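(* Let $U\subset\mathbb{R}^n$ be open and bounded, and let $\mathcal{P}_0(\xi)=\xi$ for every $\xi\in\partial U$. Assume that for all $t_0\in[0,T]$, $\xi\in\mathbb{R}^n$ and $\varepsilon\in(0,1]$ the solution $x$ of $\dot x=f(t,x)+\varepsilon g(t,x,\varepsilon)$ with $x(t_0)=\xi$ exists, is unique and extends to $[0,T]$, and that $\Phi^s(\xi)\neq0$ for every $\xi\in\partial U$ and every $s\in[0,T]$. Assume moreover that the map $\mathcal{P}_0$ has finitely many fixed points $a_1,\dots,a_k$ in $U$, and that for each $i\in\{1,\dots,k\}$ the matrix $I-(\mathcal{P}_0)'(a_i)$ is nonsingular. If $$\operatorname{ind}(a_1,I-\mathcal{P}_0)+\dots+\operatorname{ind}(a_k,I-\mathcal{P}_0)\neq d_{\mathbb{R}^n}(-\Phi^T,U),$$ then for all sufficiently small $\varepsilon>0$ the system $\dot x=f(t,x)+\varepsilon g(t,x,\varepsilon)$ has a $T$-periodic solution $x_\varepsilon$ such that $$\rho(x_\varepsilon(0),\partial U)\to0\quad\text{as }\varepsilon\to0 .$$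
   Context: $T>0$; $f:\mathbb{R}\times\mathbb{R}^n\to\mathbb{R}^n$ is continuously differentiable, $g:\mathbb{R}\times\mathbb{R}^n\times[0,1]\to\mathbb{R}^n$ is continuous, both $T$-periodic in the first variable. $\Omega(\cdot,t_0,\xi)$ is the solution of $\dot x=f(t,x)$ with value $\xi$ at time $t_0$; it is assumed that these solutions extend to $[0,T]$ for all $t_0\in[0,T]$, $\xi\in\mathbb{R}^n$. $\mathcal{P}_0(\xi)=\Omega(T,0,\xi)$. The generalized averaging operator $\Phi^s:\mathbb{R}^n\to\mathbb{R}^n$, $s\in[0,T]$, is $\Phi^s(\xi)=\eta(T,s,\xi)-\eta(0,s,\xi)$, where $\eta(\cdot,s,\xi)$ is the solution of $\dot y=f'_x(t,\Omega(t,0,\xi))y+g(t,\Omega(t,0,\xi),0)$ with $\eta(s,s,\xi)=0$ ($f'_x$ is the derivative of $f$ in the second variable). $\operatorname{ind}(a_i,I-\mathcal{P}_0)=(-1)^{\beta}$, where $\beta$ is the sum of the multiplicities of the real negative eigenvalues of $I-(\mathcal{P}_0)'(a_i)$. $d_{\mathbb{R}^n}$ is the Brouwer degree with respect to $0$; $\rho(\xi,K)=\min_{\zeta\in K}\|\xi-\zeta\|$. *)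

theory Defs
  imports "HOL-Analysis.Analysis" "HOL-Computational_Algebra.Polynomial"
begin

definition C1_on :: "'a::real_normed_vector set \<Rightarrow> ('a \<Rightarrow> 'b::real_normed_vector) \<Rightarrow> bool" where
  "C1_on S F \<longleftrightarrow>
     (\<exists>F' :: 'a \<Rightarrow> 'a \<Rightarrow>\<^sub>L 'b.
        (\<forall>x\<in>S. (F has_derivative blinfun_apply (F' x)) (at x)) \<and> continuous_on S F')"

text \<open>Solutions are considered on \<open>[0,T]\<close>, with one-sided derivatives at the end points;
  the values of \<open>x\<close> outside \<open>[0,T]\<close> are irrelevant.\<close>

definition ivp_solution ::
  "(real \<Rightarrow> 'a::real_normed_vector \<Rightarrow> 'a) \<Rightarrow> real \<Rightarrow> real \<Rightarrow> 'a \<Rightarrow> (real \<Rightarrow> 'a) \<Rightarrow> bool" where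
  "ivp_solution F T t0 \<xi> x \<longleftrightarrow>
     x t0 = \<xi> \<and> (\<forall>t\<in>{0..T}. (x has_vector_derivative F t (x t)) (at t within {0..T}))"

text \<open>The value at time \<open>t\<close> of the solution of the initial value problem; it is meaningful
  for \<open>t0\<close> and \<open>t\<close> in \<open>[0,T]\<close> when the solution exists and is unique on \<open>[0,T]\<close>.\<close>

definition ivp_value ::
  "(real \<Rightarrow> 'a::real_normed_vector \<Rightarrow> 'a) \<Rightarrow> real \<Rightarrow> real \<Rightarrow> 'a \<Rightarrow> real \<Rightarrow> 'a" where
  "ivp_value F T t0 \<xi> t = (THE v. \<exists>x. ivp_solution F T t0 \<xi> x \<and> x t = v)"

definition poincare_map ::
  "(real \<Rightarrow> 'a::real_normed_vector \<Rightarrow> 'a) \<Rightarrow> real \<Rightarrow> 'a \<Rightarrow> 'a" where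
  "poincare_map f T \<xi> = ivp_value f T 0 \<xi> T"

definition linearized_field ::
  "(real \<Rightarrow> 'a::real_normed_vector \<Rightarrow> 'a) \<Rightarrow> (real \<Rightarrow> 'a \<Rightarrow> real \<Rightarrow> 'a) \<Rightarrow> real \<Rightarrow> 'a
     \<Rightarrow> real \<Rightarrow> 'a \<Rightarrow> 'a" where
  "linearized_field f g T \<xi> t y =
     frechet_derivative (f t) (at (ivp_value f T 0 \<xi> t)) y + g t (ivp_value f T 0 \<xi> t) 0"

definition averaging_operator ::
  "(real \<Rightarrow> 'a::real_normed_vector \<Rightarrow> 'a) \<Rightarrow> (real \<Rightarrow> 'a \<Rightarrow> real \<Rightarrow> 'a) \<Rightarrow> real \<Rightarrow> real
     \<Rightarrow> 'a \<Rightarrow> 'a" where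
  "averaging_operator f g T s \<xi> =
     ivp_value (linearized_field f g T \<xi>) T s 0 T - ivp_value (linearized_field f g T \<xi>) T s 0 0"

definition jacobian_matrix :: "(real^'n \<Rightarrow> real^'n) \<Rightarrow> real^'n \<Rightarrow> real^'n^'n" where
  "jacobian_matrix F a = matrix (frechet_derivative F (at a))"

definition charpoly :: "real^'n^'n \<Rightarrow> real poly" where
  "charpoly A = det (\<chi> i j. (if i = j then monom 1 1 else 0) - [:A $ i $ j:])"

text \<open>The sum runs over the negative real eigenvalues; multiplicities are algebraic.\<close>

definition negative_eigenvalue_count :: "real^'n^'n \<Rightarrow> nat" where
  "negative_eigenvalue_count A =
     (\<Sum>\<mu> | \<mu> < 0 \<and> (\<exists>v. v \<noteq> 0 \<and> A *v v = \<mu> *\<^sub>R v). order \<mu> (charpoly A))"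

text \<open>The index of a fixed point \<open>a\<close> of \<open>P\<close> for the vector field \<open>I - P\<close>, for
  \<open>I - P'(a)\<close> nonsingular.\<close>

definition fixed_point_index :: "real^'n \<Rightarrow> (real^'n \<Rightarrow> real^'n) \<Rightarrow> int" where
  "fixed_point_index a P = (- 1) ^ negative_eigenvalue_count (mat 1 - jacobian_matrix P a)"

text \<open>The Brouwer degree with respect to \<open>0\<close> of a continuous map \<open>F\<close> on the closure of a
  bounded open set \<open>U\<close>, without zeros on the boundary: the signed number of zeros of any
  continuously differentiable map \<open>G\<close> with regular value \<open>0\<close> whose pointwise
  distance from \<open>F\<close> on the closure is less than the distance of \<open>0\<close> from the image of the
  boundary under \<open>F\<close>.
  Such \<open>G\<close> exist, and the number does not depend on \<open>G\<close>.\<close>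

definition regular_approximation ::
  "(real^'n \<Rightarrow> real^'n) \<Rightarrow> (real^'n) set \<Rightarrow> (real^'n \<Rightarrow> real^'n) \<Rightarrow> bool" where
  "regular_approximation F U G \<longleftrightarrow>
     continuous_on (closure U) G \<and> C1_on U G \<and>
     (\<forall>x\<in>closure U. dist (G x) (F x) < infdist 0 (F ` frontier U)) \<and>
     (\<forall>x\<in>U. G x = 0 \<longrightarrow> det (jacobian_matrix G x) \<noteq> 0)"

definition brouwer_degree :: "(real^'n \<Rightarrow> real^'n) \<Rightarrow> (real^'n) set \<Rightarrow> int" where
  "brouwer_degree F U =
     (THE d. \<exists>G. regular_approximation F U G \<and>
        real_of_int d = (\<Sum>x | x \<in> U \<and> G x = 0. sgn (det (jacobian_matrix G x))))"

text \<open>Here \<open>x\<close> is a solution on the whole real line.\<close>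

definition periodic_solution ::
  "(real \<Rightarrow> 'a::real_normed_vector \<Rightarrow> 'a) \<Rightarrow> real \<Rightarrow> (real \<Rightarrow> 'a) \<Rightarrow> bool" where
  "periodic_solution F T x \<longleftrightarrow>
     (\<forall>t. (x has_vector_derivative F t (x t)) (at t)) \<and> (\<forall>t. x (t + T) = x t)"

end

theory Submission
  imports Defs "HOL-Complex_Analysis.Great_Picard"
begin

text \<open>Let \<open>P_\<epsilon>\<close> be the time-\<open>T\<close> map of the perturbed system. Since \<open>P_0\<close> is the
  identity on the boundary of \<open>U\<close>, linearization gives \<open>P_\<epsilon>(\<xi>) - \<xi> = \<epsilon> \<Phi>\<^sup>0(\<xi>) + o(\<epsilon>)\<close> uniformly on the
  boundary, so for small \<open>\<epsilon>\<close> the degree of \<open>I - P_\<epsilon>\<close> on \<open>U\<close> is that of \<open>-\<Phi>\<^sup>0\<close>, which the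
  nonvanishing homotopy \<open>\<Phi>\<^sup>s\<close> identifies with that of \<open>-\<Phi>\<^sup>T\<close>. On the set of points of \<open>U\<close> at distance more than
  \<open>\<delta>\<close> from the boundary, \<open>I - P_\<epsilon>\<close> is a small perturbation of \<open>I - P_0\<close>, whose degree there is the
  sum of the indices. As the two degrees differ, \<open>P_\<epsilon>\<close> has a fixed point within \<open>\<delta>\<close> of the boundary.

  That the degree is well defined and invariant rests on the integral of \<open>det Dw\<close> being \<open>0\<close> for a
  continuously differentiable \<open>w\<close> with compact support: for large \<open>\<mu>\<close> the map \<open>\<mu> I + w\<close> is a bijection between
  boxes, so the integral of \<open>det (\<mu> I + Dw)\<close>, a polynomial in \<open>\<mu>\<close>, is \<open>\<mu>\<^sup>n\<close> times the
  volume of the box for all \<open>\<mu>\<close>, in particular for \<open>\<mu> = 0\<close>.\<close>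

section \<open>Continuously differentiable maps\<close>

text \<open>On the frontier of \<open>U\<close> the map I - P_0 vanishes identically, so it has no
  degree on \<open>U\<close>. There the term of order \<epsilon> decides, whereas away from the
  frontier the term of order 0 does. The difference between these two orders is what the theorem
  exploits. The perturbation \<open>g\<close> is merely continuous. Hence P_\<epsilon> is merely
  continuous, by a compactness argument that rests on uniqueness; derivatives are taken only at
  \<epsilon> = 0, and the degree must be handled for continuous maps. The usual proof that a
  Jacobian determinant of compact support integrates to 0 writes it as a divergence, which takes
  second derivatives; the polynomial in \<mu> works for C1 maps. Invariance follows thus: a cutoff
  yields a map equal to one end of the homotopy near the frontier and to the other end near all
  zeros. Composition with a map whose Jacobian determinant is a bump at 0 turns signed zero counts
  into integrals of Jacobian determinants, and these agree for maps that agree off a compact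
  set.\<close>

lemma C1_on_iff_frechet:
  fixes F :: "'a::euclidean_space \<Rightarrow> 'b::real_normed_vector"
  shows "C1_on S F \<longleftrightarrow> (\<forall>x\<in>S. F differentiable at x) \<and>
    (\<forall>h. continuous_on S (\<lambda>x. frechet_derivative F (at x) h))"
proof
  assume "C1_on S F"
  then obtain F' :: "'a \<Rightarrow> 'a \<Rightarrow>\<^sub>L 'b" where
    d: "\<And>x. x \<in> S \<Longrightarrow> (F has_derivative blinfun_apply (F' x)) (at x)" and c: "continuous_on S F'"
    unfolding C1_on_def by blast
  have eq: "frechet_derivative F (at x) h = blinfun_apply (F' x) h" if "x \<in> S" for x h
    using frechet_derivative_at[OF d[OF that]] by simp
  have "continuous_on S (\<lambda>x. blinfun_apply (F' x) h)" for h
    using c by (intro continuous_intros)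
  then show "(\<forall>x\<in>S. F differentiable at x) \<and>
    (\<forall>h. continuous_on S (\<lambda>x. frechet_derivative F (at x) h))"
    using d eq unfolding differentiable_def by (metis (no_types, lifting) continuous_on_cong)
next
  assume a: "(\<forall>x\<in>S. F differentiable at x) \<and>
    (\<forall>h. continuous_on S (\<lambda>x. frechet_derivative F (at x) h))"
  define F' where "F' x = Blinfun (frechet_derivative F (at x))" for x
  have app: "blinfun_apply (F' x) = frechet_derivative F (at x)" if "x \<in> S" for x
    unfolding F'_def using a that
    by (intro bounded_linear_Blinfun_apply has_derivative_bounded_linear) (auto simp: frechet_derivative_works)
  \<comment> \<open>In finite dimension continuity in each direction already gives continuity in
    operator norm.\<close>
  have "continuous_on S F'"
    using a by (intro continuous_on_blinfun_componentwise) (simp add: app cong: continuous_on_cong)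
  then show "C1_on S F"
    unfolding C1_on_def using a by (auto simp: app frechet_derivative_works intro!: exI[of _ F'])
qed

lemma C1_onI:
  fixes F :: "'a::euclidean_space \<Rightarrow> 'b::real_normed_vector"
  assumes d: "\<And>x. x \<in> S \<Longrightarrow> (F has_derivative D x) (at x)"
    and c: "\<And>h. continuous_on S (\<lambda>x. D x h)"
  shows "C1_on S F"
proof -
  have "frechet_derivative F (at x) h = D x h" if "x \<in> S" for x h
    using frechet_derivative_at[OF d[OF that]] by simp
  then show ?thesis
    unfolding C1_on_iff_frechet using d c unfolding differentiable_def
    by (metis (no_types, lifting) continuous_on_cong)
qed

lemma C1_on_has_derivative:
  fixes F :: "'a::euclidean_space \<Rightarrow> 'b::real_normed_vector"
  assumes "C1_on S F" "x \<in> S"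
  shows "(F has_derivative frechet_derivative F (at x)) (at x)"
  using assms by (simp add: C1_on_iff_frechet frechet_derivative_works)

lemma C1_on_continuous_derivative:
  fixes F :: "'a::euclidean_space \<Rightarrow> 'b::real_normed_vector"
  assumes "C1_on S F"
  shows "continuous_on S (\<lambda>x. frechet_derivative F (at x) h)"
  using assms by (simp add: C1_on_iff_frechet)

lemma C1_on_imp_continuous_on:
  fixes F :: "'a::euclidean_space \<Rightarrow> 'b::real_normed_vector"
  assumes "C1_on S F" shows "continuous_on S F"
  using C1_on_has_derivative[OF assms]
  by (meson continuous_at_imp_continuous_on has_derivative_continuous)

lemma C1_on_subset:
  fixes F :: "'a::euclidean_space \<Rightarrow> 'b::real_normed_vector"
  shows "C1_on S F \<Longrightarrow> R \<subseteq> S \<Longrightarrow> C1_on R F"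
  unfolding C1_on_def by (meson continuous_on_subset subsetD)

lemma C1_on_cong_open:
  fixes F :: "'a::euclidean_space \<Rightarrow> 'b::real_normed_vector"
  assumes "C1_on S F" "open S" "\<And>x. x \<in> S \<Longrightarrow> G x = F x"
  shows "C1_on S G"
  using assms unfolding C1_on_def
  by (metis has_derivative_transform_within_open)

lemma C1_on_Un_open:
  fixes F :: "'a::euclidean_space \<Rightarrow> 'b::real_normed_vector"
  assumes "open S" "open R" "C1_on S F" "C1_on R F"
  shows "C1_on (S \<union> R) F"
  using assms unfolding C1_on_iff_frechet by (auto intro: continuous_on_open_Un)

lemma C1_on_bounded_linear:
  fixes F :: "'a::euclidean_space \<Rightarrow> 'b::real_normed_vector"
  assumes "bounded_linear F" shows "C1_on S F"
  by (rule C1_onI[where D = "\<lambda>x. F"]) (use assms bounded_linear_imp_has_derivative in auto)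

lemma C1_on_const: "C1_on S (\<lambda>x::'a::euclidean_space. c::'b::real_normed_vector)"
  by (rule C1_onI[where D = "\<lambda>x h. 0"]) auto

lemma C1_on_add:
  fixes F G :: "'a::euclidean_space \<Rightarrow> 'b::real_normed_vector"
  assumes "C1_on S F" "C1_on S G" shows "C1_on S (\<lambda>x. F x + G x)"
proof (rule C1_onI)
  fix x assume "x \<in> S"
  show "((\<lambda>x. F x + G x) has_derivative
     (\<lambda>h. frechet_derivative F (at x) h + frechet_derivative G (at x) h)) (at x)"
    using \<open>x \<in> S\<close> assms by (intro has_derivative_add C1_on_has_derivative)
qed (intro continuous_on_add C1_on_continuous_derivative assms)

lemma C1_on_scaleR:
  fixes F :: "'a::euclidean_space \<Rightarrow> real" and G :: "'a \<Rightarrow> 'b::real_normed_vector"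
  assumes "C1_on S F" "C1_on S G" shows "C1_on S (\<lambda>x. F x *\<^sub>R G x)"
proof (rule C1_onI)
  fix x assume "x \<in> S"
  show "((\<lambda>x. F x *\<^sub>R G x) has_derivative
     (\<lambda>h. F x *\<^sub>R frechet_derivative G (at x) h + frechet_derivative F (at x) h *\<^sub>R G x)) (at x)"
    using \<open>x \<in> S\<close> assms by (intro has_derivative_scaleR C1_on_has_derivative)
qed (intro continuous_on_add continuous_on_scaleR C1_on_continuous_derivative C1_on_imp_continuous_on assms)

lemma C1_on_diff:
  fixes F G :: "'a::euclidean_space \<Rightarrow> 'b::real_normed_vector"
  assumes "C1_on S F" "C1_on S G" shows "C1_on S (\<lambda>x. F x - G x)"
  using C1_on_add[OF assms(1) C1_on_scaleR[OF C1_on_const[of _ "-1"] assms(2)]] by simp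

lemma C1_on_compose:
  fixes G :: "'a::euclidean_space \<Rightarrow> 'b::euclidean_space" and F :: "'b \<Rightarrow> 'c::real_normed_vector"
  assumes F: "C1_on R F" and G: "C1_on S G" and sub: "G ` S \<subseteq> R"
  shows "C1_on S (\<lambda>x. F (G x))"
proof -
  obtain F' :: "'b \<Rightarrow> 'b \<Rightarrow>\<^sub>L 'c" where
    dF: "\<And>x. x \<in> R \<Longrightarrow> (F has_derivative blinfun_apply (F' x)) (at x)" and cF: "continuous_on R F'"
    using F unfolding C1_on_def by blast
  obtain G' :: "'a \<Rightarrow> 'a \<Rightarrow>\<^sub>L 'b" where
    dG: "\<And>x. x \<in> S \<Longrightarrow> (G has_derivative blinfun_apply (G' x)) (at x)" and cG: "continuous_on S G'"
    using G unfolding C1_on_def by blast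
  show ?thesis
  proof (rule C1_onI)
    fix x assume "x \<in> S"
    then show "((\<lambda>x. F (G x)) has_derivative (\<lambda>h. F' (G x) (G' x h))) (at x)"
      using has_derivative_compose[OF dG dF, of x] sub by (auto simp: o_def)
  next
    fix h
    have "continuous_on S (\<lambda>x. F' (G x))"
      using continuous_on_compose2[OF cF C1_on_imp_continuous_on[OF G]] sub by auto
    then show "continuous_on S (\<lambda>x. F' (G x) (G' x h))"
      using cG by (intro continuous_intros)
  qed
qed

lemma C1_on_vec:
  fixes F :: "'a::euclidean_space \<Rightarrow> real^'n"
  assumes "\<And>i. C1_on S (\<lambda>x. F x $ i)" shows "C1_on S F"
proof -
  have "C1_on S (\<lambda>x. \<Sum>i\<in>A. F x $ i *\<^sub>R axis i 1)" for A :: "'n set"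
    by (induction A rule: infinite_finite_induct) (auto intro!: C1_on_const C1_on_add C1_on_scaleR assms)
  moreover have "F x = (\<Sum>i\<in>UNIV. F x $ i *\<^sub>R axis i 1)" for x
    using basis_expansion[of "F x"] by (simp add: scalar_mult_eq_scaleR)
  ultimately show ?thesis by (metis (no_types, lifting) ext)
qed

lemma C1_on_prod:
  fixes F :: "'i \<Rightarrow> 'a::euclidean_space \<Rightarrow> real"
  assumes "\<And>i. i \<in> A \<Longrightarrow> C1_on S (F i)" shows "C1_on S (\<lambda>x. \<Prod>i\<in>A. F i x)"
  using assms
proof (induction A rule: infinite_finite_induct)
  case (insert a A)
  then show ?case using C1_on_scaleR[of S "F a" "\<lambda>x. \<Prod>i\<in>A. F i x"] by auto
qed (auto intro: C1_on_const)

lemma C1_on_real_polynomial_function: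
  fixes F :: "'a::euclidean_space \<Rightarrow> real"
  assumes "real_polynomial_function F" shows "C1_on S F"
  using assms
proof induction
  case (mult f g)
  then show ?case using C1_on_scaleR[of S f g] by auto
qed (auto intro: C1_on_const C1_on_add C1_on_bounded_linear)

lemma C1_on_polynomial_function:
  fixes F :: "'a::euclidean_space \<Rightarrow> real^'n"
  assumes "polynomial_function F" shows "C1_on S F"
proof (rule C1_on_vec)
  fix i
  have "real_polynomial_function ((\<lambda>v. v $ i) \<circ> F)"
    using assms bounded_linear_vec_nth unfolding polynomial_function_def by blast
  then show "C1_on S (\<lambda>x. F x $ i)"
    using C1_on_real_polynomial_function by (auto simp: o_def)
qed

section \<open>Jacobian matrices and their determinants\<close>

lemma matrix_component: "matrix D $ i $ j = D (axis j 1) $ i"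
  by (simp add: matrix_def)

lemma continuous_on_det:
  fixes M :: "'a::topological_space \<Rightarrow> real^'n^'n"
  assumes "\<And>i j. continuous_on S (\<lambda>x. M x $ i $ j)"
  shows "continuous_on S (\<lambda>x. det (M x))"
  unfolding det_def by (intro continuous_intros assms)

lemma C1_on_continuous_jacobian:
  fixes F :: "real^'n \<Rightarrow> real^'n"
  assumes "C1_on S F" shows "continuous_on S (\<lambda>x. jacobian_matrix F x $ i $ j)"
  unfolding jacobian_matrix_def matrix_component
  by (intro continuous_on_component C1_on_continuous_derivative assms)

lemma C1_on_continuous_det_jacobian:
  fixes F :: "real^'n \<Rightarrow> real^'n"
  assumes "C1_on S F" shows "continuous_on S (\<lambda>x. det (jacobian_matrix F x))"
  by (intro continuous_on_det C1_on_continuous_jacobian assms)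

lemma jacobian_matrix_eq:
  fixes F :: "real^'n \<Rightarrow> real^'n"
  assumes "(F has_derivative D) (at x)"
  shows "jacobian_matrix F x = matrix D"
  unfolding jacobian_matrix_def using frechet_derivative_at[OF assms] by simp

text \<open>Both maps have the same derivatives at \<open>x\<close>, so the choice operator inside
  \<open>frechet_derivative\<close> returns the same value for both, even where neither is
  differentiable.\<close>

lemma jacobian_matrix_cong_open:
  fixes F G :: "real^'n \<Rightarrow> real^'n"
  assumes "open S" "x \<in> S" "\<And>y. y \<in> S \<Longrightarrow> F y = G y"
  shows "jacobian_matrix F x = jacobian_matrix G x"
proof -
  have "(F has_derivative D) (at x) \<longleftrightarrow> (G has_derivative D) (at x)" for D
    using has_derivative_transform_within_open[OF _ assms(1,2)] assms(3) by metis
  then show ?thesis unfolding jacobian_matrix_def frechet_derivative_def by simp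
qed

lemma poly_det: "poly (det P) x = det (\<chi> i j. poly (P $ i $ j) (x::real))"
  for P :: "real poly^'n^'n"
  unfolding det_def by (simp add: poly_sum poly_prod)

lemma poly_charpoly: "poly (charpoly A) x = det (mat x - A)"
  unfolding charpoly_def poly_det
  by (intro arg_cong[where f = det]) (auto simp: vec_eq_iff mat_def poly_monom)

text \<open>Polynomials whose coefficients depend continuously on a parameter and whose degrees are bounded, so that
  they can be integrated coefficientwise.\<close>

definition cpoly :: "'a::topological_space set \<Rightarrow> ('a \<Rightarrow> real poly) \<Rightarrow> bool" where
  "cpoly S p \<longleftrightarrow> (\<exists>N. \<forall>x. degree (p x) \<le> N) \<and> (\<forall>k. continuous_on S (\<lambda>x. coeff (p x) k))"

lemma cpoly_const: "cpoly S (\<lambda>x. c)"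
  unfolding cpoly_def by auto

lemma cpoly_add: "cpoly S p \<Longrightarrow> cpoly S q \<Longrightarrow> cpoly S (\<lambda>x. p x + q x)"
  unfolding cpoly_def
proof (intro conjI allI; (elim conjE exE)?)
  fix N M assume "\<forall>x. degree (p x) \<le> N" "\<forall>x. degree (q x) \<le> M"
  then show "\<exists>N. \<forall>x. degree (p x + q x) \<le> N"
    by (intro exI[of _ "max N M"]) (meson degree_add_le_max le_max_iff_disj max.mono order_trans)
qed (auto intro!: continuous_intros)

lemma cpoly_mult: "cpoly S p \<Longrightarrow> cpoly S q \<Longrightarrow> cpoly S (\<lambda>x. p x * q x)"
  unfolding cpoly_def
proof (intro conjI allI; (elim conjE exE)?)
  fix N M assume "\<forall>x. degree (p x) \<le> N" "\<forall>x. degree (q x) \<le> M"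
  then show "\<exists>N. \<forall>x. degree (p x * q x) \<le> N"
    by (intro exI[of _ "N + M"]) (meson degree_mult_le add_mono order_trans)
qed (auto intro!: continuous_intros simp: coeff_mult)

lemma cpoly_sum: "(\<And>i. i \<in> A \<Longrightarrow> cpoly S (p i)) \<Longrightarrow> cpoly S (\<lambda>x. \<Sum>i\<in>A. p i x)"
  by (induction A rule: infinite_finite_induct) (auto intro: cpoly_add cpoly_const)

lemma cpoly_prod: "(\<And>i. i \<in> A \<Longrightarrow> cpoly S (p i)) \<Longrightarrow> cpoly S (\<lambda>x. \<Prod>i\<in>A. p i x)"
  by (induction A rule: infinite_finite_induct) (auto intro: cpoly_mult cpoly_const)

lemma cpoly_charpoly:
  fixes M :: "'a::topological_space \<Rightarrow> real^'n^'n"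
  assumes "\<And>i j. continuous_on S (\<lambda>x. M x $ i $ j)"
  shows "cpoly S (\<lambda>x. charpoly (M x))"
proof -
  have "cpoly S (\<lambda>x. (if i = j then monom 1 1 else 0) - [:M x $ i $ j:])" for i j
  proof -
    have "cpoly S (\<lambda>x. [:- M x $ i $ j:])"
      unfolding cpoly_def
    proof (intro conjI allI)
      fix k show "continuous_on S (\<lambda>x. coeff [:- M x $ i $ j:] k)"
        using assms[of i j] by (cases k) (auto intro!: continuous_intros)
    qed (auto intro!: exI[of _ 0])
    from cpoly_add[OF cpoly_const this, of "if i = j then monom 1 1 else 0"] show ?thesis
      by (simp add: diff_conv_add_uminus del: add_uminus_conv_diff)
  qed
  then show ?thesis
    unfolding charpoly_def det_def by (auto intro!: cpoly_sum cpoly_mult cpoly_prod cpoly_const)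
qed

section \<open>The integral of a Jacobian determinant\<close>

text \<open>The derivative is bounded on \<open>C\<close> by compactness and vanishes off
  \<open>C\<close>; the mean value inequality on the whole space turns this bound into a Lipschitz
  constant.\<close>

lemma C1_compact_support_lipschitz:
  fixes w :: "'a::euclidean_space \<Rightarrow> 'b::real_normed_vector"
  assumes w: "C1_on UNIV w" and C: "compact C" "\<And>x. x \<notin> C \<Longrightarrow> w x = 0"
  obtains L where "L > 0" "\<And>x h. norm (frechet_derivative w (at x) h) \<le> L * norm h"
    "\<And>x y. norm (w x - w y) \<le> L * norm (x - y)"
proof -
  obtain w' :: "'a \<Rightarrow> 'a \<Rightarrow>\<^sub>L 'b" where
    d: "\<And>x. (w has_derivative blinfun_apply (w' x)) (at x)" and c: "continuous_on UNIV w'"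
    using w unfolding C1_on_def by blast
  have "bounded (w' ` C)"
    using c C(1) by (meson compact_continuous_image compact_imp_bounded continuous_on_subset subset_UNIV)
  then obtain B where B: "B > 0" "\<And>x. x \<in> C \<Longrightarrow> norm (w' x) \<le> B"
    by (auto simp: bounded_pos)
  have w'0: "blinfun_apply (w' x) = (\<lambda>h. 0)" if "x \<notin> C" for x
  proof -
    have "((\<lambda>x. 0) has_derivative blinfun_apply (w' x)) (at x)"
      by (rule has_derivative_transform_within_open[OF d, of "- C"]) (use C that in \<open>auto intro: compact_imp_closed\<close>)
    then show ?thesis using has_derivative_unique has_derivative_const by blast
  qed
  have bd: "norm (w' x h) \<le> B * norm h" for x h
  proof (cases "x \<in> C")
    case True
    then show ?thesis
      by (meson B(2) mult_right_mono norm_blinfun norm_ge_zero order_trans)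
  qed (use B w'0 in auto)
  show ?thesis
  proof
    show "B > 0" by fact
    show "norm (frechet_derivative w (at x) h) \<le> B * norm h" for x h
      using bd[of x h] frechet_derivative_at[OF d[of x]] by simp
    have "onorm (blinfun_apply (w' x)) \<le> B" for x
      using bd by (intro onorm_le)
    then show "norm (w x - w y) \<le> B * norm (x - y)" for x y
      using differentiable_bound[OF convex_UNIV d] by blast
  qed
qed

lemma det_scaleR:
  fixes A :: "real^'n^'n"
  shows "det (c *\<^sub>R A) = c ^ CARD('n) * det A"
proof -
  have "det (c *\<^sub>R A) = (\<Sum>p | p permutes UNIV. c ^ CARD('n) * (of_int (sign p) * (\<Prod>i\<in>UNIV. A $ i $ p i)))"
    unfolding det_def
    by (rule sum.cong) (simp_all add: prod.distrib)
  then show ?thesis unfolding det_def sum_distrib_left .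
qed

text \<open>For \<open>t\<close> in [0,1] the matrix I + tM has trivial kernel, so its determinant
  keeps the sign it has at \<open>t = 0\<close>.\<close>

lemma det_id_plus_positive:
  fixes M :: "real^'n^'n"
  assumes "\<And>h. norm (M *v h) \<le> L * norm h" "L < 1" "0 \<le> L"
  shows "det (mat 1 + M) > 0"
proof -
  have nz: "det (mat 1 + t *\<^sub>R M) \<noteq> 0" if t: "t \<in> {0..1}" for t
  proof
    assume "det (mat 1 + t *\<^sub>R M) = 0"
    then have "\<not> invertible (mat 1 + t *\<^sub>R M)"
      by (simp add: invertible_det_nz)
    then obtain h where h: "h \<noteq> 0" "(mat 1 + t *\<^sub>R M) *v h = 0"
      unfolding invertible_left_inverse matrix_left_invertible_ker by blast
    then have "h = - (t *\<^sub>R (M *v h))"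
      by (simp add: matrix_vector_mult_add_rdistrib scaleR_matrix_vector_assoc add_eq_0_iff2)
    then have "norm h = t * norm (M *v h)"
      using t by (metis abs_of_nonneg atLeastAtMost_iff norm_minus_cancel norm_scaleR)
    also have "\<dots> \<le> 1 * norm (M *v h)"
      using t by (intro mult_right_mono) auto
    also have "\<dots> < norm h"
      using assms(1)[of h] assms(2) h(1) by (smt (verit) mult_less_cancel_right2 zero_less_norm_iff)
    finally show False by simp
  qed
  have "continuous_on {0..1} (\<lambda>t. det (mat 1 + t *\<^sub>R M))"
    by (intro continuous_on_det) (auto intro!: continuous_intros)
  then have conn: "connected ((\<lambda>t. det (mat 1 + t *\<^sub>R M)) ` {0..1})"
    by (intro connected_continuous_image) auto
  show ?thesis
  proof (rule ccontr)
    assume "\<not> ?thesis"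
    then have "det (mat 1 + (1::real) *\<^sub>R M) \<le> 0" by simp
    moreover have "det (mat 1 + (0::real) *\<^sub>R M) = 1" by simp
    ultimately have "0 \<in> (\<lambda>t. det (mat 1 + t *\<^sub>R M)) ` {0..1}"
      by (intro connectedD_interval[OF conn, of "det (mat 1 + (1::real) *\<^sub>R M)" "det (mat 1 + (0::real) *\<^sub>R M)" 0])
        (auto intro: image_eqI[where x = 1] image_eqI[where x = 0])
    then show False using nz by force
  qed
qed

lemma id_plus_contraction_surj:
  fixes v :: "'a::euclidean_space \<Rightarrow> 'a"
  assumes "\<And>x y. norm (v x - v y) \<le> L * norm (x - y)" "0 \<le> L" "L < 1"
  shows "\<exists>x. x + v x = y"
proof -
  have "\<exists>!x. y - v x = x"
    using assms by (intro banach_fix_type[of L]) (auto simp: dist_norm norm_minus_commute)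
  then show ?thesis by (metis diff_add_cancel)
qed

lemma integral_det_id_plus:
  fixes v :: "real^'n::{finite,wellorder} \<Rightarrow> real^'n::_"
  assumes v: "C1_on UNIV v" and C: "\<And>x. x \<notin> C \<Longrightarrow> v x = 0" "C \<subseteq> cbox a b"
    and dL: "\<And>x h. norm (frechet_derivative v (at x) h) \<le> L * norm h"
    and lip: "\<And>x y. norm (v x - v y) \<le> L * norm (x - y)" and L: "0 \<le> L" "L < 1"
  shows "integral (cbox a b) (\<lambda>x. det (mat 1 + jacobian_matrix v x)) = measure lebesgue (cbox a b)"
proof -
  let ?\<phi> = "\<lambda>x. x + v x"
  have inj: "inj ?\<phi>"
  proof (rule injI)
    fix x y assume "x + v x = y + v y"
    then have "x - y = v y - v x" by (simp add: algebra_simps)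
    then have "norm (x - y) = norm (v x - v y)" by (simp add: norm_minus_commute)
    then have "norm (x - y) \<le> L * norm (x - y)" using lip[of x y] by simp
    then show "x = y" using L by (smt (verit) mult_less_cancel_right2 right_minus_eq zero_less_norm_iff)
  qed
  have img: "?\<phi> ` cbox a b = cbox a b"
  proof
    show "cbox a b \<subseteq> ?\<phi> ` cbox a b"
    proof
      fix y assume y: "y \<in> cbox a b"
      obtain x where x: "x + v x = y" using id_plus_contraction_surj[OF lip L] by blast
      have "x \<in> cbox a b"
      proof (rule ccontr)
        assume "x \<notin> cbox a b"
        then have "v x = 0" using C by blast
        then show False using x y \<open>x \<notin> cbox a b\<close> by simp
      qed
      then show "y \<in> ?\<phi> ` cbox a b" using x by blast
    qed
    show "?\<phi> ` cbox a b \<subseteq> cbox a b"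
    proof clarify
      fix x assume x: "x \<in> cbox a b"
      show "x + v x \<in> cbox a b"
      proof (rule ccontr)
        assume n: "x + v x \<notin> cbox a b"
        \<comment> \<open>Points outside the box are fixed, so \<open>x + v x\<close> would be the
          image of itself and of \<open>x\<close>.\<close>
        then have "?\<phi> (x + v x) = ?\<phi> x" using C by auto
        then show False using injD[OF inj] n x by metis
      qed
    qed
  qed
  have J: "matrix (\<lambda>h. h + frechet_derivative v (at x) h) = mat 1 + jacobian_matrix v x" for x
  proof -
    have "axis j (1::real) $ i = (if i = j then 1 else 0)" for i j :: "'n::{finite,wellorder}" by (simp add: axis_def)
    then show ?thesis unfolding vec_eq_iff by (simp add: jacobian_matrix_def matrix_component mat_def)
  qed
  have der: "(?\<phi> has_derivative (\<lambda>h. h + frechet_derivative v (at x) h)) (at x within cbox a b)" for x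
    by (rule has_derivative_at_withinI) (intro has_derivative_add has_derivative_ident C1_on_has_derivative[OF v] UNIV_I)
  have Mv: "jacobian_matrix v x *v h = frechet_derivative v (at x) h" for x h
    using C1_on_has_derivative[OF v, of x] unfolding jacobian_matrix_def
    by (simp add: matrix_works has_derivative_linear)
  have pos: "det (mat 1 + jacobian_matrix v x) > 0" for x
    using det_id_plus_positive[of "jacobian_matrix v x" L] dL L Mv by simp
  have "continuous_on (cbox a b) (\<lambda>x. det (mat 1 + jacobian_matrix v x))"
    by (intro continuous_on_det)
      (auto intro!: continuous_intros C1_on_continuous_jacobian C1_on_subset[OF v])
  then have int: "(\<lambda>x. det (mat 1 + jacobian_matrix v x)) integrable_on cbox a b"
    by (rule integrable_continuous)
  have "measure lebesgue (?\<phi> ` cbox a b) =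
     integral (cbox a b) (\<lambda>x. \<bar>det (matrix (\<lambda>h. h + frechet_derivative v (at x) h))\<bar>)"
    using measure_differentiable_image_eq[of "cbox a b" ?\<phi> "\<lambda>x h. h + frechet_derivative v (at x) h"]
      der inj int pos J by (simp add: inj_on_subset abs_of_pos)
  then show ?thesis
    using img J pos by (simp add: abs_of_pos)
qed

lemma integral_det_jacobian_compact_support:
  fixes w :: "real^'n::{finite,wellorder} \<Rightarrow> real^'n::_"
  assumes w: "C1_on UNIV w" and C: "compact C" "\<And>x. x \<notin> C \<Longrightarrow> w x = 0" "C \<subseteq> cbox a b"
  shows "integral (cbox a b) (\<lambda>x. det (jacobian_matrix w x)) = 0"
proof -
  obtain L where L: "L > 0" "\<And>x h. norm (frechet_derivative w (at x) h) \<le> L * norm h"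
    "\<And>x y. norm (w x - w y) \<le> L * norm (x - y)"
    using C1_compact_support_lipschitz[OF w C(1,2)] by metis
  \<comment> \<open>The value of \<open>p x\<close> at \<mu> is det(\<mu> I + Dw(x)). Its
    coefficients are integrated one by one to obtain the polynomial \<open>q\<close>.\<close>
  define p where "p x = charpoly (- jacobian_matrix w x)" for x
  have "cpoly (cbox a b) p"
    unfolding p_def by (intro cpoly_charpoly)
      (auto intro!: continuous_intros C1_on_continuous_jacobian C1_on_subset[OF w])
  then obtain N where N: "\<And>x. degree (p x) \<le> N" and cont: "\<And>k. continuous_on (cbox a b) (\<lambda>x. coeff (p x) k)"
    unfolding cpoly_def by blast
  define q where "q = (\<Sum>k\<le>N. monom (integral (cbox a b) (\<lambda>x. coeff (p x) k)) k)"
  have pd: "poly (p x) \<mu> = det (mat \<mu> + jacobian_matrix w x)" for x \<mu>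
    unfolding p_def poly_charpoly by simp
  have q: "poly q \<mu> = integral (cbox a b) (\<lambda>x. det (mat \<mu> + jacobian_matrix w x))" for \<mu>
  proof -
    have "det (mat \<mu> + jacobian_matrix w x) = (\<Sum>k\<le>N. coeff (p x) k * \<mu> ^ k)" for x
      using poly_as_sum_of_monoms'[OF N, of x] pd[of x \<mu>]
      by (metis (mono_tags, lifting) poly_monom poly_sum sum.cong)
    then show ?thesis
      unfolding q_def
      by (simp add: poly_sum poly_monom integral_sum integrable_continuous cont continuous_on_mult_right)
  qed
  \<comment> \<open>For \<mu> > L the map w/\<mu> has Lipschitz constant L/\<mu> < 1; pulling \<mu>
    out of each row gives the power.\<close>
  have big: "poly q \<mu> = \<mu> ^ CARD('n) * measure lebesgue (cbox a b)" if "\<mu> > L" for \<mu>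
  proof -
    have mu: "\<mu> > 0" using that L by simp
    let ?v = "\<lambda>x. (1 / \<mu>) *\<^sub>R w x"
    have d: "(?v has_derivative (\<lambda>h. (1 / \<mu>) *\<^sub>R frechet_derivative w (at x) h)) (at x)" for x
      using C1_on_has_derivative[OF w, of x] by (auto intro!: derivative_eq_intros)
    have fd: "frechet_derivative ?v (at x) h = (1 / \<mu>) *\<^sub>R frechet_derivative w (at x) h" for x h
      by (rule fun_cong[OF frechet_derivative_at[OF d[of x], symmetric]])
    have jv: "jacobian_matrix ?v x = (1 / \<mu>) *\<^sub>R jacobian_matrix w x" for x
      using jacobian_matrix_eq[OF d] by (simp add: jacobian_matrix_def matrix_def vec_eq_iff)
    have "integral (cbox a b) (\<lambda>x. det (mat 1 + jacobian_matrix ?v x)) = measure lebesgue (cbox a b)"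
    proof (rule integral_det_id_plus)
      show "C1_on UNIV ?v" by (intro C1_on_scaleR C1_on_const w)
      show "norm (frechet_derivative ?v (at x) h) \<le> L / \<mu> * norm h" for x h
        unfolding fd norm_scaleR using L(2)[of x h] mu by (simp add: divide_right_mono)
      show "norm (?v x - ?v y) \<le> L / \<mu> * norm (x - y)" for x y
        using L(3)[of x y] mu unfolding scaleR_right_diff_distrib[symmetric] norm_scaleR
        by (simp add: divide_right_mono)
    qed (use C mu L that in auto)
    moreover have "det (mat \<mu> + jacobian_matrix w x) = \<mu> ^ CARD('n) * det (mat 1 + jacobian_matrix ?v x)" for x
    proof -
      have "mat \<mu> + jacobian_matrix w x = \<mu> *\<^sub>R (mat 1 + jacobian_matrix ?v x)"
        using mu unfolding vec_eq_iff by (simp add: jv mat_def distrib_left)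
      also have "det \<dots> = \<mu> ^ CARD('n) * det (mat 1 + jacobian_matrix ?v x)"
        by (simp add: det_scaleR)
      finally show ?thesis .
    qed
    ultimately show ?thesis unfolding q by simp
  qed
  have "q - monom (measure lebesgue (cbox a b)) (CARD('n)) = 0"
  proof (rule ccontr)
    assume "q - monom (measure lebesgue (cbox a b)) (CARD('n)) \<noteq> 0"
    then have "finite {\<mu>. poly (q - monom (measure lebesgue (cbox a b)) (CARD('n))) \<mu> = 0}"
      by (rule poly_roots_finite)
    moreover have "{L<..} \<subseteq> {\<mu>. poly (q - monom (measure lebesgue (cbox a b)) (CARD('n))) \<mu> = 0}"
      using big by (auto simp: poly_monom)
    ultimately show False using infinite_Ioi finite_subset by blast
  qed
  \<comment> \<open>The monomial has degree \<open>CARD('n)\<close>, which is positive, so it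
    vanishes at 0.\<close>
  then have "poly q 0 = 0" by (simp add: poly_monom)
  moreover have "mat (0::real) = (0 :: real^'n::{finite,wellorder}^'n::_)" unfolding vec_eq_iff by (simp add: mat_def)
  ultimately show ?thesis unfolding q by simp
qed

section \<open>Continuously differentiable cutoff functions\<close>

definition tent :: "real \<Rightarrow> real" where
  "tent t = max 0 (t + 1) - 2 * max 0 t + max 0 (t - 1)"

text \<open>An antiderivative of \<open>tent\<close>, rising from 0 to 1 on [-1,1]. Both are written
  as second differences of a power of \<open>max 0 t\<close>, so that the only point needing a
  separate limit is the kink handled in \<open>max_square_has_derivative\<close>.\<close>

definition smooth_step :: "real \<Rightarrow> real" where
  "smooth_step t = ((max 0 (t + 1))\<^sup>2 - 2 * (max 0 t)\<^sup>2 + (max 0 (t - 1))\<^sup>2) / 2"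

lemma max_square_has_derivative:
  "((\<lambda>t. (max 0 t)\<^sup>2) has_real_derivative 2 * max 0 t) (at (t::real))"
proof (cases "t = 0")
  case True
  have "((\<lambda>h::real. (max 0 h)\<^sup>2 / h) \<longlongrightarrow> 0) (at 0)"
  proof (rule Lim_null_comparison)
    have "norm ((max 0 h)\<^sup>2 / h) \<le> \<bar>h\<bar>" for h :: real
      by (cases "h > 0") (auto simp: power2_eq_square)
    then show "\<forall>\<^sub>F h in at (0::real). norm ((max 0 h)\<^sup>2 / h) \<le> \<bar>h\<bar>" by simp
    show "((\<lambda>h::real. \<bar>h\<bar>) \<longlongrightarrow> 0) (at 0)" by (intro tendsto_eq_intros) auto
  qed
  then show ?thesis using True by (simp add: DERIV_def)
next
  case False
  show ?thesis
  proof (cases "t > 0")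
    case True
    have "((\<lambda>t::real. t\<^sup>2) has_real_derivative 2 * t) (at t)" by (auto intro!: derivative_eq_intros)
    from has_field_derivative_transform_within_open[OF this, of "{0<..}" "\<lambda>t. (max 0 t)\<^sup>2"] True
    show ?thesis by auto
  next
    case f: False
    have "((\<lambda>t::real. 0) has_real_derivative 0) (at t)" by simp
    from has_field_derivative_transform_within_open[OF this, of "{..<0}" "\<lambda>t. (max 0 t)\<^sup>2"] f False
    show ?thesis by auto
  qed
qed

lemma smooth_step_has_derivative: "(smooth_step has_real_derivative tent t) (at t)"
proof -
  have "((\<lambda>t. (max 0 (t + c))\<^sup>2) has_real_derivative 2 * max 0 (t + c)) (at t)" for c t :: real
  proof -
    have "((\<lambda>t. t + c) has_real_derivative 1) (at t)" by (auto intro!: derivative_eq_intros)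
    from DERIV_chain2[OF max_square_has_derivative this] show ?thesis by simp
  qed
  note d = this[of 1 t] this[of 0 t] this[of "-1" t]
  have "(smooth_step has_real_derivative
    (2 * max 0 (t + 1) - 2 * (2 * max 0 (t + 0)) + 2 * max 0 (t + -1)) / 2) (at t)"
    unfolding smooth_step_def[abs_def] using d
    by (intro DERIV_cdivide DERIV_add DERIV_diff DERIV_cmult) simp_all
  then show ?thesis by (simp add: tent_def add_divide_distrib diff_divide_distrib)
qed

lemma continuous_tent [continuous_intros]:
  "continuous_on S f \<Longrightarrow> continuous_on S (\<lambda>x. tent (f x))"
  unfolding tent_def
  by (intro continuous_on_add continuous_on_diff continuous_on_mult continuous_on_max continuous_on_const)

lemma tent_nonneg: "0 \<le> tent t" and tent_0: "tent 0 = 1"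
  and tent_outside: "1 \<le> \<bar>t\<bar> \<Longrightarrow> tent t = 0"
  unfolding tent_def by (auto simp: max_def)

lemma smooth_step_le: "t \<le> -1 \<Longrightarrow> smooth_step t = 0"
  unfolding smooth_step_def by simp

lemma smooth_step_ge: "1 \<le> t \<Longrightarrow> smooth_step t = 1"
  unfolding smooth_step_def by (simp add: power2_eq_square algebra_simps)

lemma smooth_step_mono: "s \<le> t \<Longrightarrow> smooth_step s \<le> smooth_step t"
  by (rule DERIV_nonneg_imp_nondecreasing) (use smooth_step_has_derivative tent_nonneg in blast)+

lemma smooth_step_bounds: "0 \<le> smooth_step t" "smooth_step t \<le> 1"
  using smooth_step_mono[of "min t (-1)" t] smooth_step_mono[of t "max t 1"]
    smooth_step_le[of "min t (-1)"] smooth_step_ge[of "max t 1"] by auto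

lemma C1_on_smooth_step: "C1_on S smooth_step"
proof (rule C1_onI)
  show "(smooth_step has_derivative (\<lambda>h. tent t * h)) (at t)" for t
    using smooth_step_has_derivative[of t] by (simp add: has_field_derivative_def)
qed (intro continuous_intros)

lemma cutoff_ball:
  fixes a :: "'a::euclidean_space"
  assumes r: "r > 0"
  shows "\<exists>b::'a \<Rightarrow> real. C1_on UNIV b \<and> (\<forall>x. 0 \<le> b x \<and> b x \<le> 1) \<and>
     (\<forall>x\<in>ball a r. b x = 1) \<and> (\<forall>x. x \<notin> cball a (2 * r) \<longrightarrow> b x = 0)"
proof -
  \<comment> \<open>With this constant \<open>?q x\<close> is 3 - 2 |x - a|^2 / r^2: at least 1
    within distance \<open>r\<close> of \<open>a\<close>, and at most -1 from distance sqrt(2) r on,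
    hence outside radius \<open>2 * r\<close>. The squared distance is differentiable at the centre
    too.\<close>
  define c where "c = 2 / r\<^sup>2"
  let ?q = "\<lambda>x. 3 - c * ((x - a) \<bullet> (x - a))"
  let ?b = "\<lambda>x. smooth_step (?q x)"
  show ?thesis
  proof (intro exI[of _ ?b] conjI ballI allI impI)
  have "C1_on UNIV ?q"
  proof (rule C1_onI)
    show "(?q has_derivative (\<lambda>h. - (c * ((x - a) \<bullet> h + h \<bullet> (x - a))))) (at x)" for x
      by (auto intro!: derivative_eq_intros)
  qed (intro continuous_intros)
  then show "C1_on UNIV ?b"
    by (intro C1_on_compose[OF C1_on_smooth_step]) auto
  show "0 \<le> ?b x" "?b x \<le> 1" for x by (rule smooth_step_bounds)+
  have q: "?q x = 3 - 2 * (dist a x)\<^sup>2 / r\<^sup>2" for x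
    unfolding dist_commute[of a x] dist_norm[of x a] power2_norm_eq_inner c_def by simp
  show "?b x = 1" if "x \<in> ball a r" for x
  proof (rule smooth_step_ge)
    have "(dist a x)\<^sup>2 \<le> r\<^sup>2" using that by (intro power_mono) auto
    then show "1 \<le> ?q x" unfolding q using r by (simp add: field_simps)
  qed
  show "?b x = 0" if "x \<notin> cball a (2 * r)" for x
  proof (rule smooth_step_le)
    have "(2 * r)\<^sup>2 \<le> (dist a x)\<^sup>2" using that r by (intro power_mono) auto
    moreover have "2 * r\<^sup>2 \<le> (2 * r)\<^sup>2" by (simp add: power_mult_distrib)
    ultimately have "2 * r\<^sup>2 \<le> (dist a x)\<^sup>2" by linarith
    then show "?q x \<le> -1" unfolding q using r by (simp add: field_simps)
  qed
qed
qed

text \<open>Having \<open>k = 1\<close> on a neighbourhood \<open>W\<close> of \<open>K\<close>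
  leaves Jacobian matrices on \<open>K\<close> unchanged when maps are modified by \<open>k\<close>;
  having \<open>k = 0\<close> off a compact \<open>C\<close> inside \<open>U\<close> allows maps
  given on \<open>U\<close> to be extended by 0.\<close>

lemma C1_cutoff:
  fixes K U :: "'a::euclidean_space set"
  assumes K: "compact K" and U: "open U" "K \<subseteq> U"
  obtains k :: "'a \<Rightarrow> real" and W C where "C1_on UNIV k" "\<And>x. 0 \<le> k x \<and> k x \<le> 1"
    "open W" "K \<subseteq> W" "\<And>x. x \<in> W \<Longrightarrow> k x = 1"
    "compact C" "C \<subseteq> U" "\<And>x. x \<notin> C \<Longrightarrow> k x = 0"
proof -
  have "\<forall>x\<in>K. \<exists>r. r > 0 \<and> cball x (2 * r) \<subseteq> U"
  proof
    fix x assume "x \<in> K"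
    then obtain e where e: "e > 0" "cball x e \<subseteq> U" using U open_contains_cball by blast
    then have "e / 2 > 0 \<and> cball x (2 * (e / 2)) \<subseteq> U" by simp
    then show "\<exists>r. r > 0 \<and> cball x (2 * r) \<subseteq> U" ..
  qed
  then obtain r where r: "\<And>x. x \<in> K \<Longrightarrow> r x > 0 \<and> cball x (2 * r x) \<subseteq> U"
    using bchoice[of K "\<lambda>x r. r > 0 \<and> cball x (2 * r) \<subseteq> U"] by blast
  have "\<forall>x\<in>K. \<exists>b::'a \<Rightarrow> real. C1_on UNIV b \<and> (\<forall>y. 0 \<le> b y \<and> b y \<le> 1) \<and>
     (\<forall>y\<in>ball x (r x). b y = 1) \<and> (\<forall>y. y \<notin> cball x (2 * r x) \<longrightarrow> b y = 0)"
  proof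
    fix x assume "x \<in> K"
    with r have "r x > 0" by blast
    from cutoff_ball[OF this, of x] show "\<exists>b::'a \<Rightarrow> real. C1_on UNIV b \<and> (\<forall>y. 0 \<le> b y \<and> b y \<le> 1) \<and>
       (\<forall>y\<in>ball x (r x). b y = 1) \<and> (\<forall>y. y \<notin> cball x (2 * r x) \<longrightarrow> b y = 0)" .
  qed
  from bchoice[OF this] obtain b where b: "\<And>x. x \<in> K \<Longrightarrow> C1_on UNIV (b x :: 'a \<Rightarrow> real)"
     "\<And>x y. x \<in> K \<Longrightarrow> 0 \<le> b x y \<and> b x y \<le> 1" "\<And>x y. x \<in> K \<Longrightarrow> y \<in> ball x (r x) \<Longrightarrow> b x y = 1"
     "\<And>x y. x \<in> K \<Longrightarrow> y \<notin> cball x (2 * r x) \<Longrightarrow> b x y = 0" by blast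
  obtain D where D: "D \<subseteq> K" "finite D" "K \<subseteq> (\<Union>x\<in>D. ball x (r x))"
  proof (rule compactE_image[OF K, of K "\<lambda>x. ball x (r x)"])
    show "K \<subseteq> (\<Union>x\<in>K. ball x (r x))" using r by force
  qed auto
  \<comment> \<open>This combination is 1 as soon as one bump is 1, and 0 where all of them
    vanish.\<close>
  let ?k = "\<lambda>y. 1 - (\<Prod>x\<in>D. (1 - b x y))"
  show ?thesis
  proof
    show "C1_on UNIV ?k" by (rule C1_on_diff[OF C1_on_const C1_on_prod], rule C1_on_diff[OF C1_on_const b(1)], rule subsetD[OF D(1)])
    show "0 \<le> ?k y \<and> ?k y \<le> 1" for y
    proof -
      have 01: "0 \<le> 1 - b x y \<and> 1 - b x y \<le> 1" if "x \<in> D" for x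
        using b(2)[OF subsetD[OF D(1) that], of y] by linarith
      have "0 \<le> (\<Prod>x\<in>D. 1 - b x y)" using 01 by (blast intro: prod_nonneg)
      moreover have "(\<Prod>x\<in>D. 1 - b x y) \<le> 1" using 01 by (rule prod_le_1)
      ultimately show ?thesis by simp
    qed
    show "open (\<Union>x\<in>D. ball x (r x))" by blast
    show "K \<subseteq> (\<Union>x\<in>D. ball x (r x))" by fact
    show "?k y = 1" if "y \<in> (\<Union>x\<in>D. ball x (r x))" for y
    proof -
      from that obtain x where x: "x \<in> D" "y \<in> ball x (r x)" by blast
      with D(1) have "b x y = 1" by (intro b(3)) auto
      with x(1)
      have "(\<Prod>x\<in>D. 1 - b x y) = 0" using D(2) by (intro prod_zero) auto
      then show ?thesis by simp
    qed
    show "compact (\<Union>x\<in>D. cball x (2 * r x))" using D by (intro compact_UN) auto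
    show "(\<Union>x\<in>D. cball x (2 * r x)) \<subseteq> U" using r D by blast
    show "?k y = 0" if "y \<notin> (\<Union>x\<in>D. cball x (2 * r x))" for y
    proof -
      have "b x y = 0" if "x \<in> D" for x
      proof (rule b(4))
        show "x \<in> K" using that D(1) by (rule subsetD[rotated])
        show "y \<notin> cball x (2 * r x)" using that \<open>y \<notin> (\<Union>x\<in>D. cball x (2 * r x))\<close> by (meson UN_I)
      qed
      then show ?thesis by simp
    qed
  qed
qed

text \<open>The inverse function theorem is applied inside the open set \<open>R\<close> on which
  the Jacobian determinant has the sign it has at \<open>z\<close>, so that the neighbourhood
  inherits the constant sign.\<close>

lemma regular_point_neighbourhood:
  fixes G :: "real^'n \<Rightarrow> real^'n"
  assumes S: "open S" and G: "C1_on S G" and z: "z \<in> S" and reg: "det (jacobian_matrix G z) \<noteq> 0"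
  obtains N V where "open N" "N \<subseteq> S" "z \<in> N" "open V" "G z \<in> V" "inj_on G N" "G ` N = V"
    "\<And>x. x \<in> N \<Longrightarrow> sgn (det (jacobian_matrix G x)) = sgn (det (jacobian_matrix G z))"
proof -
  let ?d = "\<lambda>x. det (jacobian_matrix G x) * sgn (det (jacobian_matrix G z))"
  define R where "R = {x \<in> S. ?d x > 0}"
  have "continuous_on S ?d" by (intro continuous_intros C1_on_continuous_det_jacobian G)
  then have "open (S \<inter> ?d -` {0<..})"
    using S open_greaterThan by (rule continuous_open_preimage)
  moreover have "R = S \<inter> ?d -` {0<..}" unfolding R_def by auto
  ultimately have R: "open R" by simp
  have zR: "z \<in> R" unfolding R_def using z reg by (simp add: sgn_if mult_neg_neg)
  have RS: "R \<subseteq> S" unfolding R_def by blast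
  obtain F' where d: "\<And>x. x \<in> R \<Longrightarrow> (G has_derivative blinfun_apply (F' x)) (at x)" and c: "continuous_on R F'"
    using C1_on_subset[OF G RS] unfolding C1_on_def by blast
  have "invertible (jacobian_matrix G z)" using reg by (simp add: invertible_det_nz)
  then obtain B where B: "B ** jacobian_matrix G z = mat 1" unfolding invertible_left_inverse by blast
  have J: "jacobian_matrix G z *v h = F' z h" for h
    unfolding jacobian_matrix_eq[OF d[OF zR]]
    by (simp add: matrix_works bounded_linear.linear blinfun.bounded_linear_right)
  have "Blinfun ((*v) B) o\<^sub>L F' z = id_blinfun"
  proof (rule blinfun_eqI)
    fix h
    have "blinfun_apply (Blinfun ((*v) B)) = (*v) B"
      by (rule bounded_linear_Blinfun_apply) (rule matrix_vector_mul_bounded_linear)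
    then show "(Blinfun ((*v) B) o\<^sub>L F' z) h = id_blinfun h"
      using B by (simp add: J[symmetric] matrix_vector_mul_assoc)
  qed
  from inverse_function_theorem[OF R d c zR this]
  obtain N V g g' where N: "open N" "N \<subseteq> R" "z \<in> N" "open V" "G z \<in> V" "homeomorphism N V G g"
    by metis
  show ?thesis
  proof
    show "inj_on G N" by (metis N(6) homeomorphism_apply1 inj_on_inverseI)
    show "G ` N = V" using N(6) homeomorphism_image1 by blast
    show "sgn (det (jacobian_matrix G x)) = sgn (det (jacobian_matrix G z))" if "x \<in> N" for x
      using that N(2) unfolding R_def by (auto simp: sgn_if zero_less_mult_iff split: if_splits)
  qed (use N RS in auto)
qed

section \<open>Signed zero counts and homotopies\<close>

text \<open>A cutoff equal to 1 near \<open>C\<close> extends both maps to compactly supported maps,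
  whose Jacobian determinants integrate to 0. Off \<open>C\<close> the extensions agree, so the
  difference of the two integrals is an integral over \<open>C\<close>.\<close>

lemma has_integral_det_jacobian_diff:
  fixes w0 w1 :: "real^'n::{finite,wellorder} \<Rightarrow> real^'n::_"
  assumes U: "open U" and w: "C1_on U w0" "C1_on U w1" and C: "compact C" "C \<subseteq> U"
    and eq: "\<And>x. x \<in> U - C \<Longrightarrow> w0 x = w1 x"
  shows "((\<lambda>x. det (jacobian_matrix w1 x) - det (jacobian_matrix w0 x)) has_integral 0) C"
proof -
  obtain k :: "real^'n::{finite,wellorder} \<Rightarrow> real" and W D
    where k: "C1_on UNIV k" "open W" "C \<subseteq> W" "\<And>x. x \<in> W \<Longrightarrow> k x = 1"
      "compact D" "D \<subseteq> U" "\<And>x. x \<notin> D \<Longrightarrow> k x = 0"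
    using C1_cutoff[OF C(1) U C(2)] by metis
  \<comment> \<open>On \<open>U - D\<close> both descriptions of \<open>e w\<close> give 0, so it is
    C1 on \<open>U\<close> and on \<open>- D\<close>, two open sets that cover the space.\<close>
  define e where "e w x = (if x \<in> U then k x *\<^sub>R w x else 0)" for w :: "real^'n::{finite,wellorder} \<Rightarrow> real^'n::_" and x
  have WD: "W \<subseteq> D" using k(4,7) by fastforce
  have CD: "C \<subseteq> D" using WD k(3) by blast
  have oD: "open (- D)" using k(5) by (simp add: compact_imp_closed open_Compl)
  have e0: "e w x = 0" if "x \<notin> D" for w x using that k(7) by (simp add: e_def)
  have eC1: "C1_on UNIV (e w)" if "C1_on U w" for w
  proof -
    have "C1_on U (e w)"
    proof (rule C1_on_cong_open[OF _ U])
      show "C1_on U (\<lambda>x. k x *\<^sub>R w x)" by (rule C1_on_scaleR[OF C1_on_subset[OF k(1) subset_UNIV] that])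
    qed (simp add: e_def)
    moreover have "C1_on (- D) (e w)"
      by (rule C1_on_cong_open[OF C1_on_const oD]) (simp add: e0)
    ultimately have "C1_on (U \<union> - D) (e w)" by (rule C1_on_Un_open[OF U oD])
    moreover have "U \<union> - D = UNIV" using k(6) by blast
    ultimately show ?thesis by simp
  qed
  obtain a where a: "D \<subseteq> cbox (-a) a"
    using bounded_subset_cbox_symmetric[OF compact_imp_bounded[OF k(5)]] by blast
  have int: "((\<lambda>x. det (jacobian_matrix (e w) x)) has_integral 0) (cbox (-a) a)" if "C1_on U w" for w
  proof -
    have "(\<lambda>x. det (jacobian_matrix (e w) x)) integrable_on cbox (-a) a"
      by (rule integrable_continuous) (rule C1_on_continuous_det_jacobian[OF C1_on_subset[OF eC1[OF that] subset_UNIV]])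
    moreover have "integral (cbox (-a) a) (\<lambda>x. det (jacobian_matrix (e w) x)) = 0"
      by (rule integral_det_jacobian_compact_support[OF eC1[OF that] k(5) e0 a])
    ultimately show ?thesis by (simp add: has_integral_integral)
  qed
  let ?h = "\<lambda>x. det (jacobian_matrix (e w1) x) - det (jacobian_matrix (e w0) x)"
  have h: "(?h has_integral 0) (cbox (-a) a)"
    using has_integral_diff[OF int[OF w(2)] int[OF w(1)]] by simp
  have h0: "?h x = 0" if "x \<notin> C" for x
  proof -
    have "jacobian_matrix (e w1) x = jacobian_matrix (e w0) x"
    proof (rule jacobian_matrix_cong_open)
      show "open (- C)" using C(1) by (simp add: compact_imp_closed open_Compl)
    qed (use that eq in \<open>auto simp: e_def\<close>)
    then show ?thesis by simp
  qed
  have "(?h has_integral 0) C"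
  proof -
    have "?h = (\<lambda>x. if x \<in> C then ?h x else 0)" using h0 by auto
    then have "((\<lambda>x. if x \<in> C then ?h x else 0) has_integral 0) (cbox (-a) a)" using h by simp
    then show ?thesis using has_integral_restrict[of C "cbox (-a) a" ?h 0] CD a by blast
  qed
  moreover have "?h x = det (jacobian_matrix w1 x) - det (jacobian_matrix w0 x)" if "x \<in> C" for x
  proof -
    have "jacobian_matrix (e w) x = jacobian_matrix w x" for w
      by (rule jacobian_matrix_cong_open[OF k(2)]) (use that k(3,4,6) WD in \<open>auto simp: e_def\<close>)
    then show ?thesis by simp
  qed
  ultimately show ?thesis by (metis (no_types, lifting) has_integral_eq)
qed

lemma bump_integrable:
  fixes h :: "'a::euclidean_space \<Rightarrow> real"
  assumes h: "continuous_on UNIV h" and h0: "\<And>y. \<rho> \<le> norm y \<Longrightarrow> h y = 0" and V: "ball 0 \<rho> \<subseteq> V"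
  shows "h absolutely_integrable_on V" "integral V h = integral UNIV h"
proof -
  have r: "(\<lambda>x. if x \<in> V then h x else 0) = h" if "ball 0 \<rho> \<subseteq> V" for V
  proof
    fix x show "(if x \<in> V then h x else 0) = h x"
      using that h0[of x] by (cases "norm x < \<rho>") (auto simp: subset_iff)
  qed
  show "integral V h = integral UNIV h"
    using integral_restrict_UNIV[of V h] r[OF V] by simp
  obtain a where a: "ball (0::'a) \<rho> \<subseteq> cbox (-a) a"
    using bounded_subset_cbox_symmetric[OF bounded_ball] by blast
  have "h absolutely_integrable_on cbox (-a) a"
    using h by (intro absolutely_integrable_continuous continuous_on_subset[OF h]) auto
  then have "h absolutely_integrable_on UNIV"
    using absolutely_integrable_restrict_UNIV[of "cbox (-a) a" h] r[OF a] by simp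
  then show "h absolutely_integrable_on V"
    using absolutely_integrable_restrict_UNIV[of V h] r[OF V] by simp
qed

text \<open>Change of variables on a piece where \<open>G\<close> is injective; the constant sign
  \<open>s\<close> converts the absolute value of the determinant into the determinant.\<close>

lemma has_integral_bump_diffeo:
  fixes G :: "real^'n::{finite,wellorder} \<Rightarrow> real^'n::_" and h :: "real^'n::{finite,wellorder} \<Rightarrow> real"
  assumes N: "open N" and G: "C1_on N G" and inj: "inj_on G N" and V: "G ` N = V" "ball 0 \<rho> \<subseteq> V"
    and sg: "\<And>x. x \<in> N \<Longrightarrow> sgn (det (jacobian_matrix G x)) = s"
    and h: "continuous_on UNIV h" "\<And>y. \<rho> \<le> norm y \<Longrightarrow> h y = 0"
  shows "((\<lambda>x. h (G x) * det (jacobian_matrix G x)) has_integral s * integral UNIV h) N"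
proof -
  \<comment> \<open>The change of variables theorem takes vector-valued integrands, so
    \<open>h\<close> is wrapped in \<open>real^1\<close>.\<close>
  let ?f = "\<lambda>y. vec (h y) :: real^1"
  let ?D = "\<lambda>x. frechet_derivative G (at x)"
  have "?f absolutely_integrable_on G ` N \<and> integral (G ` N) ?f = vec (integral UNIV h)"
    using bump_integrable[OF h V(2)] V(1)
    by (simp add: absolutely_integrable_on_1_iff integral_on_1_eq)
  moreover have "(G has_derivative ?D x) (at x within N)" if "x \<in> N" for x
    using C1_on_has_derivative[OF G that] by (rule has_derivative_at_withinI)
  ultimately have i: "(\<lambda>x. \<bar>det (matrix (?D x))\<bar> *\<^sub>R ?f (G x)) absolutely_integrable_on N"
    "integral N (\<lambda>x. \<bar>det (matrix (?D x))\<bar> *\<^sub>R ?f (G x)) = vec (integral UNIV h)"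
    using has_absolute_integral_change_of_variables[of N G ?D ?f "vec (integral UNIV h)"] N inj
    by (auto simp: lebesgue_openin)
  have "(\<lambda>x. \<bar>det (jacobian_matrix G x)\<bar> * h (G x)) absolutely_integrable_on N"
    "integral N (\<lambda>x. \<bar>det (jacobian_matrix G x)\<bar> * h (G x)) = integral UNIV h"
    using i by (simp_all add: absolutely_integrable_on_1_iff integral_on_1_eq jacobian_matrix_def)
  then have "((\<lambda>x. \<bar>det (jacobian_matrix G x)\<bar> * h (G x)) has_integral integral UNIV h) N"
    by (simp add: absolutely_integrable_on_def has_integral_iff)
  then have "((\<lambda>x. s * (\<bar>det (jacobian_matrix G x)\<bar> * h (G x))) has_integral s * integral UNIV h) N"
    by (rule has_integral_mult_right)
  moreover have "s * (\<bar>det (jacobian_matrix G x)\<bar> * h (G x)) = h (G x) * det (jacobian_matrix G x)" if "x \<in> N" for x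
  proof -
    have "s * \<bar>det (jacobian_matrix G x)\<bar> = det (jacobian_matrix G x)"
      using sg[OF that] by (metis sgn_mult_abs)
    then show ?thesis by (metis mult.assoc mult.commute)
  qed
  ultimately show ?thesis by (metis (no_types, lifting) has_integral_eq)
qed

text \<open>The zeros form a compact set, and local injectivity at a regular zero isolates it; a
  finite subcover by neighbourhoods with one zero each remains.\<close>

lemma finite_regular_zeros:
  fixes G :: "real^'n \<Rightarrow> real^'n"
  assumes U: "open U" and G: "C1_on U G" and K: "compact K" "K \<subseteq> U"
    and reg: "\<And>x. x \<in> K \<Longrightarrow> G x = 0 \<Longrightarrow> det (jacobian_matrix G x) \<noteq> 0"
  shows "finite {x \<in> K. G x = 0}"
proof -
  let ?Z = "{x \<in> K. G x = 0}"
  have "closed (K \<inter> G -` {0})"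
    by (rule continuous_closed_preimage[OF C1_on_imp_continuous_on[OF C1_on_subset[OF G K(2)]]
       compact_imp_closed[OF K(1)] closed_singleton])
  moreover have "?Z = K \<inter> (K \<inter> G -` {0})" by auto
  ultimately have Z: "compact ?Z" using K(1) by (metis compact_Int_closed)
  have "\<forall>z\<in>?Z. \<exists>N. open N \<and> z \<in> N \<and> inj_on G N"
  proof
    fix z assume "z \<in> ?Z"
    then have z: "z \<in> U" "det (jacobian_matrix G z) \<noteq> 0" using K(2) reg by auto
    obtain N V where "open N" "z \<in> N" "inj_on G N"
      by (rule regular_point_neighbourhood[OF U G z]) blast
    then show "\<exists>N. open N \<and> z \<in> N \<and> inj_on G N" by blast
  qed
  from bchoice[OF this] obtain N where N: "\<And>z. z \<in> ?Z \<Longrightarrow> open (N z) \<and> z \<in> N z \<and> inj_on G (N z)" by blast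
  obtain D where D: "D \<subseteq> ?Z" "finite D" "?Z \<subseteq> (\<Union>z\<in>D. N z)"
  proof (rule compactE_image[OF Z, of ?Z N])
    show "?Z \<subseteq> (\<Union>z\<in>?Z. N z)" using N by blast
  qed (use N in auto)
  have "?Z \<subseteq> D"
  proof
    fix x assume x: "x \<in> ?Z"
    with D obtain z where z: "z \<in> D" "x \<in> N z" by blast
    with D(1) N[of z] x have "x = z" by (metis (mono_tags, lifting) inj_onD mem_Collect_eq subsetD)
    with z show "x \<in> D" by simp
  qed
  then show ?thesis using D(2) finite_subset by blast
qed

text \<open>The integral form of the degree. If \<open>h\<close> is supported in a small ball around
  0, then \<open>h (G x)\<close> lives on disjoint neighbourhoods of the zeros, each mapped
  injectively onto an open set containing that ball; each contributes its sign times the integral of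
  \<open>h\<close>. Zeros interior to \<open>K\<close> keep these neighbourhoods inside
  \<open>K\<close>.\<close>

lemma degree_integral_formula:
  fixes G :: "real^'n::{finite,wellorder} \<Rightarrow> real^'n::_"
  assumes U: "open U" and G: "C1_on U G" and K: "compact K" "K \<subseteq> U"
    and int: "{x \<in> K. G x = 0} \<subseteq> interior K"
    and reg: "\<And>x. x \<in> K \<Longrightarrow> G x = 0 \<Longrightarrow> det (jacobian_matrix G x) \<noteq> 0"
  shows "\<exists>\<rho>>0. \<forall>h. continuous_on UNIV h \<longrightarrow> (\<forall>y. \<rho> \<le> norm y \<longrightarrow> h y = 0) \<longrightarrow>
    ((\<lambda>x. h (G x) * det (jacobian_matrix G x)) has_integral
       (\<Sum>x | x \<in> K \<and> G x = 0. sgn (det (jacobian_matrix G x))) * integral UNIV h) K"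
proof -
  let ?Z = "{x \<in> K. G x = 0}"
  have fin: "finite ?Z" using finite_regular_zeros[OF U G K reg] by blast
  \<comment> \<open>The last clause makes the neighbourhoods disjoint although each \<open>d\<close>
    is chosen separately: if \<open>z\<close> and \<open>z'\<close> have radii \<open>d\<close> and
    \<open>d'\<close>, then \<open>d + d' \<le> dist z z'\<close>.\<close>
  define Q where "Q z N \<longleftrightarrow> open N \<and> N \<subseteq> interior K \<and> z \<in> N \<and>
     inj_on G N \<and> open (G ` N) \<and> 0 \<in> G ` N \<and> (\<forall>x\<in>N. sgn (det (jacobian_matrix G x)) = sgn (det (jacobian_matrix G z)))
     \<and> (\<exists>d. N \<subseteq> ball z d \<and> (\<forall>z'\<in>?Z. z' \<noteq> z \<longrightarrow> 2 * d \<le> dist z z'))" for z N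
  have "\<forall>z\<in>?Z. \<exists>N. Q z N"
  proof
    fix z assume z: "z \<in> ?Z"
    obtain d0 where d0: "d0 > 0" "\<forall>z'\<in>?Z. z' \<noteq> z \<longrightarrow> d0 \<le> dist z z'"
      using finite_set_avoid[OF fin, of z] by blast
    define d where "d = d0 / 2"
    have d: "d > 0" "\<forall>z'\<in>?Z. z' \<noteq> z \<longrightarrow> 2 * d \<le> dist z z'" using d0 unfolding d_def by auto
    let ?S = "interior K \<inter> ball z d"
    have zS: "z \<in> ?S" using z int d by auto
    have GS: "C1_on ?S G" using C1_on_subset[OF G] K(2) interior_subset by blast
    have dz: "det (jacobian_matrix G z) \<noteq> 0" using reg z by blast
    have oS: "open ?S" by blast
    obtain N V where N: "open N" "N \<subseteq> ?S" "z \<in> N" "open V" "G z \<in> V" "inj_on G N" "G ` N = V"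
      "\<And>x. x \<in> N \<Longrightarrow> sgn (det (jacobian_matrix G x)) = sgn (det (jacobian_matrix G z))"
      by (rule regular_point_neighbourhood[OF oS GS zS dz]) (rule that)
    show "\<exists>N. Q z N"
      unfolding Q_def
    proof (intro exI conjI)
      show "N \<subseteq> interior K" "N \<subseteq> ball z d" using N(2) by blast+
      show "open (G ` N)" "0 \<in> G ` N" using N(4,5,7) z by simp_all
      show "open N" "z \<in> N" "inj_on G N" by (fact N)+
      show "\<forall>x\<in>N. sgn (det (jacobian_matrix G x)) = sgn (det (jacobian_matrix G z))"
        using N(8) by (rule ballI)
      show "\<forall>z'\<in>?Z. z' \<noteq> z \<longrightarrow> 2 * d \<le> dist z z'" by (fact d)
    qed
  qed
  from bchoice[OF this] obtain N where Q: "\<forall>z\<in>?Z. Q z (N z)" ..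
  have N: "open (N z)" "N z \<subseteq> interior K" "z \<in> N z" "inj_on G (N z)" "open (G ` N z)" "0 \<in> G ` N z"
     "\<And>x. x \<in> N z \<Longrightarrow> sgn (det (jacobian_matrix G x)) = sgn (det (jacobian_matrix G z))"
     "\<exists>d. N z \<subseteq> ball z d \<and> (\<forall>z'\<in>?Z. z' \<noteq> z \<longrightarrow> 2 * d \<le> dist z z')" if "z \<in> ?Z" for z
    using bspec[OF Q that, unfolded Q_def] by - (elim conjE bspec, assumption+)+
  have disj: "z = z'" if z: "z \<in> ?Z" "z' \<in> ?Z" and x: "x \<in> N z" "x \<in> N z'" for z z' x
  proof (rule ccontr)
    assume ne: "z \<noteq> z'"
    obtain d where d: "N z \<subseteq> ball z d" "\<forall>z'\<in>?Z. z' \<noteq> z \<longrightarrow> 2 * d \<le> dist z z'" using N(8)[OF z(1)] by (elim exE conjE)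
    obtain d' where d': "N z' \<subseteq> ball z' d'" "\<forall>z''\<in>?Z. z'' \<noteq> z' \<longrightarrow> 2 * d' \<le> dist z' z''" using N(8)[OF z(2)] by (elim exE conjE)
    have dd: "2 * d \<le> dist z z'" "2 * d' \<le> dist z' z" 
      using bspec[OF d(2) z(2)] bspec[OF d'(2) z(1)] ne not_sym[OF ne] by (simp_all only: simp_thms)
    have "dist z x < d" "dist z' x < d'" using x subsetD[OF d(1)] subsetD[OF d'(1)] by (simp_all only: mem_ball)
    then show False using dd dist_triangle[of z z' x] dist_commute[of x z'] dist_commute[of z z'] by linarith
  qed
  let ?K' = "K - (\<Union>z\<in>?Z. N z)"
  have K': "compact ?K'" using N(1) K(1) by (intro compact_diff) auto
  have "\<exists>m>0. \<forall>x\<in>?K'. m \<le> norm (G x)"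
  proof (cases "?K' = {}")
    case False
    have "continuous_on ?K' (\<lambda>x. norm (G x))"
      by (intro continuous_on_norm C1_on_imp_continuous_on[OF C1_on_subset[OF G]]) (use K(2) in auto)
    from continuous_attains_inf[OF K' False this] obtain x where x: "x \<in> ?K'" "\<forall>y\<in>?K'. norm (G x) \<le> norm (G y)" by blast
    moreover have "G x \<noteq> 0" using x(1) N(3) by blast
    ultimately show ?thesis by (intro exI[of _ "norm (G x)"]) auto
  qed (auto intro: exI[of _ 1])
  then obtain m where m: "m > 0" "\<And>x. x \<in> ?K' \<Longrightarrow> m \<le> norm (G x)" by blast
  have "\<forall>z\<in>?Z. \<exists>e. e > 0 \<and> ball 0 e \<subseteq> G ` N z"
    using N(5,6) open_contains_ball by blast
  from bchoice[OF this] obtain e where e: "\<And>z. z \<in> ?Z \<Longrightarrow> e z > 0 \<and> ball 0 (e z) \<subseteq> G ` N z" by blast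
  \<comment> \<open>Below \<open>m\<close>, so that \<open>h (G x)\<close> vanishes away from the
    neighbourhoods, and below every \<open>e z\<close>, so that the support of \<open>h\<close> lies
    in each image.\<close>
  define \<rho> where "\<rho> = Min (insert m (e ` ?Z))"
  have \<rho>: "\<rho> > 0" "\<rho> \<le> m" "\<And>z. z \<in> ?Z \<Longrightarrow> \<rho> \<le> e z"
    unfolding \<rho>_def using fin m(1) e by (auto simp: Min_gr_iff)
  show ?thesis
  proof (intro exI[of _ \<rho>] conjI allI impI)
    fix h :: "real^'n::{finite,wellorder} \<Rightarrow> real"
    assume h: "continuous_on UNIV h" "\<forall>y. \<rho> \<le> norm y \<longrightarrow> h y = 0"
    let ?I = "\<lambda>x. h (G x) * det (jacobian_matrix G x)"
    have "((\<lambda>x. if x \<in> N z then ?I x else 0) has_integral sgn (det (jacobian_matrix G z)) * integral UNIV h) K"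
      if z: "z \<in> ?Z" for z
    proof -
      have "(?I has_integral sgn (det (jacobian_matrix G z)) * integral UNIV h) (N z)"
      proof (rule has_integral_bump_diffeo[OF N(1)[OF z] _ N(4)[OF z] refl _ N(7)[OF z _] h(1)])
        show "C1_on (N z) G" using C1_on_subset[OF G] N(2)[OF z] K(2) interior_subset by blast
        show "ball 0 \<rho> \<subseteq> G ` N z" using e[OF z] \<rho>(3)[OF z] by (meson order_trans subset_ball)
      qed (use h in auto)
      then show ?thesis
        using has_integral_restrict[of "N z" K ?I] N(2)[OF z] interior_subset by blast
    qed
    then have "((\<lambda>x. \<Sum>z\<in>?Z. if x \<in> N z then ?I x else 0) has_integral
      (\<Sum>z\<in>?Z. sgn (det (jacobian_matrix G z)) * integral UNIV h)) K"
      by (intro has_integral_sum fin)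
    moreover have "(\<Sum>z\<in>?Z. if x \<in> N z then ?I x else 0) = ?I x" if "x \<in> K" for x
    proof (cases "\<exists>z\<in>?Z. x \<in> N z")
      case True
      then obtain z where z: "z \<in> ?Z" "x \<in> N z" by blast
      have "(\<Sum>z'\<in>?Z. if x \<in> N z' then ?I x else 0) = (\<Sum>z'\<in>?Z. if z' = z then ?I x else 0)"
        using disj z by (intro sum.cong) auto
      also have "\<dots> = ?I x" using z fin by (simp add: sum.delta)
      finally show ?thesis .
    next
      case False
      then have "\<rho> \<le> norm (G x)" using m(2)[of x] \<rho>(2) that by auto
      then have "?I x = 0" using h(2) by simp
      then show ?thesis using False by (auto intro: sum.neutral)
    qed
    ultimately show "(?I has_integral (\<Sum>x\<in>?Z. sgn (det (jacobian_matrix G x))) * integral UNIV h) K"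
      unfolding sum_distrib_right by (metis (no_types, lifting) has_integral_eq)
  qed (rule \<rho>)
qed

definition signed_zero_count :: "(real^'n \<Rightarrow> real^'n) \<Rightarrow> (real^'n) set \<Rightarrow> real" where
  "signed_zero_count G U = (\<Sum>x | x \<in> U \<and> G x = 0. sgn (det (jacobian_matrix G x)))"

lemma jacobian_matrix_compose:
  fixes F G :: "real^'n \<Rightarrow> real^'n"
  assumes F: "F differentiable at (G x)" and G: "G differentiable at x"
  shows "jacobian_matrix (\<lambda>x. F (G x)) x = jacobian_matrix F (G x) ** jacobian_matrix G x"
proof -
  let ?F = "frechet_derivative F (at (G x))" and ?G = "frechet_derivative G (at x)"
  have d: "(F has_derivative ?F) (at (G x))" "(G has_derivative ?G) (at x)"
    using F G frechet_derivative_works by blast+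
  have "((\<lambda>x. F (G x)) has_derivative (\<lambda>h. ?F (?G h))) (at x)"
    by (rule has_derivative_compose[OF d(2,1)])
  then have "jacobian_matrix (\<lambda>x. F (G x)) x = matrix (?F \<circ> ?G)"
    by (simp add: jacobian_matrix_eq o_def)
  also have "\<dots> = matrix ?F ** matrix ?G"
    using d by (intro matrix_compose) (auto intro: has_derivative_linear)
  finally show ?thesis by (simp add: jacobian_matrix_def)
qed

text \<open>A product of hats in the single coordinates, because such a product is the determinant
  of a diagonal matrix. For \<open>r > 0\<close> it is supported in the cube of half side
  \<open>r\<close>.\<close>

definition box_bump :: "real \<Rightarrow> real^'n \<Rightarrow> real" where
  "box_bump r y = (\<Prod>i\<in>UNIV. tent (y $ i / r) / r)"

text \<open>The Jacobian determinant of this map is \<open>box_bump r\<close>; hence \<open>box_bump r (G x) * det DG(x)\<close> is the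
  Jacobian determinant of a composition, and its integral depends only on \<open>G\<close> near the boundary.\<close>

definition box_map :: "real \<Rightarrow> real^'n \<Rightarrow> real^'n" where
  "box_map r y = (\<chi> i. smooth_step (y $ i / r))"

lemma box_map_component_derivative:
  fixes y :: "real^'n"
  shows "((\<lambda>y. box_map r y $ i) has_derivative (\<lambda>h. tent (y $ i / r) * (h $ i / r))) (at y)"
proof -
  have "((\<lambda>y. y $ i / r) has_derivative (\<lambda>h. h $ i / r)) (at y)"
    by (intro bounded_linear_imp_has_derivative bounded_linear_divide[THEN bounded_linear_compose] bounded_linear_vec_nth)
  moreover have "(smooth_step has_derivative (\<lambda>h. tent (y $ i / r) * h)) (at (y $ i / r))"
    using smooth_step_has_derivative[of "y $ i / r"] by (simp add: has_field_derivative_def)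
  ultimately show ?thesis
    unfolding box_map_def vec_lambda_beta by (rule has_derivative_compose)
qed

lemma C1_on_box_map: "C1_on UNIV (box_map r :: real^'n \<Rightarrow> real^'n)"
proof (rule C1_on_vec)
  fix i
  show "C1_on UNIV (\<lambda>y::real^'n. box_map r y $ i)"
  proof (rule C1_onI)
    show "((\<lambda>y. box_map r y $ i) has_derivative (\<lambda>h. tent (y $ i / r) * (h $ i / r))) (at y)" for y :: "real^'n"
      by (rule box_map_component_derivative)
    show "continuous_on UNIV (\<lambda>y::real^'n. tent (y $ i / r) * (h $ i / r))" for h
    proof -
      have "continuous_on UNIV (\<lambda>y::real^'n. y $ i / r)"
        by (intro linear_continuous_on bounded_linear_divide[THEN bounded_linear_compose] bounded_linear_vec_nth)
      then show ?thesis by (rule continuous_on_mult[OF continuous_tent continuous_on_const])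
    qed
  qed
qed

lemma det_jacobian_box_map: "det (jacobian_matrix (box_map r) y) = box_bump r (y :: real^'n)"
proof -
  have d: "(box_map r has_derivative frechet_derivative (box_map r) (at y)) (at y)"
    by (rule C1_on_has_derivative[OF C1_on_box_map UNIV_I])
  have "((\<lambda>y. box_map r y $ i) has_derivative (\<lambda>h. frechet_derivative (box_map r) (at y) h $ i)) (at y)" for i
    by (rule bounded_linear.has_derivative[OF bounded_linear_vec_nth d])
  then have "(\<lambda>h. frechet_derivative (box_map r) (at y) h $ i) = (\<lambda>h. tent (y $ i / r) * (h $ i / r))" for i
    using has_derivative_unique box_map_component_derivative by blast
  then have "jacobian_matrix (box_map r) y $ i $ j = tent (y $ i / r) * (axis j 1 $ i / r)" for i j
    unfolding jacobian_matrix_def matrix_component by metis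
  then have J: "jacobian_matrix (box_map r) y $ i $ j = (if i = j then tent (y $ i / r) / r else 0)" for i j
    by (simp add: axis_def)
  show ?thesis
    unfolding box_bump_def by (subst det_diagonal) (simp_all add: J)
qed

lemma continuous_on_box_bump: "continuous_on UNIV (box_bump r :: real^'n \<Rightarrow> real)"
  using C1_on_continuous_det_jacobian[OF C1_on_box_map, of r] by (simp add: det_jacobian_box_map)

text \<open>The norm is at most the sum of the absolute values of the coordinates, so at this
  distance some coordinate has absolute value at least \<open>r\<close>.\<close>

lemma box_bump_outside:
  fixes y :: "real^'n"
  assumes r: "r > 0" and y: "real CARD('n) * r \<le> norm y"
  shows "box_bump r y = 0"
proof -
  have "\<exists>i. r \<le> \<bar>y $ i\<bar>"
  proof (rule ccontr)
    assume "\<nexists>i. r \<le> \<bar>y $ i\<bar>"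
    then have "(\<Sum>i\<in>UNIV. \<bar>y $ i\<bar>) < (\<Sum>i\<in>(UNIV::'n set). r)"
      by (intro sum_strict_mono) (auto simp: not_le)
    then show False using y norm_le_l1_cart[of y] by simp
  qed
  then obtain i where "r \<le> \<bar>y $ i\<bar>" by blast
  then have "tent (y $ i / r) = 0" using r by (intro tent_outside) (simp add: abs_divide)
  then show ?thesis unfolding box_bump_def by (intro prod_zero) auto
qed

text \<open>A nonnegative continuous function with integral 0 vanishes, but the value at the origin
  is a power of \<open>1 / r\<close>.\<close>

lemma box_bump_integral_nonzero:
  assumes r: "r > 0"
  shows "integral UNIV (box_bump r :: real^'n \<Rightarrow> real) \<noteq> 0"
proof
  assume 0: "integral UNIV (box_bump r :: real^'n \<Rightarrow> real) = 0"
  let ?b = "box_bump r :: real^'n \<Rightarrow> real"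
  let ?\<rho> = "real CARD('n) * r"
  obtain a :: "real^'n" where a: "ball 0 ?\<rho> \<subseteq> cbox (-a) a"
    using bounded_subset_cbox_symmetric[OF bounded_ball] by blast
  have rho: "0 < ?\<rho>" using r by simp
  have "?b absolutely_integrable_on cbox (-a) a" "integral (cbox (-a) a) ?b = 0"
    using bump_integrable[OF continuous_on_box_bump box_bump_outside[OF r] a] 0 by auto
  then have h: "(?b has_integral 0) (cbox (-a) a)"
    by (simp add: absolutely_integrable_on_def has_integral_iff)
  have c0: "0 \<in> ball 0 ?\<rho>" using rho by simp
  have "ball 0 ?\<rho> \<subseteq> interior (cbox (-a) a)" using a by (intro interior_maximal) auto
  then have ne: "box (-a) a \<noteq> {}" using c0 by (auto simp: interior_cbox)
  have nn: "0 \<le> ?b x" for x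
    unfolding box_bump_def using r tent_nonneg by (intro prod_nonneg) (auto intro!: divide_nonneg_pos)
  have "?b 0 = 0"
    by (rule has_integral_0_cbox_imp_0[OF continuous_on_subset[OF continuous_on_box_bump subset_UNIV] nn h ne])
      (use a c0 in blast)
  moreover have "?b 0 = (1 / r) ^ CARD('n)" unfolding box_bump_def by (simp add: tent_0)
  ultimately show False using r by simp
qed

text \<open>The zeros as pairs of time and point form a closed subset of a compact product; this is
  their projection.\<close>

lemma compact_homotopy_zeros:
  fixes F0 F1 :: "'a::euclidean_space \<Rightarrow> 'b::euclidean_space"
  assumes S: "compact S" and H: "continuous_on S F0" "continuous_on S F1"
  shows "compact {x \<in> S. \<exists>t\<in>{0..1::real}. (1 - t) *\<^sub>R F0 x + t *\<^sub>R F1 x = (0::'b)}"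
proof -
  let ?H = "\<lambda>(t, x). (1 - t) *\<^sub>R F0 x + t *\<^sub>R F1 x"
  have cl: "closed ({0..1::real} \<times> S)" by (intro closed_Times compact_imp_closed[OF S] closed_real_atLeastAtMost)
  have co: "compact ({0..1::real} \<times> S)" by (rule compact_Times[OF compact_Icc S])
  have "continuous_on ({0..1} \<times> S) ?H"
    unfolding case_prod_unfold
    by (intro continuous_intros continuous_on_compose2[OF H(1)] continuous_on_compose2[OF H(2)]) auto
  then have "closed (({0..1} \<times> S) \<inter> ?H -` {0})"
    by (rule continuous_closed_preimage[OF _ cl closed_singleton])
  then have "compact (({0..1} \<times> S) \<inter> (({0..1} \<times> S) \<inter> ?H -` {0}))"
    by (rule compact_Int_closed[OF co])
  then have "compact (snd ` (({0..1} \<times> S) \<inter> (({0..1} \<times> S) \<inter> ?H -` {0})))"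
    by (rule compact_continuous_image[OF continuous_on_snd[OF continuous_on_id]])
  moreover have "snd ` (({0..1} \<times> S) \<inter> (({0..1} \<times> S) \<inter> ?H -` {0})) =
     {x \<in> S. \<exists>t\<in>{0..1::real}. (1 - t) *\<^sub>R F0 x + t *\<^sub>R F1 x = (0::'b)}" (is "?L = ?R")
  proof
    show "?L \<subseteq> ?R"
    proof
      fix x assume "x \<in> ?L"
      then obtain p where p: "x = snd p" "p \<in> {0..1} \<times> S" "?H p = 0" by blast
      then have "fst p \<in> {0..1}" "x \<in> S" "(1 - fst p) *\<^sub>R F0 x + fst p *\<^sub>R F1 x = 0"
        by (simp_all only: case_prod_unfold mem_Times_iff)
      then show "x \<in> ?R" by blast
    qed
    show "?R \<subseteq> ?L"
    proof
      fix x assume "x \<in> ?R"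
      then obtain t where "t \<in> {0..1}" "x \<in> S" "(1 - t) *\<^sub>R F0 x + t *\<^sub>R F1 x = 0" by blast
      then show "x \<in> ?L" by (intro image_eqI[of _ _ "(t, x)"]) simp_all
    qed
  qed
  ultimately show ?thesis by simp
qed

text \<open>The set \<open>Z\<close> of zeros of all stages is compact and avoids the frontier. An
  auxiliary \<open>G2\<close> is compared with \<open>G1\<close> through its zeros, near which the
  two coincide, and with \<open>G0\<close> through the integral formula, since \<open>G2\<close> and
  \<open>G0\<close> coincide off a compact set.\<close>

lemma signed_zero_count_homotopy_wellorder:
  fixes G0 G1 :: "real^'n::{finite,wellorder} \<Rightarrow> real^'n::_"
  assumes U: "open U" "bounded U"
    and C1: "C1_on U G0" "C1_on U G1"
    and cont: "continuous_on (closure U) G0" "continuous_on (closure U) G1"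
    and reg: "\<And>x. x \<in> U \<Longrightarrow> G0 x = 0 \<Longrightarrow> det (jacobian_matrix G0 x) \<noteq> 0"
      "\<And>x. x \<in> U \<Longrightarrow> G1 x = 0 \<Longrightarrow> det (jacobian_matrix G1 x) \<noteq> 0"
    and nz: "\<And>x t. x \<in> frontier U \<Longrightarrow> t \<in> {0..1} \<Longrightarrow> (1 - t) *\<^sub>R G0 x + t *\<^sub>R G1 x \<noteq> 0"
  shows "signed_zero_count G0 U = signed_zero_count G1 U"
proof -
  define Z where "Z = {x \<in> closure U. \<exists>t\<in>{0..1::real}. (1 - t) *\<^sub>R G0 x + t *\<^sub>R G1 x = 0}"
  have "compact Z"
    unfolding Z_def by (rule compact_homotopy_zeros) (use U cont in auto)
  moreover have ZU: "Z \<subseteq> U"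
  proof
    fix x assume "x \<in> Z"
    then have "x \<in> closure U" "x \<notin> frontier U" unfolding Z_def using nz by auto
    then show "x \<in> U" using U(1) by (simp add: frontier_def interior_open)
  qed
  ultimately obtain k :: "real^'n::{finite,wellorder} \<Rightarrow> real" and W C where
    k: "C1_on UNIV k" "\<And>x. 0 \<le> k x \<and> k x \<le> 1"
    "open W" "Z \<subseteq> W" "\<And>x. x \<in> W \<Longrightarrow> k x = 1" "compact C" "C \<subseteq> U" "\<And>x. x \<notin> C \<Longrightarrow> k x = 0"
    using C1_cutoff[OF _ U(1)] by metis
  have WC: "W \<subseteq> C" using k(5,8) by fastforce
  \<comment> \<open>\<open>G2\<close> agrees with \<open>G0\<close> near the boundary and with \<open>G1\<close> near the zeros of both.\<close>
  define G2 where "G2 x = G0 x + k x *\<^sub>R (G1 x - G0 x)" for x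
  have G2_C1: "C1_on U G2"
    unfolding G2_def[abs_def]
    by (rule C1_on_add[OF C1(1) C1_on_scaleR[OF C1_on_subset[OF k(1) subset_UNIV] C1_on_diff[OF C1(2,1)]]])
  have G2_alt: "G2 x = (1 - k x) *\<^sub>R G0 x + k x *\<^sub>R G1 x" for x
    unfolding G2_def by (simp add: algebra_simps)
  \<comment> \<open>At a zero of \<open>G2\<close> the number \<open>k x\<close> is itself a time at
    which the homotopy vanishes.\<close>
  have zZ: "x \<in> Z" if "x \<in> U" "G0 x = 0 \<or> G1 x = 0 \<or> G2 x = 0" for x
  proof -
    have "\<exists>t\<in>{0..1::real}. (1 - t) *\<^sub>R G0 x + t *\<^sub>R G1 x = 0"
      using that(2) k(2)[of x] G2_alt[of x]
      by (elim disjE) (auto intro: bexI[of _ 0] bexI[of _ 1] bexI[of _ "k x"])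
    then show ?thesis unfolding Z_def using that(1) closure_subset by blast
  qed
  have W2: "G2 x = G1 x" if "x \<in> W" for x using that k(5) unfolding G2_def by simp
  have J2: "jacobian_matrix G2 x = jacobian_matrix G1 x" if "x \<in> W" for x
    by (rule jacobian_matrix_cong_open[OF k(3) that W2])
  have eq12: "signed_zero_count G2 U = signed_zero_count G1 U"
    unfolding signed_zero_count_def
  proof (rule sum.cong)
    show "{x. x \<in> U \<and> G2 x = 0} = {x. x \<in> U \<and> G1 x = 0}"
      using zZ W2 k(4) by (metis subsetD)
    show "sgn (det (jacobian_matrix G2 x)) = sgn (det (jacobian_matrix G1 x))" if "x \<in> {x. x \<in> U \<and> G1 x = 0}" for x
    proof -
      have "x \<in> W" using that zZ k(4) by blast
      then show ?thesis by (simp only: J2)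
    qed
  qed
  have reg2: "det (jacobian_matrix G2 x) \<noteq> 0" if "x \<in> U" "G2 x = 0" for x
  proof -
    have "x \<in> W" using zZ that k(4) by blast
    then show ?thesis using J2[of x] W2[of x] reg(2)[of x] that by simp
  qed
  have intC: "{x \<in> C. G x = 0} \<subseteq> interior C" if "G = G0 \<or> G = G2" for G
  proof -
    have "{x \<in> C. G x = 0} \<subseteq> W" using that zZ k(4,7) by blast
    also have "W \<subseteq> interior C" using WC k(3) by (rule interior_maximal)
    finally show ?thesis .
  qed
  have cnt: "(\<Sum>x | x \<in> C \<and> G x = 0. sgn (det (jacobian_matrix G x))) = signed_zero_count G U"
    if "G = G0 \<or> G = G2" for G
  proof -
    have "{x. x \<in> C \<and> G x = 0} = {x. x \<in> U \<and> G x = 0}"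
      using that zZ k(4,7) WC by blast
    then show ?thesis unfolding signed_zero_count_def by simp
  qed
  obtain \<rho>0 where \<rho>0: "\<rho>0 > 0" and I0: "\<And>h. continuous_on UNIV h \<Longrightarrow> (\<forall>y. \<rho>0 \<le> norm y \<longrightarrow> h y = 0) \<Longrightarrow>
     ((\<lambda>x. h (G0 x) * det (jacobian_matrix G0 x)) has_integral signed_zero_count G0 U * integral UNIV h) C"
  proof -
    have "{x \<in> C. G0 x = 0} \<subseteq> interior C" by (rule intC) simp
    from degree_integral_formula[OF U(1) C1(1) k(6,7) this reg(1)[OF subsetD[OF k(7)]]]
    obtain \<rho> where "\<rho> > 0" and I: "\<And>h. continuous_on UNIV h \<Longrightarrow> (\<forall>y. \<rho> \<le> norm y \<longrightarrow> h y = 0) \<Longrightarrow>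
     ((\<lambda>x. h (G0 x) * det (jacobian_matrix G0 x)) has_integral
       (\<Sum>x | x \<in> C \<and> G0 x = 0. sgn (det (jacobian_matrix G0 x))) * integral UNIV h) C" by blast
    have "(\<Sum>x | x \<in> C \<and> G0 x = 0. sgn (det (jacobian_matrix G0 x))) = signed_zero_count G0 U"
      by (rule cnt) simp
    from that[OF \<open>\<rho> > 0\<close> I[unfolded this]] show thesis .
  qed
  obtain \<rho>2 where \<rho>2: "\<rho>2 > 0" and I2: "\<And>h. continuous_on UNIV h \<Longrightarrow> (\<forall>y. \<rho>2 \<le> norm y \<longrightarrow> h y = 0) \<Longrightarrow>
     ((\<lambda>x. h (G2 x) * det (jacobian_matrix G2 x)) has_integral signed_zero_count G2 U * integral UNIV h) C"
  proof -
    have "{x \<in> C. G2 x = 0} \<subseteq> interior C" by (rule intC) simp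
    from degree_integral_formula[OF U(1) G2_C1 k(6,7) this reg2[OF subsetD[OF k(7)]]]
    obtain \<rho> where "\<rho> > 0" and I: "\<And>h. continuous_on UNIV h \<Longrightarrow> (\<forall>y. \<rho> \<le> norm y \<longrightarrow> h y = 0) \<Longrightarrow>
     ((\<lambda>x. h (G2 x) * det (jacobian_matrix G2 x)) has_integral
       (\<Sum>x | x \<in> C \<and> G2 x = 0. sgn (det (jacobian_matrix G2 x))) * integral UNIV h) C" by blast
    have "(\<Sum>x | x \<in> C \<and> G2 x = 0. sgn (det (jacobian_matrix G2 x))) = signed_zero_count G2 U"
      by (rule cnt) simp
    from that[OF \<open>\<rho> > 0\<close> I[unfolded this]] show thesis .
  qed
  \<comment> \<open>Small enough for the bump to be admissible in both integral formulas: its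
    support has radius at most \<open>CARD('n) * r\<close>.\<close>
  define r where "r = min \<rho>0 \<rho>2 / real CARD('n)"
  have r: "r > 0" "real CARD('n) * r = min \<rho>0 \<rho>2" unfolding r_def using \<rho>0 \<rho>2 by auto
  let ?h = "box_bump r :: real^'n::{finite,wellorder} \<Rightarrow> real"
  have h0: "?h y = 0" if "min \<rho>0 \<rho>2 \<le> norm y" for y
    by (rule box_bump_outside[OF r(1)]) (simp only: r(2) that)
  have dj: "det (jacobian_matrix (\<lambda>x. box_map r (G x)) x) = ?h (G x) * det (jacobian_matrix G x)"
    if "C1_on U G" "x \<in> U" for G x
  proof -
    have "jacobian_matrix (\<lambda>x. box_map r (G x)) x = jacobian_matrix (box_map r) (G x) ** jacobian_matrix G x"
      by (rule jacobian_matrix_compose)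
        (use C1_on_box_map that in \<open>auto simp: C1_on_iff_frechet\<close>)
    then show ?thesis by (simp add: det_mul det_jacobian_box_map)
  qed
  have "((\<lambda>x. det (jacobian_matrix (\<lambda>x. box_map r (G2 x)) x) - det (jacobian_matrix (\<lambda>x. box_map r (G0 x)) x)) has_integral 0) C"
  proof (rule has_integral_det_jacobian_diff[OF U(1) _ _ k(6,7)])
    show "C1_on U (\<lambda>x. box_map r (G0 x))" "C1_on U (\<lambda>x. box_map r (G2 x))"
      by (rule C1_on_compose[OF C1_on_box_map _ subset_UNIV], fact)+
    show "box_map r (G0 x) = box_map r (G2 x)" if "x \<in> U - C" for x
      using that k(8) by (simp add: G2_def)
  qed
  then have "((\<lambda>x. ?h (G2 x) * det (jacobian_matrix G2 x) - ?h (G0 x) * det (jacobian_matrix G0 x)) has_integral 0) C"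
    by (rule has_integral_eq[rotated]) (use dj C1(1) G2_C1 k(7) in \<open>simp add: subset_iff\<close>)
  moreover have "((\<lambda>x. ?h (G2 x) * det (jacobian_matrix G2 x) - ?h (G0 x) * det (jacobian_matrix G0 x)) has_integral
     (signed_zero_count G2 U * integral UNIV ?h - signed_zero_count G0 U * integral UNIV ?h)) C"
    using h0 by (intro has_integral_diff I0 I2 continuous_on_box_bump) auto
  ultimately have "signed_zero_count G2 U * integral UNIV ?h - signed_zero_count G0 U * integral UNIV ?h = 0"
    using has_integral_unique by blast
  then have "signed_zero_count G2 U = signed_zero_count G0 U"
    using box_bump_integral_nonzero[OF r(1), where 'n = 'n] by simp
  then show ?thesis using eq12 by simp
qed

section \<open>Sard's theorem, and the passage to arbitrary finite index types\<close>

lemma sard_regular_value_wellorder: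
  fixes G :: "real^'n::{finite,wellorder} \<Rightarrow> real^'n::_"
  assumes G: "C1_on UNIV G" and e: "e > 0"
  shows "\<exists>y. norm y < e \<and> (\<forall>x. G x = y \<longrightarrow> det (jacobian_matrix G x) \<noteq> 0)"
proof -
  define S where "S = {x. det (jacobian_matrix G x) = 0}"
  have "negligible (G ` S)"
  proof (rule baby_Sard[where f' = "\<lambda>x. frechet_derivative G (at x)"])
    show "(G has_derivative frechet_derivative G (at x)) (at x within S)" for x
      by (rule has_derivative_at_withinI[OF C1_on_has_derivative[OF G UNIV_I]])
    show "rank (matrix (frechet_derivative G (at x))) < CARD('n)" if "x \<in> S" for x
      using that unfolding S_def jacobian_matrix_def by (simp add: det_eq_0_rank)
  qed simp
  then have "\<not> ball 0 e \<subseteq> G ` S"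
    using e open_not_negligible[of "ball 0 e"] negligible_subset by auto
  then obtain y where "y \<in> ball 0 e" "y \<notin> G ` S" by blast
  then show ?thesis unfolding S_def by (intro exI[of _ y]) auto
qed

text \<open>The change of variables and Sard theorems of the library need a well-ordered index type.\<close>

typedef ('a::finite) fin_index = "{..<CARD('a)}"
  by (auto intro!: exI[of _ 0])

instantiation fin_index :: (finite) "{finite, wellorder}"
begin

definition less_eq_fin_index :: "'a fin_index \<Rightarrow> 'a fin_index \<Rightarrow> bool" where
  "less_eq_fin_index a b \<longleftrightarrow> Rep_fin_index a \<le> Rep_fin_index b"

definition less_fin_index :: "'a fin_index \<Rightarrow> 'a fin_index \<Rightarrow> bool" where
  "less_fin_index a b \<longleftrightarrow> Rep_fin_index a < Rep_fin_index b"

instance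
proof
  show "finite (UNIV :: 'a fin_index set)"
    using type_definition.univ[OF type_definition_fin_index] by (metis finite_imageI finite_lessThan)
next
  fix P and a :: "'a fin_index"
  assume step: "\<And>x::'a fin_index. (\<And>y. y < x \<Longrightarrow> P y) \<Longrightarrow> P x"
  show "P a"
    by (induction "Rep_fin_index a" arbitrary: a rule: less_induct)
      (use step less_fin_index_def in blast)
qed (auto simp: less_eq_fin_index_def less_fin_index_def Rep_fin_index_inject)

end

lemma card_fin_index: "CARD('a::finite fin_index) = CARD('a)"
  by (simp add: type_definition.card[OF type_definition_fin_index])

text \<open>Conjugation by \<pi> matches the permutations in the two Leibniz sums and preserves
  their signs.\<close>

lemma det_reindex:
  fixes A :: "real^'n^'n" and \<pi> :: "'m::finite \<Rightarrow> 'n"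
  assumes bij: "bij \<pi>"
  shows "det (\<chi> i j. A $ \<pi> i $ \<pi> j) = det A"
proof -
  have inv: "inv \<pi> (\<pi> i) = i" "\<pi> (inv \<pi> k) = k" for i k
    using bij by (simp_all add: bij_is_inj bij_is_surj surj_f_inv_f)
  have perm: "\<pi> \<circ> p \<circ> inv \<pi> permutes UNIV" if "p permutes UNIV" for p
    by (rule bij_imp_permutes)
      (use bij_comp[OF bij_imp_bij_inv[OF bij] bij_comp[OF permutes_bij[OF that] bij]] in \<open>simp_all add: o_assoc\<close>)
  have perm': "inv \<pi> \<circ> q \<circ> \<pi> permutes UNIV" if "q permutes UNIV" for q
    by (rule bij_imp_permutes)
      (use bij_comp[OF bij bij_comp[OF permutes_bij[OF that] bij_imp_bij_inv[OF bij]]] in \<open>simp_all add: o_assoc\<close>)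
  have sgn: "sign (\<pi> \<circ> p \<circ> inv \<pi>) = sign p" if "p permutes UNIV" for p
  proof -
    have "map_permutation UNIV \<pi> p = \<pi> \<circ> p \<circ> inv \<pi>"
      using bij by (auto simp: map_permutation_def restrict_id_def fun_eq_iff bij_is_surj)
    then show ?thesis using sign_map_permutation[of \<pi> UNIV p] bij that by (simp add: bij_is_inj)
  qed
  show ?thesis
    unfolding det_def
  proof (rule sum.reindex_bij_witness[where j = "\<lambda>p. \<pi> \<circ> p \<circ> inv \<pi>" and i = "\<lambda>q. inv \<pi> \<circ> q \<circ> \<pi>"])
    fix p :: "'m \<Rightarrow> 'm" assume p: "p \<in> {p. p permutes UNIV}"
    have "(\<Prod>k\<in>UNIV. A $ k $ (\<pi> \<circ> p \<circ> inv \<pi>) k) = (\<Prod>i\<in>UNIV. A $ \<pi> i $ \<pi> (p i))"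
      using prod.reindex_bij_betw[OF bij, of "\<lambda>k. A $ k $ (\<pi> \<circ> p \<circ> inv \<pi>) k"] by (simp add: inv)
    then show "of_int (sign (\<pi> \<circ> p \<circ> inv \<pi>)) * (\<Prod>k\<in>UNIV. A $ k $ (\<pi> \<circ> p \<circ> inv \<pi>) k) =
      of_int (sign p) * (\<Prod>i\<in>UNIV. (\<chi> i j. A $ \<pi> i $ \<pi> j) $ i $ p i)"
      using sgn p by simp
  qed (use perm[unfolded comp_def] perm'[unfolded comp_def] in \<open>auto simp: fun_eq_iff inv comp_def\<close>)
qed

definition reindex :: "('m \<Rightarrow> 'n) \<Rightarrow> real^'n \<Rightarrow> real^'m" where
  "reindex \<pi> x = (\<chi> i. x $ \<pi> i)"

lemma linear_reindex: "linear (reindex \<pi>)"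
  by (rule linearI) (simp_all add: reindex_def vec_eq_iff)

lemma bounded_linear_reindex: "bounded_linear (reindex \<pi>)"
  using linear_reindex linear_conv_bounded_linear by blast

lemma reindex_inverse:
  assumes "bij \<pi>"
  shows "reindex (inv \<pi>) (reindex \<pi> x) = x" "reindex \<pi> (reindex (inv \<pi>) y) = y"
  using assms by (simp_all add: reindex_def vec_eq_iff bij_is_inj bij_is_surj surj_f_inv_f)

definition conjugate :: "('m \<Rightarrow> 'n) \<Rightarrow> (real^'n \<Rightarrow> real^'n) \<Rightarrow> real^'m \<Rightarrow> real^'m" where
  "conjugate \<pi> G y = reindex \<pi> (G (reindex (inv \<pi>) y))"

lemma det_jacobian_conjugate:
  fixes G :: "real^'n \<Rightarrow> real^'n" and \<pi> :: "'m::finite \<Rightarrow> 'n"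
  assumes bij: "bij \<pi>" and G: "G differentiable at x"
  shows "det (jacobian_matrix (conjugate \<pi> G) (reindex \<pi> x)) = det (jacobian_matrix G x)"
proof -
  let ?D = "frechet_derivative G (at x)"
  have "(G has_derivative ?D) (at (reindex (inv \<pi>) (reindex \<pi> x)))"
    unfolding reindex_inverse[OF bij] using G by (simp add: frechet_derivative_works)
  from has_derivative_compose[OF bounded_linear_imp_has_derivative[OF bounded_linear_reindex] this]
  have "((\<lambda>y. G (reindex (inv \<pi>) y)) has_derivative (\<lambda>h. ?D (reindex (inv \<pi>) h))) (at (reindex \<pi> x))" .
  from bounded_linear.has_derivative[OF bounded_linear_reindex this]
  have d: "(conjugate \<pi> G has_derivative (\<lambda>h. reindex \<pi> (?D (reindex (inv \<pi>) h)))) (at (reindex \<pi> x))"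
    unfolding conjugate_def[abs_def] .
  have ax: "reindex (inv \<pi>) (axis j 1) = axis (\<pi> j) (1::real)" for j
    using bij by (auto simp: reindex_def axis_def vec_eq_iff bij_is_surj surj_f_inv_f bij_is_inj)
  have "jacobian_matrix (conjugate \<pi> G) (reindex \<pi> x) = (\<chi> i j. jacobian_matrix G x $ \<pi> i $ \<pi> j)"
    unfolding jacobian_matrix_eq[OF d]
    by (simp add: vec_eq_iff matrix_component ax jacobian_matrix_def) (simp add: reindex_def)
  then show ?thesis by (simp add: det_reindex[OF bij])
qed

lemma C1_on_conjugate:
  fixes G :: "real^'n \<Rightarrow> real^'n" and \<pi> :: "'m::finite \<Rightarrow> 'n"
  assumes bij: "bij \<pi>" and G: "C1_on U G"
  shows "C1_on (reindex \<pi> ` U) (conjugate \<pi> G)"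
  unfolding conjugate_def[abs_def]
proof (rule C1_on_compose[OF C1_on_bounded_linear[OF bounded_linear_reindex] _ subset_UNIV])
  show "C1_on (reindex \<pi> ` U) (\<lambda>x. G (reindex (inv \<pi>) x))"
    by (rule C1_on_compose[OF G C1_on_bounded_linear[OF bounded_linear_reindex]])
      (auto simp: reindex_inverse[OF bij])
qed

lemma exists_bij_fin_index: "\<exists>\<pi> :: 'n fin_index \<Rightarrow> 'n::finite. bij \<pi>"
  using finite_same_card_bij[of "UNIV :: 'n fin_index set" "UNIV :: 'n set"] by (simp add: card_fin_index)

lemma signed_zero_count_conjugate:
  fixes G :: "real^'n \<Rightarrow> real^'n" and \<pi> :: "'m::finite \<Rightarrow> 'n"
  assumes bij: "bij \<pi>" and G: "C1_on U G"
  shows "signed_zero_count (conjugate \<pi> G) (reindex \<pi> ` U) = signed_zero_count G U"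
  unfolding signed_zero_count_def
proof (rule sum.reindex_bij_witness[where i = "reindex \<pi>" and j = "reindex (inv \<pi>)"])
  have z: "reindex \<pi> v = 0 \<longleftrightarrow> v = 0" for v :: "real^'n"
    using reindex_inverse(1)[OF bij, of v] linear_0[OF linear_reindex] by metis
  fix y assume "y \<in> {y. y \<in> reindex \<pi> ` U \<and> conjugate \<pi> G y = 0}"
  then show "reindex (inv \<pi>) y \<in> {x. x \<in> U \<and> G x = 0}"
    "reindex \<pi> (reindex (inv \<pi>) y) = y"
    "sgn (det (jacobian_matrix G (reindex (inv \<pi>) y))) = sgn (det (jacobian_matrix (conjugate \<pi> G) y))"
    using G by (auto simp: reindex_inverse[OF bij] conjugate_def z C1_on_iff_frechet
       det_jacobian_conjugate[OF bij])
next
  fix x assume "x \<in> {x. x \<in> U \<and> G x = 0}"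
  then show "reindex \<pi> x \<in> {y. y \<in> reindex \<pi> ` U \<and> conjugate \<pi> G y = 0}"
    "reindex (inv \<pi>) (reindex \<pi> x) = x"
    by (auto simp: reindex_inverse[OF bij] conjugate_def linear_0[OF linear_reindex])
qed

text \<open>Relabelling the coordinates is a linear homeomorphism, and conjugation by it preserves
  Jacobian determinants at corresponding points; so the result for the well-ordered index type
  carries over.\<close>

lemma signed_zero_count_homotopy:
  fixes G0 G1 :: "real^'n \<Rightarrow> real^'n"
  assumes U: "open U" "bounded U"
    and C1: "C1_on U G0" "C1_on U G1"
    and cont: "continuous_on (closure U) G0" "continuous_on (closure U) G1"
    and reg: "\<And>x. x \<in> U \<Longrightarrow> G0 x = 0 \<Longrightarrow> det (jacobian_matrix G0 x) \<noteq> 0"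
      "\<And>x. x \<in> U \<Longrightarrow> G1 x = 0 \<Longrightarrow> det (jacobian_matrix G1 x) \<noteq> 0"
    and nz: "\<And>x t. x \<in> frontier U \<Longrightarrow> t \<in> {0..1} \<Longrightarrow> (1 - t) *\<^sub>R G0 x + t *\<^sub>R G1 x \<noteq> 0"
  shows "signed_zero_count G0 U = signed_zero_count G1 U"
proof -
  obtain \<pi> :: "'n fin_index \<Rightarrow> 'n" where bij: "bij \<pi>" using exists_bij_fin_index by blast
  let ?U = "reindex \<pi> ` U" and ?G = "conjugate \<pi>"
  have inj: "inj (reindex \<pi> :: real^'n \<Rightarrow> real^'n fin_index)" by (metis injI reindex_inverse(1)[OF bij])
  have surj: "surj (reindex \<pi> :: real^'n \<Rightarrow> real^'n fin_index)" by (metis surjI reindex_inverse(2)[OF bij])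
  have clo: "closure ?U = reindex \<pi> ` closure U"
    by (rule closure_injective_linear_image[OF linear_reindex inj, symmetric])
  have int: "interior ?U = reindex \<pi> ` interior U"
    by (rule interior_bijective_linear_image[OF linear_reindex]) (simp add: bij_def inj surj)
  have fro: "frontier ?U = reindex \<pi> ` frontier U"
    unfolding frontier_def clo int by (rule image_set_diff[OF inj, symmetric])
  have z: "reindex \<pi> v = 0 \<longleftrightarrow> v = 0" for v :: "real^'n"
    using reindex_inverse(1)[OF bij, of v] linear_0[OF linear_reindex] by metis
  have app: "?G G (reindex \<pi> x) = reindex \<pi> (G x)" for G x
    by (simp add: conjugate_def reindex_inverse[OF bij])
  have cont': "continuous_on (closure ?U) (?G G)" if "continuous_on (closure U) G" for G
    unfolding conjugate_def[abs_def] clo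
    by (intro continuous_on_compose2[OF linear_continuous_on[OF bounded_linear_reindex] _ subset_UNIV]
       continuous_on_compose2[OF that linear_continuous_on[OF bounded_linear_reindex]])
      (auto simp: reindex_inverse[OF bij])
  have reg': "det (jacobian_matrix (?G G) y) \<noteq> 0"
    if G: "C1_on U G" and r: "\<And>x. x \<in> U \<Longrightarrow> G x = 0 \<Longrightarrow> det (jacobian_matrix G x) \<noteq> 0"
      and y: "y \<in> ?U" "?G G y = 0" for G y
  proof -
    obtain x where x: "x \<in> U" "y = reindex \<pi> x" using y by blast
    then have "G x = 0" using y(2) app z by simp
    then show ?thesis
      using r[OF x(1)] det_jacobian_conjugate[OF bij, of G x] G x by (simp add: C1_on_iff_frechet)
  qed
  have "signed_zero_count (?G G0) ?U = signed_zero_count (?G G1) ?U"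
  proof (rule signed_zero_count_homotopy_wellorder)
    show "open ?U" using U(1) by (rule open_surjective_linear_image[OF _ linear_reindex surj])
    show "bounded ?U" using U(2) bounded_linear_reindex by (rule bounded_linear_image)
    fix y and t :: real assume "y \<in> frontier ?U" "t \<in> {0..1}"
    then obtain x where x: "x \<in> frontier U" "y = reindex \<pi> x" unfolding fro by blast
    have "(1 - t) *\<^sub>R ?G G0 y + t *\<^sub>R ?G G1 y = reindex \<pi> ((1 - t) *\<^sub>R G0 x + t *\<^sub>R G1 x)"
      unfolding x(2) app by (simp add: linear_add[OF linear_reindex] linear_cmul[OF linear_reindex])
    then show "(1 - t) *\<^sub>R ?G G0 y + t *\<^sub>R ?G G1 y \<noteq> 0" using nz[OF x(1) \<open>t \<in> {0..1}\<close>] z by simp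
  qed (use C1_on_conjugate[OF bij] C1 cont' cont reg' reg in blast)+
  then show ?thesis using C1 by (simp add: signed_zero_count_conjugate[OF bij])
qed

lemma sard_regular_value:
  fixes G :: "real^'n \<Rightarrow> real^'n"
  assumes G: "C1_on UNIV G" and e: "e > 0"
  shows "\<exists>y. norm y < e \<and> (\<forall>x. G x = y \<longrightarrow> det (jacobian_matrix G x) \<noteq> 0)"
proof -
  obtain \<pi> :: "'n fin_index \<Rightarrow> 'n" where bij: "bij \<pi>" using exists_bij_fin_index by blast
  obtain K where K: "K > 0" "\<And>y. norm (reindex (inv \<pi>) y) \<le> norm y * K"
    using bounded_linear.pos_bounded[OF bounded_linear_reindex] by blast
  have surj: "surj (reindex \<pi> :: real^'n \<Rightarrow> real^'n fin_index)" by (metis surjI reindex_inverse(2)[OF bij])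
  have "C1_on UNIV (conjugate \<pi> G)" using C1_on_conjugate[OF bij G] surj by simp
  from sard_regular_value_wellorder[OF this, of "e / K"]
  obtain y where y: "norm y < e / K" "\<And>x. conjugate \<pi> G x = y \<Longrightarrow> det (jacobian_matrix (conjugate \<pi> G) x) \<noteq> 0"
    using e K by auto
  show ?thesis
  proof (intro exI[of _ "reindex (inv \<pi>) y"] conjI allI impI)
    show "norm (reindex (inv \<pi>) y) < e" using K(2)[of y] y(1) K(1) by (simp add: field_simps)
    fix x assume "G x = reindex (inv \<pi>) y"
    then have "conjugate \<pi> G (reindex \<pi> x) = y" by (simp add: conjugate_def reindex_inverse[OF bij])
    from y(2)[OF this] show "det (jacobian_matrix G x) \<noteq> 0"
      using det_jacobian_conjugate[OF bij, of G x] G by (simp add: C1_on_iff_frechet)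
  qed
qed

section \<open>Brouwer degree\<close>

text \<open>A polynomial approximation from Stone-Weierstrass is shifted by a small regular value
  from Sard's theorem, which makes 0 a regular value; each of the two changes costs at most
  \<open>e / 2\<close>.\<close>

lemma exists_regular_approximation:
  fixes F :: "real^'n \<Rightarrow> real^'n"
  assumes S: "compact S" and F: "continuous_on S F" and e: "e > 0"
  obtains G where "C1_on UNIV G" "\<And>x. x \<in> S \<Longrightarrow> dist (G x) (F x) < e"
    "\<And>x. G x = 0 \<Longrightarrow> det (jacobian_matrix G x) \<noteq> 0"
proof -
  obtain P where P: "polynomial_function P" "\<And>x. x \<in> S \<Longrightarrow> norm (F x - P x) < e / 2"
    using Stone_Weierstrass_polynomial_function[OF S F, of "e / 2"] e by auto
  have PC: "C1_on UNIV P" by (rule C1_on_polynomial_function[OF P(1)])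
  obtain y where y: "norm y < e / 2" "\<And>x. P x = y \<Longrightarrow> det (jacobian_matrix P x) \<noteq> 0"
    using sard_regular_value[OF PC, of "e / 2"] e by auto
  let ?G = "\<lambda>x. P x - y"
  show ?thesis
  proof
    show "C1_on UNIV ?G" by (rule C1_on_diff[OF PC C1_on_const])
    show "dist (?G x) (F x) < e" if "x \<in> S" for x
    proof -
      have "norm (P x - y - F x) \<le> norm (F x - P x) + norm y"
        using norm_triangle_ineq4[of "P x - F x" y] by (simp add: norm_minus_commute algebra_simps)
      then show ?thesis using P(2)[OF that] y(1) by (simp add: dist_norm)
    qed
    fix x assume "?G x = 0"
    then have "P x = y" by simp
    have "(P has_derivative frechet_derivative P (at x)) (at x)" by (rule C1_on_has_derivative[OF PC UNIV_I])
    from has_derivative_diff[OF this has_derivative_const[of y]]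
    have "jacobian_matrix ?G x = jacobian_matrix P x"
      using jacobian_matrix_eq[of ?G] by (simp add: jacobian_matrix_def)
    then show "det (jacobian_matrix ?G x) \<noteq> 0" using y(2)[OF \<open>P x = y\<close>] by simp
  qed
qed

lemma signed_zero_count_in_Ints: "signed_zero_count G U \<in> \<int>"
  unfolding signed_zero_count_def by (rule Ints_sum) (simp add: sgn_if)

text \<open>Convexity of balls. It transfers the nonvanishing of a straight-line homotopy to
  approximations of its two ends.\<close>

lemma convex_combination_dist:
  fixes a b c d :: "'a::real_normed_vector"
  assumes "dist a c < m" "dist b d < m" "t \<in> {0..1::real}"
  shows "dist ((1 - t) *\<^sub>R a + t *\<^sub>R b) ((1 - t) *\<^sub>R c + t *\<^sub>R d) < m"
proof -
  have "(1 - t) *\<^sub>R (a - c) + t *\<^sub>R (b - d) \<in> ball 0 m"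
    using assms by (intro convexD[OF convex_ball]) (auto simp: dist_norm norm_minus_commute)
  moreover have "(1 - t) *\<^sub>R (a - c) + t *\<^sub>R (b - d) = ((1 - t) *\<^sub>R a + t *\<^sub>R b) - ((1 - t) *\<^sub>R c + t *\<^sub>R d)"
    by (simp add: scaleR_right_diff_distrib)
  ultimately show ?thesis by (metis dist_norm dist_0_norm mem_ball)
qed

text \<open>At a frontier point two regular approximations lie in a ball around \<open>F x\<close>
  that misses 0, and so does the segment between them. By homotopy invariance they have equal
  counts, so the description in \<open>brouwer_degree\<close> is unique.\<close>

lemma brouwer_degree_eq_signed_zero_count:
  fixes F G :: "real^'n \<Rightarrow> real^'n"
  assumes U: "open U" "bounded U" and G: "regular_approximation F U G"
  shows "real_of_int (brouwer_degree F U) = signed_zero_count G U"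
proof -
  have eq: "signed_zero_count H U = signed_zero_count G U" if H: "regular_approximation F U H" for H
  proof (rule signed_zero_count_homotopy[OF U])
    fix x and t :: real assume x: "x \<in> frontier U" and t: "t \<in> {0..1}"
    have xc: "x \<in> closure U" using x by (simp add: frontier_def)
    let ?i = "infdist 0 (F ` frontier U)"
    have "dist (H x) (F x) < ?i" "dist (G x) (F x) < ?i"
      using G H xc unfolding regular_approximation_def by auto
    from convex_combination_dist[OF this t]
    have "dist ((1 - t) *\<^sub>R H x + t *\<^sub>R G x) (F x) < ?i"
      by (simp add: scaleR_left_distrib[symmetric])
    moreover have "?i \<le> dist 0 (F x)" using x by (intro infdist_le) auto
    ultimately show "(1 - t) *\<^sub>R H x + t *\<^sub>R G x \<noteq> 0" by (metis not_le)
  qed (use G H in \<open>auto simp: regular_approximation_def\<close>)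
  obtain d where d: "signed_zero_count G U = real_of_int d"
    using signed_zero_count_in_Ints[of G U] by (auto elim: Ints_cases)
  have "brouwer_degree F U = d"
    unfolding brouwer_degree_def signed_zero_count_def[symmetric]
  proof (rule the_equality)
    show "\<exists>G. regular_approximation F U G \<and> real_of_int d = signed_zero_count G U"
      using G d by auto
    show "d' = d" if "\<exists>G. regular_approximation F U G \<and> real_of_int d' = signed_zero_count G U" for d'
      using that eq d by auto
  qed
  then show ?thesis using d by simp
qed

text \<open>For an empty frontier \<open>infdist\<close> has the default value 0, and no point could
  satisfy the strict bound in \<open>regular_approximation\<close>. In that case the closure of
  \<open>U\<close> is empty and the bound is vacuous.\<close>

lemma bounded_open_frontier_empty:
  fixes U :: "'a::euclidean_space set"
  assumes "bounded U" "frontier U = {}"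
  shows "U = {}"
  using assms frontier_eq_empty[of U] not_bounded_UNIV by auto

lemma regular_approximationI:
  fixes F G :: "real^'n \<Rightarrow> real^'n"
  assumes U: "bounded U" and F: "\<And>x. x \<in> frontier U \<Longrightarrow> m \<le> norm (F x)"
    and G: "C1_on UNIV G" "\<And>x. x \<in> closure U \<Longrightarrow> dist (G x) (F x) < m"
    "\<And>x. G x = 0 \<Longrightarrow> det (jacobian_matrix G x) \<noteq> 0"
  shows "regular_approximation F U G"
  unfolding regular_approximation_def
proof (intro conjI ballI impI)
  show "continuous_on (closure U) G" using C1_on_imp_continuous_on[OF G(1)] continuous_on_subset by blast
  show "C1_on U G" using C1_on_subset[OF G(1)] by blast
  fix x assume x: "x \<in> closure U"
  then have "U \<noteq> {}" by auto
  then have "frontier U \<noteq> {}" using bounded_open_frontier_empty[OF U] by blast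
  then have "m \<le> infdist 0 (F ` frontier U)"
    unfolding infdist_def using F by (auto intro!: cINF_greatest)
  then show "dist (G x) (F x) < infdist 0 (F ` frontier U)" using G(2)[OF x] by simp
qed (use G(3) in auto)

lemma compact_norm_bound_below:
  fixes F :: "'a::topological_space \<Rightarrow> 'b::real_normed_vector"
  assumes "compact S" "continuous_on S F" "\<And>x. x \<in> S \<Longrightarrow> F x \<noteq> 0"
  shows "\<exists>m>0. \<forall>x\<in>S. m \<le> norm (F x)"
proof (cases "S = {}")
  case False
  from continuous_attains_inf[OF assms(1) False continuous_on_norm[OF assms(2)]]
  obtain x where x: "x \<in> S" "\<forall>y\<in>S. norm (F x) \<le> norm (F y)" by blast
  then show ?thesis using assms(3)[OF x(1)] by (intro exI[of _ "norm (F x)"]) simp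
qed (auto intro: exI[of _ 1])

text \<open>By compactness one \<open>m\<close> bounds all stages on the frontier from below.
  Approximations of the two ends within \<open>m\<close> are then joined by a segment without zeros
  on the frontier.\<close>

lemma brouwer_degree_linear_homotopy:
  fixes F0 F1 :: "real^'n \<Rightarrow> real^'n"
  assumes U: "open U" "bounded U"
    and F: "continuous_on (closure U) F0" "continuous_on (closure U) F1"
    and nz: "\<And>x t. x \<in> frontier U \<Longrightarrow> t \<in> {0..1} \<Longrightarrow> (1 - t) *\<^sub>R F0 x + t *\<^sub>R F1 x \<noteq> 0"
  shows "brouwer_degree F0 U = brouwer_degree F1 U"
proof -
  let ?H = "\<lambda>p. (1 - fst p) *\<^sub>R F0 (snd p) + fst p *\<^sub>R F1 (snd p)"
  have cU: "compact (closure U)" using U(2) by simp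
  have fc: "frontier U \<subseteq> closure U" by (simp add: frontier_def)
  have "compact (frontier U)" using U(2) by (rule compact_frontier_bounded)
  then have "compact ({0..1::real} \<times> frontier U)" by (intro compact_Times compact_Icc)
  moreover have "continuous_on ({0..1::real} \<times> frontier U) ?H"
    by (intro continuous_intros continuous_on_compose2[OF F(1)] continuous_on_compose2[OF F(2)]) (use fc in auto)
  moreover have "?H p \<noteq> 0" if "p \<in> {0..1::real} \<times> frontier U" for p
    using that nz by (simp add: mem_Times_iff)
  ultimately have "\<exists>m>0. \<forall>p\<in>{0..1::real} \<times> frontier U. m \<le> norm (?H p)"
    by (rule compact_norm_bound_below)
  then obtain m where m: "m > 0" "\<And>p. p \<in> {0..1::real} \<times> frontier U \<Longrightarrow> m \<le> norm (?H p)" by blast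
  have mt: "m \<le> norm ((1 - t) *\<^sub>R F0 x + t *\<^sub>R F1 x)" if "t \<in> {0..1}" "x \<in> frontier U" for t x
    using m(2)[of "(t, x)"] that by simp
  obtain G0 where G0: "C1_on UNIV G0" "\<And>x. x \<in> closure U \<Longrightarrow> dist (G0 x) (F0 x) < m"
    "\<And>x. G0 x = 0 \<Longrightarrow> det (jacobian_matrix G0 x) \<noteq> 0"
    using exists_regular_approximation[OF cU F(1) m(1)] by blast
  obtain G1 where G1: "C1_on UNIV G1" "\<And>x. x \<in> closure U \<Longrightarrow> dist (G1 x) (F1 x) < m"
    "\<And>x. G1 x = 0 \<Longrightarrow> det (jacobian_matrix G1 x) \<noteq> 0"
    using exists_regular_approximation[OF cU F(2) m(1)] by blast
  have r0: "regular_approximation F0 U G0"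
    by (rule regular_approximationI[OF U(2) _ G0]) (use mt[of 0] in simp_all)
  have r1: "regular_approximation F1 U G1"
    by (rule regular_approximationI[OF U(2) _ G1]) (use mt[of 1] in simp_all)
  have "signed_zero_count G0 U = signed_zero_count G1 U"
  proof (rule signed_zero_count_homotopy[OF U])
    fix x and t :: real assume x: "x \<in> frontier U" and t: "t \<in> {0..1}"
    have xc: "x \<in> closure U" using x fc by blast
    from convex_combination_dist[OF G0(2)[OF xc] G1(2)[OF xc] t] mt[OF t x]
    show "(1 - t) *\<^sub>R G0 x + t *\<^sub>R G1 x \<noteq> 0" by (metis dist_0_norm not_le)
  qed (use r0 r1 in \<open>auto simp: regular_approximation_def\<close>)
  then show ?thesis
    using brouwer_degree_eq_signed_zero_count[OF U r0] brouwer_degree_eq_signed_zero_count[OF U r1] by simp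
qed

text \<open>By uniform continuity, stages whose times differ by less than \<open>d\<close> are close
  enough for a straight-line homotopy; finitely many such steps lead from 0 to
  \<open>T\<close>.\<close>

lemma brouwer_degree_homotopy:
  fixes H :: "real \<Rightarrow> real^'n \<Rightarrow> real^'n"
  assumes U: "open U" "bounded U" and T: "0 \<le> T"
    and H: "continuous_on ({0..T} \<times> closure U) (\<lambda>(s, x). H s x)"
    and nz: "\<And>s x. s \<in> {0..T} \<Longrightarrow> x \<in> frontier U \<Longrightarrow> H s x \<noteq> 0"
  shows "brouwer_degree (H 0) U = brouwer_degree (H T) U"
proof -
  have fc: "frontier U \<subseteq> closure U" by (simp add: frontier_def)
  have cU: "compact ({0..T} \<times> closure U)" using U(2) by (intro compact_Times) auto
  have "compact ({0..T} \<times> frontier U)" using U(2) by (intro compact_Times compact_frontier_bounded) auto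
  from compact_norm_bound_below[OF this continuous_on_subset[OF H]]
  obtain m where m: "m > 0" "\<And>s x. s \<in> {0..T} \<Longrightarrow> x \<in> frontier U \<Longrightarrow> m \<le> norm (H s x)"
    using nz fc by (auto simp: subset_iff)
  have "uniformly_continuous_on ({0..T} \<times> closure U) (\<lambda>(s, x). H s x)"
    using compact_uniformly_continuous[OF H cU] .
  then obtain d where d: "d > 0" "\<And>p q. p \<in> {0..T} \<times> closure U \<Longrightarrow> q \<in> {0..T} \<times> closure U \<Longrightarrow>
     dist q p < d \<Longrightarrow> dist (case q of (s, x) \<Rightarrow> H s x) (case p of (s, x) \<Rightarrow> H s x) < m"
    using m(1) unfolding uniformly_continuous_on_def by meson
  have cont: "continuous_on (closure U) (H s)" if "s \<in> {0..T}" for s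
  proof -
    have "continuous_on (closure U) (\<lambda>x. (s, x))" by (intro continuous_intros)
    moreover have "(\<lambda>x. (s, x)) ` closure U \<subseteq> {0..T} \<times> closure U" using that by blast
    ultimately have "continuous_on (closure U) (\<lambda>x. case (s, x) of (s, x) \<Rightarrow> H s x)"
      by (rule continuous_on_compose2[OF H])
    then show ?thesis by simp
  qed
  have near: "brouwer_degree (H s) U = brouwer_degree (H r) U" if s: "s \<in> {0..T}" "r \<in> {0..T}" "\<bar>s - r\<bar> < d" for s r
  proof (rule brouwer_degree_linear_homotopy[OF U cont[OF s(1)] cont[OF s(2)]])
    fix x and t :: real assume x: "x \<in> frontier U" and t: "t \<in> {0..1}"
    have "dist (s, x) (r, x) < d" using s(3) by (simp add: dist_Pair_Pair dist_real_def)
    then have "dist (H s x) (H r x) < m" using d(2)[of "(r, x)" "(s, x)"] s x fc by auto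
    then have a: "dist (H s x) (H r x) < norm (H r x)" using m(2)[OF s(2) x] by simp
    have b: "dist (H r x) (H r x) < norm (H r x)" using nz[OF s(2) x] by simp
    have "dist ((1 - t) *\<^sub>R H s x + t *\<^sub>R H r x) ((1 - t) *\<^sub>R H r x + t *\<^sub>R H r x) < norm (H r x)"
      by (rule convex_combination_dist[OF a b t])
    moreover have "(1 - t) *\<^sub>R H r x + t *\<^sub>R H r x = H r x" by (simp add: scaleR_left_distrib[symmetric])
    ultimately show "(1 - t) *\<^sub>R H s x + t *\<^sub>R H r x \<noteq> 0" by (metis dist_0_norm less_irrefl)
  qed
  \<comment> \<open>The added 1 makes the step \<open>T / real N\<close> strictly shorter than
    \<open>d\<close>, and \<open>N\<close> positive even if \<open>T = 0\<close>.\<close>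
  define N where "N = nat \<lceil>T / d\<rceil> + 1"
  have N: "real N > T / d" "N > 0" unfolding N_def by linarith+
  have "brouwer_degree (H (real k * T / real N)) U = brouwer_degree (H 0) U" if "k \<le> N" for k
    using that
  proof (induction k)
    case (Suc k)
    have in0T: "real j * T / real N \<in> {0..T}" if "j \<le> N" for j
    proof -
      have "real j / real N \<le> 1" using that N(2) by simp
      then have "real j / real N * T \<le> 1 * T" using T by (intro mult_right_mono) auto
      then show ?thesis using T by simp
    qed
    have "real (Suc k) * T / real N - real k * T / real N = T / real N" using N(2) by (simp add: field_simps)
    moreover have "T / real N < d" using N d(1) by (simp add: field_simps)
    ultimately have "\<bar>real (Suc k) * T / real N - real k * T / real N\<bar> < d" using T by simp
    then have "brouwer_degree (H (real (Suc k) * T / real N)) U = brouwer_degree (H (real k * T / real N)) U"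
      using Suc.prems by (intro near in0T) auto
    then show ?case using Suc by simp
  qed simp
  from this[of N] show ?thesis using N(2) by simp
qed

text \<open>An approximation within the minimum \<open>m\<close> of |F| off the \<open>V i\<close>
  is regular for \<open>U\<close> and for every \<open>V i\<close> simultaneously, and all its zeros
  in \<open>U\<close> lie in the \<open>V i\<close>. A one-element \<open>I\<close> gives excision;
  an empty \<open>I\<close> gives degree 0 for a map without zeros.\<close>

lemma brouwer_degree_additive:
  fixes F :: "real^'n \<Rightarrow> real^'n"
  assumes U: "open U" "bounded U" and F: "continuous_on (closure U) F"
    and I: "finite I" and V: "\<And>i. i \<in> I \<Longrightarrow> open (V i)" "\<And>i. i \<in> I \<Longrightarrow> V i \<subseteq> U"
    and disj: "\<And>i j. i \<in> I \<Longrightarrow> j \<in> I \<Longrightarrow> i \<noteq> j \<Longrightarrow> V i \<inter> V j = {}"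
    and nz: "\<And>x. x \<in> closure U - (\<Union>i\<in>I. V i) \<Longrightarrow> F x \<noteq> 0"
  shows "brouwer_degree F U = (\<Sum>i\<in>I. brouwer_degree F (V i))"
proof -
  have cU: "compact (closure U)" using U(2) by simp
  let ?K = "closure U - (\<Union>i\<in>I. V i)"
  have "compact ?K" using cU V(1) by (intro compact_diff) auto
  from compact_norm_bound_below[OF this continuous_on_subset[OF F] nz]
  obtain m where m: "m > 0" "\<And>x. x \<in> ?K \<Longrightarrow> m \<le> norm (F x)" by auto
  obtain G where G: "C1_on UNIV G" "\<And>x. x \<in> closure U \<Longrightarrow> dist (G x) (F x) < m"
    "\<And>x. G x = 0 \<Longrightarrow> det (jacobian_matrix G x) \<noteq> 0"
    using exists_regular_approximation[OF cU F m(1)] by blast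
  have VU: "(\<Union>i\<in>I. V i) \<subseteq> U" using V(2) by blast
  have "frontier U \<subseteq> ?K" using VU U(1) by (auto simp: frontier_def interior_open)
  then have rU: "regular_approximation F U G"
    by (intro regular_approximationI[OF U(2) _ G]) (use m(2) in auto)
  have bV: "bounded (V i)" if "i \<in> I" for i using bounded_subset[OF U(2) V(2)[OF that]] .
  have rV: "regular_approximation F (V i) G" if i: "i \<in> I" for i
  proof (rule regular_approximationI[OF bV[OF i] _ G(1) G(2) G(3)])
    have c: "closure (V i) \<subseteq> closure U" by (rule closure_mono[OF V(2)[OF i]])
    show "m \<le> norm (F x)" if x: "x \<in> frontier (V i)" for x
    proof (rule m(2))
      have xc: "x \<in> closure (V i)" "x \<notin> V i" using x V(1)[OF i] by (auto simp: frontier_def interior_open)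
      have "x \<notin> V j" if j: "j \<in> I" for j
      proof
        assume "x \<in> V j"
        then have "j \<noteq> i" using xc by blast
        \<comment> \<open>An open set disjoint from \<open>V i\<close> is disjoint from its closure,
          so frontier points of \<open>V i\<close> lie in no \<open>V j\<close>.\<close>
        then have "V j \<inter> V i = {}" using disj i j by blast
        then have "V j \<inter> closure (V i) = {}" using open_Int_closure_eq_empty[OF V(1)[OF j]] by blast
        then show False using xc \<open>x \<in> V j\<close> by blast
      qed
      then show "x \<in> ?K" using xc c by blast
    qed
    show "x \<in> closure U" if "x \<in> closure (V i)" for x using that c by blast
  qed auto
  have fin: "finite {x \<in> closure U. G x = 0}"
    by (rule finite_regular_zeros[OF open_UNIV G(1) cU subset_UNIV G(3)])
  have "x \<in> (\<Union>i\<in>I. V i)" if "x \<in> U" "G x = 0" for x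
  proof (rule ccontr)
    assume "x \<notin> (\<Union>i\<in>I. V i)"
    moreover have "x \<in> closure U" using that(1) closure_subset by blast
    ultimately show False using m(2)[of x] G(2)[of x] that(2) by auto
  qed
  then have Z: "{x. x \<in> U \<and> G x = 0} = (\<Union>i\<in>I. {x. x \<in> V i \<and> G x = 0})" using VU by blast
  have "signed_zero_count G U = (\<Sum>i\<in>I. signed_zero_count G (V i))"
    unfolding signed_zero_count_def Z
  proof (rule sum.UNION_disjoint[OF I])
    show "\<forall>i\<in>I. finite {x. x \<in> V i \<and> G x = 0}"
    proof
      fix i assume "i \<in> I"
      then have "{x. x \<in> V i \<and> G x = 0} \<subseteq> {x \<in> closure U. G x = 0}" using V(2) closure_subset by blast
      then show "finite {x. x \<in> V i \<and> G x = 0}" using fin finite_subset by blast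
    qed
    show "\<forall>i\<in>I. \<forall>j\<in>I. i \<noteq> j \<longrightarrow> {x. x \<in> V i \<and> G x = 0} \<inter> {x. x \<in> V j \<and> G x = 0} = {}"
      using disj by blast
  qed
  then have "real_of_int (brouwer_degree F U) = (\<Sum>i\<in>I. real_of_int (brouwer_degree F (V i)))"
    using brouwer_degree_eq_signed_zero_count[OF U rU]
      brouwer_degree_eq_signed_zero_count[OF V(1) bV rV] by simp
  then show ?thesis by (metis of_int_eq_iff of_int_sum)
qed

lemma brouwer_degree_linear_ball:
  fixes A :: "real^'n^'n"
  assumes A: "det A \<noteq> 0" and r: "r > 0"
  shows "real_of_int (brouwer_degree (\<lambda>x. A *v (x - a)) (ball a r)) = sgn (det A)"
proof -
  let ?L = "\<lambda>x. A *v (x - a)"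
  have ker: "A *v v = 0 \<longleftrightarrow> v = 0" for v
    using A invertible_det_nz[of A] invertible_left_inverse[of A] matrix_left_invertible_ker[of A] by auto
  have d: "(?L has_derivative (\<lambda>h. A *v h)) (at x)" for x
  proof -
    have "((\<lambda>x. x - a) has_derivative (\<lambda>h. h)) (at x)" by (auto intro!: derivative_eq_intros)
    from bounded_linear.has_derivative[OF matrix_vector_mul_bounded_linear[of A] this] show ?thesis .
  qed
  have J: "jacobian_matrix ?L x = A" for x
    using jacobian_matrix_eq[OF d] by simp
  have L: "C1_on UNIV ?L"
    by (rule C1_onI[OF d]) auto
  have co: "compact (frontier (ball a r))" by (rule compact_frontier_bounded[OF bounded_ball])
  have nz: "?L x \<noteq> 0" if "x \<in> frontier (ball a r)" for x
  proof -
    have "dist a x = r" using that unfolding frontier_ball[OF r] by (simp only: mem_sphere)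
    then have "x - a \<noteq> 0" using r by (metis dist_self less_irrefl right_minus_eq)
    then show ?thesis using ker by blast
  qed
  have "\<exists>m>0. \<forall>x\<in>frontier (ball a r). m \<le> norm (?L x)"
    by (rule compact_norm_bound_below[OF co continuous_on_subset[OF C1_on_imp_continuous_on[OF L] subset_UNIV] nz])
  then obtain m where m: "m > 0" "\<And>x. x \<in> frontier (ball a r) \<Longrightarrow> m \<le> norm (?L x)" by blast
  have "regular_approximation ?L (ball a r) ?L"
    by (rule regular_approximationI[OF bounded_ball m(2) L]) (use m(1) A J in simp_all)
  from brouwer_degree_eq_signed_zero_count[OF open_ball bounded_ball this]
  have "real_of_int (brouwer_degree ?L (ball a r)) = signed_zero_count ?L (ball a r)" .
  also have "{x. x \<in> ball a r \<and> ?L x = 0} = {a}"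
  proof -
    have "?L x = 0 \<longleftrightarrow> x = a" for x unfolding ker by simp
    then show ?thesis using centre_in_ball[of a r] r by blast
  qed
  then have "signed_zero_count ?L (ball a r) = sgn (det A)"
    unfolding signed_zero_count_def by (simp add: J)
  finally show ?thesis .
qed

text \<open>Near \<open>a\<close> the linear part dominates: |D h| is at least c |h| while the
  remainder is at most half of that. So the straight-line homotopy from \<open>F\<close> to its
  linear part has no zero on small spheres; time 0 of the same estimate isolates the zero
  \<open>a\<close>.\<close>

lemma brouwer_degree_local:
  fixes F :: "real^'n \<Rightarrow> real^'n"
  assumes d: "(F has_derivative D) (at a)" and F0: "F a = 0" and reg: "det (matrix D) \<noteq> 0"
  obtains r0 where "r0 > 0" "\<And>x. dist x a < r0 \<Longrightarrow> F x = 0 \<Longrightarrow> x = a"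
    "\<And>r. 0 < r \<Longrightarrow> r < r0 \<Longrightarrow> continuous_on (cball a r) F \<Longrightarrow>
       real_of_int (brouwer_degree F (ball a r)) = sgn (det (matrix D))"
proof -
  have lin: "linear D" using d by (rule has_derivative_linear)
  have D: "D h = matrix D *v h" for h using lin by (simp add: matrix_works)
  have "inj D" using reg lin by (simp add: det_nz_iff_inj)
  from linear_inj_bounded_below_pos[OF lin this]
  obtain c where c: "c > 0" "\<And>h. c * norm h \<le> norm (D h)" by metis
  have "c / 2 > 0" using c by simp
  with d obtain r0 where r0: "r0 > 0" "\<And>x. norm (x - a) < r0 \<Longrightarrow> norm (F x - F a - D (x - a)) \<le> c / 2 * norm (x - a)"
    unfolding has_derivative_at_alt by blast
  have near: "(1 - t) *\<^sub>R F x + t *\<^sub>R (matrix D *v (x - a)) \<noteq> 0"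
    if x: "norm (x - a) < r0" "x \<noteq> a" and t: "t \<in> {0..1}" for x t
  proof
    assume 0: "(1 - t) *\<^sub>R F x + t *\<^sub>R (matrix D *v (x - a)) = 0"
    have "v = - ((1 - t) *\<^sub>R (F x - v))" if "(1 - t) *\<^sub>R F x + t *\<^sub>R v = 0" for v
      using that by (simp add: algebra_simps)
    then have "D (x - a) = - ((1 - t) *\<^sub>R (F x - D (x - a)))"
      using 0 unfolding D[symmetric] by blast
    then have "norm (D (x - a)) = (1 - t) * norm (F x - D (x - a))"
      using t by (metis norm_minus_cancel norm_scaleR abs_of_nonneg atLeastAtMost_iff diff_ge_0_iff_ge)
    also have "\<dots> \<le> 1 * norm (F x - D (x - a))" using t by (intro mult_right_mono) auto
    also have "\<dots> \<le> c / 2 * norm (x - a)" using r0(2)[OF x(1)] F0 by simp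
    also have "\<dots> < c * norm (x - a)" using c x(2) by simp
    also have "\<dots> \<le> norm (D (x - a))" by (rule c(2))
    finally show False by simp
  qed
  show ?thesis
  proof
    show "x = a" if "dist x a < r0" "F x = 0" for x
      using near[of x 0] that by (auto simp: dist_norm)
    fix r assume r: "0 < r" "r < r0" and F: "continuous_on (cball a r) F"
    have "brouwer_degree F (ball a r) = brouwer_degree (\<lambda>x. matrix D *v (x - a)) (ball a r)"
    proof (rule brouwer_degree_linear_homotopy[OF open_ball bounded_ball])
      show "continuous_on (closure (ball a r)) F" using F r by (simp add: closure_ball)
      show "continuous_on (closure (ball a r)) (\<lambda>x. matrix D *v (x - a))"
        unfolding D[symmetric] by (intro linear_continuous_on_compose[OF _ lin] continuous_intros)
      fix x and t :: real assume "x \<in> frontier (ball a r)" "t \<in> {0..1}"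
      then have x: "dist a x = r" "t \<in> {0..1}"
        unfolding frontier_ball[OF r(1)] by (simp_all only: mem_sphere)
      show "(1 - t) *\<^sub>R F x + t *\<^sub>R (matrix D *v (x - a)) \<noteq> 0"
      proof (rule near[OF _ _ x(2)])
        show "norm (x - a) < r0" using x(1) r by (metis dist_commute dist_norm)
        show "x \<noteq> a" using x(1) r by (metis dist_self less_irrefl)
      qed
    qed
    then show "real_of_int (brouwer_degree F (ball a r)) = sgn (det (matrix D))"
      using brouwer_degree_linear_ball[OF reg r(1)] by simp
  qed (rule r0)
qed

section \<open>The sign of a determinant and the fixed point index\<close>

definition negative_root_count :: "real poly \<Rightarrow> nat" where
  "negative_root_count p = (\<Sum>\<mu> | \<mu> < 0 \<and> poly p \<mu> = 0. order \<mu> p)"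

lemma negative_root_count_linear_factor:
  assumes q: "q \<noteq> 0" and mu: "\<mu> < 0"
  shows "negative_root_count ([:- \<mu>, 1:] * q) = negative_root_count q + 1"
proof -
  let ?l = "[:- \<mu>, 1:]" and ?Z = "{\<nu>. \<nu> < 0 \<and> poly q \<nu> = 0}"
  have p: "?l * q \<noteq> 0" using q by (metis mult_eq_0_iff one_neq_zero pCons_eq_0_iff)
  have fin: "finite ?Z" using poly_roots_finite[OF q] by (rule rev_finite_subset) auto
  have ol: "order \<nu> ?l = (if \<nu> = \<mu> then 1 else 0)" for \<nu>
  proof (cases "\<nu> = \<mu>")
    case True
    then show ?thesis using order_power_n_n[of \<mu> 1] by simp
  next
    case False
    then have "poly ?l \<nu> \<noteq> 0" by simp
    then show ?thesis using False by (simp add: order_0I)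
  qed
  have Z: "{\<nu>. \<nu> < 0 \<and> poly (?l * q) \<nu> = 0} = insert \<mu> ?Z" using mu by auto
  have "negative_root_count (?l * q) = (\<Sum>\<nu>\<in>insert \<mu> ?Z. (if \<nu> = \<mu> then 1 else 0) + order \<nu> q)"
    unfolding negative_root_count_def Z by (intro sum.cong) (simp_all only: order_mult[OF p] ol)
  also have "\<dots> = 1 + (\<Sum>\<nu>\<in>insert \<mu> ?Z. order \<nu> q)"
    using fin by (simp add: sum.distrib)
  also have "(\<Sum>\<nu>\<in>insert \<mu> ?Z. order \<nu> q) = (\<Sum>\<nu>\<in>?Z. order \<nu> q)"
    using mu fin by (intro sum.mono_neutral_right) (auto simp: order_root)
  finally show ?thesis unfolding negative_root_count_def by simp
qed

text \<open>Each negative root, counted with multiplicity, contributes one sign change; linear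
  factors are split off by induction on the degree. Without negative roots the intermediate value
  theorem keeps the sign constant up to 0.\<close>

lemma sgn_poly_at_minus_infinity:
  assumes "poly p 0 \<noteq> 0"
  shows "\<exists>B<0. \<forall>x\<le>B. sgn (poly p x) = (-1) ^ negative_root_count p * sgn (poly p 0)"
  using assms
proof (induction "degree p" arbitrary: p rule: less_induct)
  case less
  show ?case
  proof (cases "\<exists>\<mu><0. poly p \<mu> = 0")
    case True
    then obtain \<mu> where mu: "\<mu> < 0" "poly p \<mu> = 0" by blast
    then obtain q where q: "p = [:- \<mu>, 1:] * q" using poly_eq_0_iff_dvd by blast
    have q0: "poly q 0 \<noteq> 0" using less.prems q by simp
    then have qn: "q \<noteq> 0" by auto
    have "degree q < degree p" unfolding q using qn by (subst degree_mult_eq) auto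
    from less.hyps[OF this q0] obtain B where B: "B < 0"
      "\<And>x. x \<le> B \<Longrightarrow> sgn (poly q x) = (-1) ^ negative_root_count q * sgn (poly q 0)" by blast
    have "sgn (poly p x) = (-1) ^ negative_root_count p * sgn (poly p 0)" if "x \<le> min B (\<mu> - 1)" for x
    proof -
      have "poly p x = (x - \<mu>) * poly q x" unfolding q by (simp add: algebra_simps)
      moreover have "poly p 0 = (- \<mu>) * poly q 0" unfolding q by simp
      moreover have "sgn (x - \<mu>) = -1" "sgn (- \<mu>) = 1" using that mu by auto
      ultimately show ?thesis
        using B(2)[of x] that negative_root_count_linear_factor[OF qn mu(1)]
        by (simp only: sgn_mult q) simp
    qed
    then show ?thesis using B(1) by (intro exI[of _ "min B (\<mu> - 1)"]) auto
  next
    case False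
    have "negative_root_count p = 0" unfolding negative_root_count_def using False by (intro sum.neutral) auto
    moreover have "sgn (poly p x) = sgn (poly p 0)" if "x \<le> -1" for x
    proof (rule ccontr)
      assume n: "sgn (poly p x) \<noteq> sgn (poly p 0)"
      have "poly p x \<noteq> 0" using False that by auto
      then have "poly p x * poly p 0 < 0"
        using n less.prems by (auto simp: sgn_if mult_less_0_iff split: if_splits)
      moreover have "x < 0" using that by simp
      ultimately obtain y where "x < y" "y < 0" "poly p y = 0" using poly_IVT[of x 0 p] by blast
      then show False using False by blast
    qed
    ultimately show ?thesis by (intro exI[of _ "-1"]) auto
  qed
qed

text \<open>The signs of the characteristic polynomial at 0 and far to the left are compared. With
  \<open>n = CARD('n)\<close>, its value at 0 is (-1)^n det A, its sign far to the left is (-1)^n,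
  and the two differ by one factor -1 for each negative root with multiplicity.\<close>

lemma sgn_det_eq_negative_eigenvalue_count:
  fixes A :: "real^'n^'n"
  assumes A: "det A \<noteq> 0"
  shows "(-1) ^ negative_eigenvalue_count A = sgn (det A)"
proof -
  let ?p = "charpoly A" and ?n = "CARD('n)"
  have ev: "(\<exists>v. v \<noteq> 0 \<and> A *v v = \<mu> *\<^sub>R v) \<longleftrightarrow> poly ?p \<mu> = 0" for \<mu>
  proof -
    have "mat \<mu> = \<mu> *\<^sub>R (mat 1 :: real^'n^'n)" unfolding vec_eq_iff by (simp add: mat_def)
    then have m: "(mat \<mu> - A) *v v = \<mu> *\<^sub>R v - A *v v" for v
      by (simp add: matrix_vector_mult_diff_rdistrib flip: scaleR_matrix_vector_assoc)
    have "poly ?p \<mu> = 0 \<longleftrightarrow> \<not> invertible (mat \<mu> - A)" by (simp add: poly_charpoly invertible_det_nz)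
    also have "\<dots> \<longleftrightarrow> (\<exists>v. v \<noteq> 0 \<and> (mat \<mu> - A) *v v = 0)"
      unfolding invertible_left_inverse matrix_left_invertible_ker by blast
    finally show ?thesis unfolding m by (metis right_minus_eq)
  qed
  have sgn_pow: "sgn (x ^ n) = sgn x ^ n" for x :: real and n
    by (induction n) (simp_all add: sgn_mult)
  have cnt: "negative_eigenvalue_count A = negative_root_count ?p"
    unfolding negative_eigenvalue_count_def negative_root_count_def ev ..
  have p0: "poly ?p 0 = (-1) ^ ?n * det A"
  proof -
    have "mat 0 - A = (-1) *\<^sub>R A" unfolding vec_eq_iff by (simp add: mat_def)
    then show ?thesis by (simp only: poly_charpoly det_scaleR)
  qed
  then have "poly ?p 0 \<noteq> 0" using A by simp
  from sgn_poly_at_minus_infinity[OF this] obtain B where B: "B < 0"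
    "\<And>x. x \<le> B \<Longrightarrow> sgn (poly ?p x) = (-1) ^ negative_root_count ?p * sgn (poly ?p 0)" by blast
  \<comment> \<open>With \<open>s = 1 / x\<close>, \<open>det (mat x - A)\<close> is a power of
    \<open>x\<close> times this determinant, which is near 1 for small \<open>s\<close>.\<close>
  have "((\<lambda>s::real. det (mat 1 - s *\<^sub>R A)) \<longlongrightarrow> det (mat 1 - 0 *\<^sub>R A)) (at 0)"
  proof -
    have "continuous_on UNIV (\<lambda>s::real. det (mat 1 - s *\<^sub>R A))"
      by (intro continuous_on_det) (auto intro!: continuous_intros)
    then show ?thesis unfolding continuous_on_def by blast
  qed
  then have "\<forall>\<^sub>F s in at 0. det (mat 1 - s *\<^sub>R A) > 0"
    by (intro order_tendstoD(1)[where y = "det (mat 1 - 0 *\<^sub>R A)"]) simp_all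
  then obtain d where d: "d > 0" "\<And>s. s \<noteq> 0 \<Longrightarrow> \<bar>s\<bar> < d \<Longrightarrow> det (mat 1 - s *\<^sub>R A) > 0"
    unfolding eventually_at by (auto simp: dist_real_def)
  \<comment> \<open>This gives |1/x| at most d/2.\<close>
  define x where "x = min B (- 2 / d)"
  have x: "x \<le> B" "x < 0" "\<bar>1 / x\<bar> < d"
  proof -
    have "2 / d > 0" using d by simp
    then have "\<bar>x\<bar> \<ge> 2 / d" "x < 0" unfolding x_def using B by auto
    then show "x < 0" "\<bar>1 / x\<bar> < d" using d(1) by (simp_all add: field_simps)
  qed (simp add: x_def)
  have "mat x - A = x *\<^sub>R (mat 1 - (1 / x) *\<^sub>R A)" using x(2) unfolding vec_eq_iff by (simp add: mat_def algebra_simps)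
  then have "poly ?p x = x ^ ?n * det (mat 1 - (1 / x) *\<^sub>R A)" by (simp only: poly_charpoly det_scaleR)
  moreover have "det (mat 1 - (1 / x) *\<^sub>R A) > 0" using x by (intro d(2)) auto
  ultimately have "sgn (poly ?p x) = (-1) ^ ?n" using x(2) by (simp add: sgn_mult sgn_pow)
  then have "(-1) ^ ?n = (-1) ^ negative_root_count ?p * sgn ((-1) ^ ?n * det A)"
    using B(2)[OF x(1)] p0 by simp
  then have "(1::real) = (-1) ^ negative_root_count ?p * sgn (det A)"
    by (simp add: sgn_mult sgn_pow)
  then show ?thesis unfolding cnt
    by (metis (no_types, opaque_lifting) minus_one_power_iff mult_1 mult_minus_left minus_equation_iff)
qed

section \<open>Linear differential equations\<close>

text \<open>The estimate runs from \<open>s\<close> in both directions, because the initial time of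
  the averaging operator may be any point of the interval. Adding the square of \<kappa> to the
  squared norm absorbs the mixed term, so that \<open>q\<close> changes at most at the rate (2L + 1)
  q; the square root of its exponential bound is below the stated one.\<close>

lemma gronwall:
  fixes w :: "real \<Rightarrow> 'a::real_inner"
  assumes w: "\<And>t. t \<in> {a..b} \<Longrightarrow> (w has_vector_derivative w' t) (at t within {a..b})"
    and bound: "\<And>t. t \<in> {a..b} \<Longrightarrow> norm (w' t) \<le> L * norm (w t) + \<kappa>"
    and L: "0 \<le> L" and \<kappa>: "0 \<le> \<kappa>" and s: "s \<in> {a..b}" and t: "t \<in> {a..b}"
  shows "norm (w t) \<le> (norm (w s) + \<kappa>) * exp ((L + 1) * (b - a))"
proof -
  \<comment> \<open>Estimating the square avoids the points where the norm is not differentiable.\<close>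
  define M where "M = 2 * L + 1"
  define q where "q t = (norm (w t))\<^sup>2 + \<kappa>\<^sup>2" for t
  have q_inner: "q = (\<lambda>t. w t \<bullet> w t + \<kappa>\<^sup>2)" unfolding q_def[abs_def] power2_norm_eq_inner ..
  have q0: "0 \<le> q t" for t by (simp add: q_def)
  have dq: "(q has_vector_derivative 2 * (w t \<bullet> w' t)) (at t within {a..b})" if "t \<in> {a..b}" for t
  proof -
    have "(w has_derivative (\<lambda>h. h *\<^sub>R w' t)) (at t within {a..b})"
      using w[OF that] by (simp add: has_vector_derivative_def)
    from has_derivative_inner[OF this this]
    have "((\<lambda>t. w t \<bullet> w t) has_derivative (\<lambda>h. h * (2 * (w t \<bullet> w' t)))) (at t within {a..b})"
      by (simp add: inner_commute algebra_simps)
    then have "((\<lambda>t. w t \<bullet> w t) has_vector_derivative 2 * (w t \<bullet> w' t)) (at t within {a..b})"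
      by (simp add: has_vector_derivative_def)
    from has_vector_derivative_add[OF this has_vector_derivative_const[of "\<kappa>\<^sup>2"]]
    show ?thesis unfolding q_inner by simp
  qed
  have bq: "\<bar>2 * (w t \<bullet> w' t)\<bar> \<le> M * q t" if "t \<in> {a..b}" for t
  proof -
    have "\<bar>w t \<bullet> w' t\<bar> \<le> norm (w t) * norm (w' t)" by (rule Cauchy_Schwarz_ineq2)
    also have "\<dots> \<le> norm (w t) * (L * norm (w t) + \<kappa>)" using bound[OF that] by (intro mult_left_mono) auto
    finally have "\<bar>2 * (w t \<bullet> w' t)\<bar> \<le> 2 * L * (norm (w t))\<^sup>2 + 2 * norm (w t) * \<kappa>"
      by (simp add: power2_eq_square algebra_simps)
    also have "2 * norm (w t) * \<kappa> \<le> (norm (w t))\<^sup>2 + \<kappa>\<^sup>2" by (rule sum_squares_bound)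
    also have "2 * L * (norm (w t))\<^sup>2 + ((norm (w t))\<^sup>2 + \<kappa>\<^sup>2) \<le> M * q t"
      using L by (simp add: M_def q_def algebra_simps)
    finally show ?thesis by simp
  qed
  \<comment> \<open>The two products are monotone in opposite senses: one controls \<open>q\<close>
    forward in time, the other backward.\<close>
  have mono: "q t2 * exp (- M * t2) \<le> q t1 * exp (- M * t1) \<and> q t1 * exp (M * t1) \<le> q t2 * exp (M * t2)"
    if "t1 \<in> {a..b}" "t2 \<in> {a..b}" "t1 \<le> t2" for t1 t2
  proof -
    have d: "((\<lambda>t. q t * exp (c * t)) has_derivative
        (\<lambda>h. h * ((2 * (w t \<bullet> w' t) + c * q t) * exp (c * t)))) (at t within {t1..t2})"
      if t: "t1 \<le> t" "t \<le> t2" for c t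
    proof -
      have "(q has_vector_derivative 2 * (w t \<bullet> w' t)) (at t within {t1..t2})"
        using has_vector_derivative_within_subset[OF dq] t \<open>t1 \<in> _\<close> \<open>t2 \<in> _\<close> by auto
      then have "(q has_real_derivative 2 * (w t \<bullet> w' t)) (at t within {t1..t2})"
        by (simp add: has_real_derivative_iff_has_vector_derivative)
      then have "((\<lambda>t. q t * exp (c * t)) has_real_derivative
          ((2 * (w t \<bullet> w' t) + c * q t) * exp (c * t))) (at t within {t1..t2})"
        by (auto intro!: derivative_eq_intros simp: algebra_simps)
      then show ?thesis
        unfolding has_real_derivative_iff_has_vector_derivative has_vector_derivative_def by simp
    qed
    have mv: "\<exists>t\<in>{t1..t2}. q t2 * exp (c * t2) - q t1 * exp (c * t1) =
        (t2 - t1) * ((2 * (w t \<bullet> w' t) + c * q t) * exp (c * t))" for c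
      by (rule mvt_very_simple[OF that(3) d])
    have inab: "t \<in> {a..b}" if "t \<in> {t1..t2}" for t using that \<open>t1 \<in> _\<close> \<open>t2 \<in> _\<close> by auto
    obtain u where u: "u \<in> {t1..t2}" "q t2 * exp (- M * t2) - q t1 * exp (- M * t1) =
        (t2 - t1) * ((2 * (w u \<bullet> w' u) + - M * q u) * exp (- M * u))" using mv[of "- M"] by blast
    have "2 * (w u \<bullet> w' u) + - M * q u \<le> 0" using bq[OF inab[OF u(1)]] by linarith
    then have "(t2 - t1) * ((2 * (w u \<bullet> w' u) + - M * q u) * exp (- M * u)) \<le> 0"
      using that(3) by (intro mult_nonneg_nonpos[OF _ mult_nonpos_nonneg]) simp_all
    moreover obtain v where v: "v \<in> {t1..t2}" "q t2 * exp (M * t2) - q t1 * exp (M * t1) =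
        (t2 - t1) * ((2 * (w v \<bullet> w' v) + M * q v) * exp (M * v))" using mv[of M] by blast
    have "0 \<le> 2 * (w v \<bullet> w' v) + M * q v" using bq[OF inab[OF v(1)]] by linarith
    then have "0 \<le> (t2 - t1) * ((2 * (w v \<bullet> w' v) + M * q v) * exp (M * v))"
      using that(3) by (intro mult_nonneg_nonneg) simp_all
    ultimately show ?thesis using u v by linarith
  qed
  have M: "0 \<le> M" using L by (simp add: M_def)
  have "(norm (w t))\<^sup>2 \<le> q t" by (simp add: q_def)
  also have "q t \<le> q s * exp (M * \<bar>t - s\<bar>)"
  proof (cases "s \<le> t")
    case True
    then have "q t * exp (- M * t) * exp (M * t) \<le> q s * exp (- M * s) * exp (M * t)"
      using mono[OF s t True] by (intro mult_right_mono) simp_all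
    moreover have "M * \<bar>t - s\<bar> = - M * s + M * t" using True by (simp add: algebra_simps)
    ultimately show ?thesis by (simp add: mult.assoc flip: exp_add)
  next
    case False
    then have "q t * exp (M * t) * exp (- M * t) \<le> q s * exp (M * s) * exp (- M * t)"
      using mono[OF t s] False by (intro mult_right_mono) simp_all
    moreover have "M * \<bar>t - s\<bar> = M * s + - M * t" using False by (simp add: algebra_simps)
    ultimately show ?thesis by (simp add: mult.assoc flip: exp_add)
  qed
  also have "\<dots> \<le> q s * exp (M * (b - a))"
  proof (rule mult_left_mono[OF _ q0])
    have "\<bar>t - s\<bar> \<le> b - a" using s t unfolding atLeastAtMost_iff by linarith
    then have "M * \<bar>t - s\<bar> \<le> M * (b - a)" using M by (rule mult_left_mono)
    then show "exp (M * \<bar>t - s\<bar>) \<le> exp (M * (b - a))" by simp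
  qed
  also have "\<dots> \<le> q s * exp (2 * ((L + 1) * (b - a)))"
  proof (rule mult_left_mono[OF _ q0])
    have "M * (b - a) \<le> (2 * (L + 1)) * (b - a)" using s by (intro mult_right_mono) (simp_all add: M_def)
    then show "exp (M * (b - a)) \<le> exp (2 * ((L + 1) * (b - a)))" by (simp only: mult.assoc exp_le_cancel_iff)
  qed
  also have "\<dots> \<le> (norm (w s) + \<kappa>)\<^sup>2 * exp (2 * ((L + 1) * (b - a)))"
  proof (rule mult_right_mono)
    show "q s \<le> (norm (w s) + \<kappa>)\<^sup>2" using \<kappa> by (simp add: q_def power2_sum)
  qed simp
  also have "\<dots> = ((norm (w s) + \<kappa>) * exp ((L + 1) * (b - a)))\<^sup>2"
    by (simp only: power_mult_distrib exp_double)
  finally have "(norm (w t))\<^sup>2 \<le> ((norm (w s) + \<kappa>) * exp ((L + 1) * (b - a)))\<^sup>2" .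
  then show ?thesis by (rule power2_le_imp_le) (use \<kappa> in simp)
qed

lemma linear_ode_solution_from_left:
  fixes B :: "real \<Rightarrow> 'a::euclidean_space \<Rightarrow>\<^sub>L 'a" and b :: "real \<Rightarrow> 'a"
  assumes T: "0 \<le> T" and B: "continuous_on {0..T} B" and b: "continuous_on {0..T} b"
  shows "\<exists>y. y 0 = h \<and> (\<forall>t\<in>{0..T}. (y has_vector_derivative B t (y t) + b t) (at t within {0..T}))"
proof -
  have "bounded (B ` {0..T})" using B by (intro compact_imp_bounded compact_continuous_image) auto
  then obtain L where L: "L > 0" "\<And>t. t \<in> {0..T} \<Longrightarrow> norm (B t) \<le> L"
    unfolding bounded_pos by auto
  define l where "l = L + 1"
  have l: "l > 0" "L < l" using L by (auto simp: l_def)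
  \<comment> \<open>Clamping the time to [0,T] turns curves on the interval into bounded continuous
    functions on the line, a complete space to which Banach's theorem applies.\<close>
  define cl where "cl t = max 0 (min T t)" for t :: real
  have cl: "cl t \<in> {0..T}" "t \<in> {0..T} \<Longrightarrow> cl t = t" for t using T by (auto simp: cl_def)
  have ccl: "continuous_on UNIV cl" unfolding cl_def by (intro continuous_intros)
  define I where "I z t = B t (exp (l * t) *\<^sub>R z t) + b t" for z :: "real \<Rightarrow> 'a" and t
  \<comment> \<open>The Picard map for \<open>exp (- l * t) *\<^sub>R y t\<close>: the weight makes it a contraction on all of \<open>{0..T}\<close>.\<close>
  define J where "J z t = exp (- l * t) *\<^sub>R (h + integral {0..t} (I z))" for z t
  have cI: "continuous_on {0..T} (I z)" if "continuous_on UNIV z" for z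
    unfolding I_def by (intro continuous_intros B b continuous_on_subset[OF that]) auto
  have cJ: "continuous_on {0..T} (J z)" if "continuous_on UNIV z" for z
    unfolding J_def
    by (intro continuous_intros indefinite_integral_continuous_1 integrable_continuous_interval cI that)
  have bc: "(\<lambda>t. J z (cl t)) \<in> bcontfun" if "continuous_on UNIV z" for z
  proof -
    have "continuous_on UNIV (\<lambda>t. J z (cl t))"
      by (rule continuous_on_compose2[OF cJ[OF that] ccl]) (use cl(1) in blast)
    moreover have "bounded (range (\<lambda>t. J z (cl t)))"
    proof (rule bounded_subset)
      show "bounded (J z ` {0..T})"
        using cJ[OF that] by (intro compact_imp_bounded compact_continuous_image) auto
      show "range (\<lambda>t. J z (cl t)) \<subseteq> J z ` {0..T}" using cl by auto
    qed
    ultimately show ?thesis by (simp add: bcontfun_def)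
  qed
  define G where "G z = Bcontfun (\<lambda>t. J (apply_bcontfun z) (cl t))" for z :: "real \<Rightarrow>\<^sub>C 'a"
  have G: "apply_bcontfun (G z) t = J (apply_bcontfun z) (cl t)" for z t
    unfolding G_def by (subst Bcontfun_inverse) (auto intro: bc)
  have "\<exists>!z. G z = z"
  proof (rule banach_fix_type[of "L / l"])
    show "0 \<le> L / l" "L / l < 1" using L l by auto
    show "\<forall>z z'. dist (G z) (G z') \<le> L / l * dist z z'"
    proof (intro allI dist_bound)
      fix z z' :: "real \<Rightarrow>\<^sub>C 'a" and t
      define r where "r = cl t"
      have r: "r \<in> {0..T}" "0 \<le> r" using cl(1)[of t] by (auto simp: r_def)
      let ?z = "apply_bcontfun z" and ?z' = "apply_bcontfun z'"
      have sub: "{0..r} \<subseteq> {0..T}" using r by auto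
      have int: "I (apply_bcontfun z) integrable_on {0..r}" for z
        by (intro integrable_continuous_interval continuous_on_subset[OF cI sub]) auto
      have E: "((\<lambda>t. exp (l * t)) has_integral (exp (l * r) - exp (l * 0)) / l) {0..r}"
      proof -
        have "((\<lambda>t. exp (l * t)) has_integral exp (l * r) / l - exp (l * 0) / l) {0..r}"
        proof (rule fundamental_theorem_of_calculus[OF r(2)])
          fix t
          have "((\<lambda>t. exp (l * t) / l) has_real_derivative exp (l * t)) (at t within {0..r})"
            using l by (auto intro!: derivative_eq_intros)
          then show "((\<lambda>t. exp (l * t) / l) has_vector_derivative exp (l * t)) (at t within {0..r})"
            by (simp add: has_real_derivative_iff_has_vector_derivative)
        qed
        then show ?thesis by (simp add: diff_divide_distrib)
      qed
      have "norm (integral {0..r} (\<lambda>t. I ?z t - I ?z' t)) \<le> integral {0..r} (\<lambda>t. L * dist z z' * exp (l * t))"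
      proof (rule integral_norm_bound_integral)
        show "(\<lambda>t. I ?z t - I ?z' t) integrable_on {0..r}" by (intro integrable_diff int)
        show "(\<lambda>t. L * dist z z' * exp (l * t)) integrable_on {0..r}"
          using E by (intro integrable_on_mult_right) (auto simp: integrable_on_def)
        fix u assume u: "u \<in> {0..r}"
        have "I ?z u - I ?z' u = B u (exp (l * u) *\<^sub>R (?z u - ?z' u))"
          by (simp add: I_def blinfun.diff_right blinfun.scaleR_right scaleR_right_diff_distrib)
        also have "norm \<dots> \<le> norm (B u) * norm (exp (l * u) *\<^sub>R (?z u - ?z' u))" by (rule norm_blinfun)
        also have "\<dots> \<le> L * (exp (l * u) * dist z z')"
          using L(2)[of u] u sub dist_bounded[of z u z'] L(1) by (intro mult_mono) (auto simp: dist_norm)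
        finally show "norm (I ?z u - I ?z' u) \<le> L * dist z z' * exp (l * u)" by (simp add: mult_ac)
      qed
      also have "\<dots> = L * dist z z' * ((exp (l * r) - 1) / l)"
        using integral_unique[OF E] by simp
      also have "\<dots> \<le> L * dist z z' * (exp (l * r) / l)"
        using L l by (intro mult_left_mono divide_right_mono) auto
      finally have "norm (integral {0..r} (\<lambda>t. I ?z t - I ?z' t)) \<le> L * dist z z' * (exp (l * r) / l)" .
      then have "exp (- l * r) * norm (integral {0..r} (\<lambda>t. I ?z t - I ?z' t)) \<le> exp (- l * r) * (L * dist z z' * (exp (l * r) / l))"
        by (rule mult_left_mono) simp
      also have "\<dots> = L / l * dist z z'" by (simp add: exp_minus field_simps)
      finally have "norm (exp (- l * r) *\<^sub>R integral {0..r} (\<lambda>t. I ?z t - I ?z' t)) \<le> L / l * dist z z'" by simp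
      moreover have "J ?z r - J ?z' r = exp (- l * r) *\<^sub>R integral {0..r} (\<lambda>t. I ?z t - I ?z' t)"
        unfolding J_def by (simp add: integral_diff int scaleR_right_diff_distrib[symmetric])
      ultimately show "dist (G z t) (G z' t) \<le> L / l * dist z z'"
        by (simp add: G dist_norm r_def)
    qed
  qed
  then obtain z where z: "G z = z" by blast
  let ?z = "apply_bcontfun z"
  define y where "y t = h + integral {0..t} (I ?z)" for t
  have zt: "?z t = exp (- l * t) *\<^sub>R y t" if "t \<in> {0..T}" for t
    using G[of z t] z cl(2)[OF that] by (simp add: J_def y_def)
  have Iy: "I ?z t = B t (y t) + b t" if "t \<in> {0..T}" for t
    unfolding I_def zt[OF that] by (simp add: exp_minus)
  have "(y has_vector_derivative B t (y t) + b t) (at t within {0..T})" if "t \<in> {0..T}" for t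
  proof -
    have "((\<lambda>t. integral {0..t} (I ?z)) has_vector_derivative I ?z t) (at t within {0..T})"
      by (rule integral_has_vector_derivative[OF cI that]) simp
    from has_vector_derivative_add[OF has_vector_derivative_const[of h] this]
    show ?thesis using Iy[OF that] unfolding y_def[abs_def] by simp
  qed
  moreover have "y 0 = h" by (simp add: y_def)
  ultimately show ?thesis by blast
qed

lemma linear_ode_unique:
  fixes B :: "real \<Rightarrow> 'a::euclidean_space \<Rightarrow>\<^sub>L 'a"
  assumes B: "continuous_on {0..T} B"
    and y: "\<And>t. t \<in> {0..T} \<Longrightarrow> (y has_vector_derivative B t (y t) + b t) (at t within {0..T})"
    and z: "\<And>t. t \<in> {0..T} \<Longrightarrow> (z has_vector_derivative B t (z t) + b t) (at t within {0..T})"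
    and s: "s \<in> {0..T}" "y s = z s" and t: "t \<in> {0..T}"
  shows "y t = z t"
proof -
  have "bounded (B ` {0..T})" using B by (intro compact_imp_bounded compact_continuous_image) auto
  then obtain L where L: "L > 0" "\<And>t. t \<in> {0..T} \<Longrightarrow> norm (B t) \<le> L"
    unfolding bounded_pos by auto
  have "norm (y t - z t) \<le> (norm (y s - z s) + 0) * exp ((L + 1) * (T - 0))"
  proof (rule gronwall[where w = "\<lambda>t. y t - z t" and w' = "\<lambda>t. B t (y t - z t)"])
    fix t assume t: "t \<in> {0..T}"
    show "((\<lambda>t. y t - z t) has_vector_derivative B t (y t - z t)) (at t within {0..T})"
      using has_vector_derivative_diff[OF y[OF t] z[OF t]] by (simp add: blinfun.diff_right)
    show "norm (B t (y t - z t)) \<le> L * norm (y t - z t) + 0"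
      using order_trans[OF norm_blinfun mult_right_mono[OF L(2)[OF t]]] by simp
  qed (use L s t in auto)
  then show ?thesis using s by simp
qed

text \<open>The value at \<open>s\<close> of a homogeneous solution depends linearly and, by
  uniqueness, injectively on its value at 0, hence surjectively in finite dimension. So a
  homogeneous solution can correct a particular solution at time \<open>s\<close>.\<close>

lemma linear_ode_solution:
  fixes B :: "real \<Rightarrow> 'a::euclidean_space \<Rightarrow>\<^sub>L 'a" and b :: "real \<Rightarrow> 'a"
  assumes T: "0 \<le> T" and B: "continuous_on {0..T} B" and b: "continuous_on {0..T} b" and s: "s \<in> {0..T}"
  shows "\<exists>y. y s = h \<and> (\<forall>t\<in>{0..T}. (y has_vector_derivative B t (y t) + b t) (at t within {0..T}))"
proof -
  have "\<forall>c. \<exists>y. y 0 = c \<and> (\<forall>t\<in>{0..T}. (y has_vector_derivative B t (y t)) (at t within {0..T}))"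
    using linear_ode_solution_from_left[OF T B continuous_on_const[of _ 0]] by simp
  then obtain Y where Y: "\<And>c. Y c 0 = c"
    "\<And>c t. t \<in> {0..T} \<Longrightarrow> (Y c has_vector_derivative B t (Y c t) + 0) (at t within {0..T})"
    by (metis add.right_neutral)
  have "linear (\<lambda>c. Y c s)"
  proof (rule linearI)
    fix c d
    show "Y (c + d) s = Y c s + Y d s"
    proof (rule linear_ode_unique[where z = "\<lambda>t. Y c t + Y d t" and s = 0, OF B Y(2) _ _ _ s])
      show "((\<lambda>t. Y c t + Y d t) has_vector_derivative B t (Y c t + Y d t) + 0) (at t within {0..T})" if "t \<in> {0..T}" for t
        using has_vector_derivative_add[OF Y(2)[OF that] Y(2)[OF that]] by (simp add: blinfun.add_right)
    qed (simp_all add: T Y(1))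
  next
    fix r c
    show "Y (r *\<^sub>R c) s = r *\<^sub>R Y c s"
    proof (rule linear_ode_unique[where z = "\<lambda>t. r *\<^sub>R Y c t" and s = 0, OF B Y(2) _ _ _ s])
      show "((\<lambda>t. r *\<^sub>R Y c t) has_vector_derivative B t (r *\<^sub>R Y c t) + 0) (at t within {0..T})" if "t \<in> {0..T}" for t
        using bounded_linear.has_vector_derivative[OF bounded_linear_scaleR_right Y(2)[OF that]] by (simp add: blinfun.scaleR_right)
    qed (simp_all add: T Y(1))
  qed
  moreover have "inj (\<lambda>c. Y c s)"
  proof (rule injI)
    fix c d assume "Y c s = Y d s"
    from linear_ode_unique[OF B Y(2) Y(2) s this] have "Y c 0 = Y d 0" by (simp add: T)
    then show "c = d" unfolding Y(1) .
  qed
  ultimately have "surj (\<lambda>c. Y c s)" using linear_injective_imp_surjective by blast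
  obtain p where p: "\<And>t. t \<in> {0..T} \<Longrightarrow> (p has_vector_derivative B t (p t) + b t) (at t within {0..T})"
    using linear_ode_solution_from_left[OF T B b] by blast
  obtain c where c: "Y c s = h - p s" using \<open>surj (\<lambda>c. Y c s)\<close> by (metis surjD)
  show ?thesis
  proof (intro exI[of _ "\<lambda>t. Y c t + p t"] conjI ballI)
    show "Y c s + p s = h" using c by simp
    fix t assume t: "t \<in> {0..T}"
    show "((\<lambda>t. Y c t + p t) has_vector_derivative B t (Y c t + p t) + b t) (at t within {0..T})"
      using has_vector_derivative_add[OF Y(2)[OF t] p[OF t]] by (simp add: blinfun.add_right add_ac)
  qed
qed

section \<open>Solutions of the perturbed system\<close>

lemma ivp_value_eq:
  assumes "ivp_solution F T t0 \<xi> x" "\<And>y. ivp_solution F T t0 \<xi> y \<Longrightarrow> y t = x t"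
  shows "ivp_value F T t0 \<xi> t = x t"
  unfolding ivp_value_def by (rule the_equality) (use assms in blast)+

lemma compact_bound:
  fixes h :: "'a::topological_space \<Rightarrow> 'b::real_normed_vector"
  assumes "compact S" "continuous_on S h"
  shows "\<exists>M>0. \<forall>x\<in>S. norm (h x) \<le> M"
proof -
  have "bounded (h ` S)" using assms by (intro compact_imp_bounded compact_continuous_image)
  then show ?thesis unfolding bounded_pos by blast
qed

text \<open>Initial time 0 suffices for the nonlinear systems, since the time-\<open>T\<close> map
  starts there; other initial times \<open>s\<close> enter through the linear equation alone.
  Uniqueness is derived for \<epsilon> = 0 from the derivative \<open>A\<close> (see
  \<open>f_unique\<close>) and assumed for \<epsilon> > 0, where \<open>g\<close> is only
  continuous.\<close>

locale averaging_system =
  fixes f :: "real \<Rightarrow> 'a::euclidean_space \<Rightarrow> 'a" and g :: "real \<Rightarrow> 'a \<Rightarrow> real \<Rightarrow> 'a"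
    and T :: real and A :: "real \<times> 'a \<Rightarrow> 'a \<Rightarrow>\<^sub>L 'a"
  assumes T: "0 < T"
    and f_derivative: "\<And>t x. (f t has_derivative blinfun_apply (A (t, x))) (at x)"
    and A_cont: "continuous_on UNIV A"
    and f_cont: "continuous_on UNIV (\<lambda>(t, x). f t x)"
    and g_cont: "continuous_on (UNIV \<times> UNIV \<times> {0..1}) (\<lambda>(t, x, \<epsilon>). g t x \<epsilon>)"
    and f_extend: "\<And>\<xi>. \<exists>x. ivp_solution f T 0 \<xi> x"
    and perturbed_exists: "\<And>\<xi> \<epsilon>. \<epsilon> \<in> {0<..1} \<Longrightarrow>
          \<exists>x. ivp_solution (\<lambda>t x. f t x + \<epsilon> *\<^sub>R g t x \<epsilon>) T 0 \<xi> x"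
    and perturbed_unique: "\<And>\<xi> \<epsilon> x y t. \<epsilon> \<in> {0<..1} \<Longrightarrow>
          ivp_solution (\<lambda>t x. f t x + \<epsilon> *\<^sub>R g t x \<epsilon>) T 0 \<xi> x \<Longrightarrow>
          ivp_solution (\<lambda>t x. f t x + \<epsilon> *\<^sub>R g t x \<epsilon>) T 0 \<xi> y \<Longrightarrow>
          t \<in> {0..T} \<Longrightarrow> x t = y t"
begin

definition field :: "real \<Rightarrow> real \<Rightarrow> 'a \<Rightarrow> 'a" where
  "field \<epsilon> t x = f t x + \<epsilon> *\<^sub>R g t x \<epsilon>"

lemma field_0: "field 0 = f"
  by (intro ext) (simp add: field_def)

text \<open>The end time \<open>b\<close> is free because a priori bounds are first available only
  up to the time at which a solution might leave a ball (see \<open>local_bound\<close>).\<close>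

definition solves :: "real \<Rightarrow> real \<Rightarrow> (real \<Rightarrow> 'a) \<Rightarrow> bool" where
  "solves \<epsilon> b x \<longleftrightarrow> (\<forall>t\<in>{0..b}. (x has_vector_derivative field \<epsilon> t (x t)) (at t within {0..b}))"

lemma solves_subinterval:
  assumes "solves \<epsilon> b x" "c \<le> b" shows "solves \<epsilon> c x"
  unfolding solves_def
proof
  fix t assume t: "t \<in> {0..c}"
  then have "t \<in> {0..b}" using assms(2) by simp
  then have "(x has_vector_derivative field \<epsilon> t (x t)) (at t within {0..b})"
    using assms(1) unfolding solves_def by blast
  then show "(x has_vector_derivative field \<epsilon> t (x t)) (at t within {0..c})"
    by (rule has_vector_derivative_within_subset) (use assms(2) in simp)
qed

lemma solves_continuous: "solves \<epsilon> b x \<Longrightarrow> continuous_on {0..b} x"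
  unfolding solves_def
  by (rule continuous_on_vector_derivative) blast

section \<open>Uniform bounds and comparison with the unperturbed solutions\<close>

lemma compact_box: "compact ({0..T} \<times> cball (0::'a) R)"
  by (intro compact_Times compact_Icc compact_cball)

lemma A_bound: "\<exists>L>0. \<forall>t\<in>{0..T}. \<forall>x. norm x \<le> R \<longrightarrow> norm (A (t, x)) \<le> L"
proof -
  have "continuous_on ({0..T} \<times> cball 0 R) A" by (rule continuous_on_subset[OF A_cont subset_UNIV])
  from compact_bound[OF compact_box this] obtain L where "L > 0" "\<forall>p\<in>{0..T} \<times> cball 0 R. norm (A p) \<le> L" by blast
  then show ?thesis by (intro exI[of _ L]) simp
qed

lemma g_continuous_on: "continuous_on (S \<times> {0..1}) (\<lambda>(p, \<epsilon>). g (fst p) (snd p) \<epsilon>)"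
proof -
  have "continuous_on (S \<times> {0..1}) (\<lambda>q. (fst (fst q), snd (fst q), snd q))"
    by (intro continuous_intros)
  from continuous_on_compose2[OF g_cont this] show ?thesis
    by (auto simp: case_prod_unfold image_subset_iff)
qed

lemma g_bound: "\<exists>M>0. \<forall>t\<in>{0..T}. \<forall>x. norm x \<le> R \<longrightarrow> (\<forall>\<epsilon>\<in>{0..1}. norm (g t x \<epsilon>) \<le> M)"
proof -
  have "compact (({0..T} \<times> cball (0::'a) R) \<times> {0..1::real})" by (intro compact_Times compact_box compact_Icc)
  from compact_bound[OF this g_continuous_on] obtain M where
    "M > 0" "\<forall>q\<in>({0..T} \<times> cball 0 R) \<times> {0..1}. norm (case q of (p, \<epsilon>) \<Rightarrow> g (fst p) (snd p) \<epsilon>) \<le> M" by blast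
  then show ?thesis by (intro exI[of _ M]) simp
qed

lemma f_lipschitz:
  assumes L: "\<And>z. norm z \<le> R \<Longrightarrow> norm (A (t, z)) \<le> L" and x: "norm x \<le> R" and y: "norm y \<le> R"
  shows "norm (f t x - f t y) \<le> L * norm (x - y)"
proof (rule differentiable_bound[OF convex_cball[of 0 R]])
  show "(f t has_derivative blinfun_apply (A (t, z))) (at z within cball 0 R)" for z
    by (rule has_derivative_at_withinI[OF f_derivative])
  show "onorm (blinfun_apply (A (t, z))) \<le> L" if "z \<in> cball 0 R" for z
    using L[of z] that by (simp add: norm_blinfun.rep_eq)
qed (use x y in simp_all)

text \<open>Gronwall for the difference: on the ball \<open>f\<close> is Lipschitz with constant
  \<open>L\<close>, and the perturbation is at most \<epsilon> M. The constant depends only on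
  \<open>R\<close>, not on the solutions, \<epsilon> or \<open>b\<close>.\<close>

lemma comparison:
  "\<exists>C>0. \<forall>\<epsilon> b x X t. \<epsilon> \<in> {0..1} \<longrightarrow> b \<in> {0..T} \<longrightarrow> solves \<epsilon> b x \<longrightarrow> solves 0 b X \<longrightarrow>
     (\<forall>t\<in>{0..b}. norm (x t) \<le> R \<and> norm (X t) \<le> R) \<longrightarrow> t \<in> {0..b} \<longrightarrow>
     norm (x t - X t) \<le> C * (norm (x 0 - X 0) + \<epsilon>)"
proof -
  obtain L where L: "L > 0" "\<And>t x. t \<in> {0..T} \<Longrightarrow> norm x \<le> R \<Longrightarrow> norm (A (t, x)) \<le> L" using A_bound by blast
  obtain M where M: "M > 0" "\<And>t x \<epsilon>. t \<in> {0..T} \<Longrightarrow> norm x \<le> R \<Longrightarrow> \<epsilon> \<in> {0..1} \<Longrightarrow> norm (g t x \<epsilon>) \<le> M" using g_bound by blast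
  let ?C = "(1 + M) * exp ((L + 1) * T)"
  have "norm (x t - X t) \<le> ?C * (norm (x 0 - X 0) + \<epsilon>)"
    if e: "\<epsilon> \<in> {0..1}" and b: "b \<in> {0..T}" and x: "solves \<epsilon> b x" and X: "solves 0 b X"
      and R: "\<forall>t\<in>{0..b}. norm (x t) \<le> R \<and> norm (X t) \<le> R" and t: "t \<in> {0..b}" for \<epsilon> b x X t
  proof -
    have "norm (x t - X t) \<le> (norm (x 0 - X 0) + \<epsilon> * M) * exp ((L + 1) * (b - 0))"
    proof (rule gronwall[where w = "\<lambda>t. x t - X t" and w' = "\<lambda>t. field \<epsilon> t (x t) - field 0 t (X t)"])
      fix t assume t: "t \<in> {0..b}"
      show "((\<lambda>t. x t - X t) has_vector_derivative field \<epsilon> t (x t) - field 0 t (X t)) (at t within {0..b})"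
        using x X t unfolding solves_def by (intro has_vector_derivative_diff) blast+
      have tT: "t \<in> {0..T}" using t b by simp
      have 1: "norm (f t (x t) - f t (X t)) \<le> L * norm (x t - X t)"
        by (rule f_lipschitz[of R]) (use L(2)[OF tT] R t in auto)
      have 2: "norm (\<epsilon> *\<^sub>R g t (x t) \<epsilon>) \<le> \<epsilon> * M"
        using M(2)[OF tT _ e, of "x t"] R t e by (simp add: mult_left_mono)
      have 3: "field \<epsilon> t (x t) - field 0 t (X t) = (f t (x t) - f t (X t)) + \<epsilon> *\<^sub>R g t (x t) \<epsilon>"
        by (simp add: field_def)
      show "norm (field \<epsilon> t (x t) - field 0 t (X t)) \<le> L * norm (x t - X t) + \<epsilon> * M"
        unfolding 3 by (rule norm_triangle_le[OF add_mono[OF 1 2]])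
    qed (use L M e b t in auto)
    also have "\<dots> \<le> ((1 + M) * (norm (x 0 - X 0) + \<epsilon>)) * exp ((L + 1) * T)"
    proof (rule mult_mono)
      show "norm (x 0 - X 0) + \<epsilon> * M \<le> (1 + M) * (norm (x 0 - X 0) + \<epsilon>)"
      proof -
        have "(1 + M) * (norm (x 0 - X 0) + \<epsilon>) = norm (x 0 - X 0) + \<epsilon> * M + (\<epsilon> + M * norm (x 0 - X 0))"
          by (simp add: algebra_simps)
        moreover have "0 \<le> \<epsilon> + M * norm (x 0 - X 0)" using M(1) e by (intro add_nonneg_nonneg mult_nonneg_nonneg) simp_all
        ultimately show ?thesis by linarith
      qed
      show "exp ((L + 1) * (b - 0)) \<le> exp ((L + 1) * T)" using b L by simp
    qed (use M(1) e in simp_all)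
    finally show ?thesis by (simp only: mult_ac)
  qed
  moreover have "?C > 0" using M(1) by simp
  ultimately show ?thesis by blast
qed

lemma f_unique:
  assumes x: "ivp_solution f T 0 \<xi> x" and y: "ivp_solution f T 0 \<xi> y" and t: "t \<in> {0..T}"
  shows "x t = y t"
proof -
  have s: "solves 0 T x" "solves 0 T y" using x y unfolding ivp_solution_def solves_def field_0 by blast+
  obtain R1 where R1: "\<forall>t\<in>{0..T}. norm (x t) \<le> R1" using compact_bound[OF compact_Icc solves_continuous[OF s(1)]] by blast
  obtain R2 where R2: "\<forall>t\<in>{0..T}. norm (y t) \<le> R2" using compact_bound[OF compact_Icc solves_continuous[OF s(2)]] by blast
  have R: "\<forall>t\<in>{0..T}. norm (x t) \<le> max R1 R2 \<and> norm (y t) \<le> max R1 R2"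
    using R1 R2 by (auto simp: le_max_iff_disj)
  obtain C where C: "C > 0" "\<And>\<epsilon> b x X t. \<epsilon> \<in> {0..1} \<Longrightarrow> b \<in> {0..T} \<Longrightarrow> solves \<epsilon> b x \<Longrightarrow> solves 0 b X \<Longrightarrow>
     (\<forall>t\<in>{0..b}. norm (x t) \<le> max R1 R2 \<and> norm (X t) \<le> max R1 R2) \<Longrightarrow> t \<in> {0..b} \<Longrightarrow>
     norm (x t - X t) \<le> C * (norm (x 0 - X 0) + \<epsilon>)" using comparison[of "max R1 R2"] by blast
  have "norm (x t - y t) \<le> C * (norm (x 0 - y 0) + 0)"
    by (rule C(2)[OF _ _ s R t]) (use T in simp_all)
  moreover have "x 0 = y 0" using x y unfolding ivp_solution_def by (simp only:)
  ultimately show ?thesis by simp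
qed

definition sol :: "real \<Rightarrow> 'a \<Rightarrow> real \<Rightarrow> 'a" where
  "sol \<epsilon> \<xi> t = ivp_value (field \<epsilon>) T 0 \<xi> t"

lemma sol_eq:
  assumes e: "\<epsilon> \<in> {0..1}" and x: "ivp_solution (field \<epsilon>) T 0 \<xi> x" and t: "t \<in> {0..T}"
  shows "sol \<epsilon> \<xi> t = x t"
  unfolding sol_def
proof (rule ivp_value_eq[OF x])
  fix y assume y: "ivp_solution (field \<epsilon>) T 0 \<xi> y"
  show "y t = x t"
  proof (cases "\<epsilon> = 0")
    case True
    then show ?thesis using f_unique[OF _ _ t] x y by (simp add: field_0)
  next
    case False
    then have "\<epsilon> \<in> {0<..1}" using e by simp
    from perturbed_unique[OF this _ _ t] show ?thesis using x y unfolding field_def[abs_def] by blast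
  qed
qed

lemma sol_solution:
  assumes e: "\<epsilon> \<in> {0..1}" shows "ivp_solution (field \<epsilon>) T 0 \<xi> (sol \<epsilon> \<xi>)"
proof -
  have "\<exists>x. ivp_solution (field \<epsilon>) T 0 \<xi> x"
  proof (cases "\<epsilon> = 0")
    case True
    then show ?thesis using f_extend by (simp add: field_0)
  next
    case False
    then have "\<epsilon> \<in> {0<..1}" using e by simp
    from perturbed_exists[OF this] show ?thesis unfolding field_def[abs_def] by blast
  qed
  then obtain x where x: "ivp_solution (field \<epsilon>) T 0 \<xi> x" by blast
  have eq: "sol \<epsilon> \<xi> t = x t" if "t \<in> {0..T}" for t by (rule sol_eq[OF e x that])
  show ?thesis
    unfolding ivp_solution_def
  proof (intro conjI ballI)
    show "sol \<epsilon> \<xi> 0 = \<xi>" using eq[of 0] x T by (simp add: ivp_solution_def)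
    fix t assume t: "t \<in> {0..T}"
    then have "(x has_vector_derivative field \<epsilon> t (x t)) (at t within {0..T})"
      using x unfolding ivp_solution_def by blast
    then show "(sol \<epsilon> \<xi> has_vector_derivative field \<epsilon> t (sol \<epsilon> \<xi> t)) (at t within {0..T})"
      unfolding eq[OF t] using eq by (rule has_vector_derivative_transform[OF t, rotated]) 
  qed
qed

lemma sol_0: "\<epsilon> \<in> {0..1} \<Longrightarrow> sol \<epsilon> \<xi> 0 = \<xi>"
  and solves_sol: "\<epsilon> \<in> {0..1} \<Longrightarrow> solves \<epsilon> T (sol \<epsilon> \<xi>)"
  using sol_solution unfolding ivp_solution_def solves_def by blast+

text \<open>A continuation argument. As long as the distance to the unperturbed solution through
  \<open>\<xi>0\<close> is at most 1, both curves stay in the ball of radius \<open>R0 + 1\<close>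
  and \<open>comparison\<close> shows the distance to be strictly below 1; so 1 is never
  reached.\<close>

lemma local_bound:
  "\<exists>\<delta>>0. \<exists>R. \<forall>\<epsilon> \<xi> t. 0 \<le> \<epsilon> \<longrightarrow> \<epsilon> \<le> \<delta> \<longrightarrow> dist \<xi> \<xi>0 < \<delta> \<longrightarrow> t \<in> {0..T} \<longrightarrow> norm (sol \<epsilon> \<xi> t) \<le> R"
proof -
  let ?X = "sol 0 \<xi>0"
  have X: "solves 0 T ?X" by (rule solves_sol) simp
  obtain R0 where R0: "\<And>t. t \<in> {0..T} \<Longrightarrow> norm (?X t) \<le> R0"
    using compact_bound[OF compact_Icc solves_continuous[OF X]] by blast
  obtain C where C: "C > 0" "\<And>\<epsilon> b x X t. \<epsilon> \<in> {0..1} \<Longrightarrow> b \<in> {0..T} \<Longrightarrow> solves \<epsilon> b x \<Longrightarrow> solves 0 b X \<Longrightarrow>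
     (\<forall>t\<in>{0..b}. norm (x t) \<le> R0 + 1 \<and> norm (X t) \<le> R0 + 1) \<Longrightarrow> t \<in> {0..b} \<Longrightarrow>
     norm (x t - X t) \<le> C * (norm (x 0 - X 0) + \<epsilon>)" using comparison[of "R0 + 1"] by blast
  \<comment> \<open>The initial distance and \<epsilon> are each at most \<delta>, so
    \<open>comparison\<close> yields at most 2/3. The bound 1/2 keeps the initial distance below 1
    and \<epsilon> in [0,1].\<close>
  define \<delta> where "\<delta> = min (1 / 2) (1 / (3 * C))"
  have d: "\<delta> > 0" "\<delta> \<le> 1 / 2" "C * (2 * \<delta>) < 1"
  proof -
    show "\<delta> > 0" "\<delta> \<le> 1 / 2" using C by (auto simp: \<delta>_def)
    have "C * (2 * \<delta>) \<le> C * (2 * (1 / (3 * C)))" using C(1) by (intro mult_left_mono) (auto simp: \<delta>_def)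
    then show "C * (2 * \<delta>) < 1" using C(1) by simp
  qed
  have "norm (sol \<epsilon> \<xi> t) \<le> R0 + 1"
    if e: "0 \<le> \<epsilon>" "\<epsilon> \<le> \<delta>" and xi: "dist \<xi> \<xi>0 < \<delta>" and t: "t \<in> {0..T}" for \<epsilon> \<xi> t
  proof -
    have e1: "\<epsilon> \<in> {0..1}" using e d by simp
    let ?d = "\<lambda>t. norm (sol \<epsilon> \<xi> t - ?X t)"
    have x: "solves \<epsilon> T (sol \<epsilon> \<xi>)" by (rule solves_sol[OF e1])
    have cd: "continuous_on {0..T} ?d"
      by (rule continuous_on_norm[OF continuous_on_diff[OF solves_continuous[OF x] solves_continuous[OF X]]])
    have start: "norm (sol \<epsilon> \<xi> 0 - ?X 0) < \<delta>" using xi e1 by (simp add: sol_0 dist_norm)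
    have "?d t \<le> 1"
    proof (rule ccontr)
      assume "\<not> ?d t \<le> 1"
      then have "1 \<le> ?d t" by simp
      have ivt: "\<exists>u. 0 \<le> u \<and> u \<le> v \<and> ?d u = 1" if "v \<in> {0..T}" "1 \<le> ?d v" for v
      proof (rule IVT'[where f = ?d and a = 0 and b = v and y = 1])
        show "1 \<le> ?d v" by (fact that(2))
        show "?d 0 \<le> 1" using start d by linarith
        show "0 \<le> v" using that(1) by simp
        show "continuous_on {0..v} ?d" by (rule continuous_on_subset[OF cd]) (use that(1) in auto)
      qed
      let ?S = "{0..T} \<inter> ?d -` {1}"
      have "closed ?S" by (rule continuous_closed_preimage[OF cd]) auto
      then have "compact ({0..T} \<inter> ?S)" by (rule compact_Int_closed[OF compact_Icc])
      moreover have "{0..T} \<inter> ?S \<noteq> {}"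
      proof -
        obtain u where "0 \<le> u" "u \<le> t" "?d u = 1" using ivt[OF t \<open>1 \<le> ?d t\<close>] by blast
        then have "u \<in> {0..T} \<inter> ?S" using t by simp
        then show ?thesis by blast
      qed
      \<comment> \<open>The first time at which the distance equals 1.\<close>
      ultimately obtain b where b: "b \<in> {0..T} \<inter> ?S" "\<And>u. u \<in> {0..T} \<inter> ?S \<Longrightarrow> b \<le> u"
        using compact_attains_inf[of "{0..T} \<inter> ?S"] by blast
      have bT: "b \<in> {0..T}" "?d b = 1" using b(1) by auto
      have le1: "?d u \<le> 1" if u: "u \<in> {0..b}" for u
      proof (rule ccontr)
        assume n: "\<not> ?d u \<le> 1"
        then have "1 \<le> ?d u" by simp
        moreover have "u \<in> {0..T}" using u bT by simp
        ultimately obtain v where v: "0 \<le> v" "v \<le> u" "?d v = 1" using ivt by blast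
        then have "v \<in> {0..T} \<inter> ?S" using \<open>u \<in> {0..T}\<close> by simp
        from b(2)[OF this] have "u = b" using v u by simp
        then show False using n bT by simp
      qed
      have "\<forall>u\<in>{0..b}. norm (sol \<epsilon> \<xi> u) \<le> R0 + 1 \<and> norm (?X u) \<le> R0 + 1"
      proof
        fix u assume u: "u \<in> {0..b}"
        then have "norm (?X u) \<le> R0" using R0 bT by simp
        moreover have "norm (sol \<epsilon> \<xi> u) \<le> norm (?X u) + ?d u" by (rule norm_triangle_sub)
        ultimately show "norm (sol \<epsilon> \<xi> u) \<le> R0 + 1 \<and> norm (?X u) \<le> R0 + 1" using le1[OF u] by linarith
      qed
      from C(2)[OF e1 bT(1) solves_subinterval[OF x] solves_subinterval[OF X] this, of b]
      have "?d b \<le> C * (norm (sol \<epsilon> \<xi> 0 - ?X 0) + \<epsilon>)" using bT by simp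
      also have "\<dots> \<le> C * (2 * \<delta>)" using C(1) start e by (intro mult_left_mono) linarith+
      finally show False using d(3) bT by linarith
    qed
    moreover have "norm (sol \<epsilon> \<xi> t) \<le> norm (?X t) + ?d t" by (rule norm_triangle_sub)
    ultimately show ?thesis using R0[OF t] by linarith
  qed
  then show ?thesis using d(1) by blast
qed

lemma compact_solution_bound:
  assumes K: "compact K"
  shows "\<exists>\<delta>\<in>{0<..1}. \<exists>R. \<forall>\<xi>\<in>K. \<forall>\<epsilon>\<in>{0..\<delta>}. \<forall>t\<in>{0..T}. norm (sol \<epsilon> \<xi> t) \<le> R"
proof -
  define Q where "Q \<xi>0 \<delta> R \<longleftrightarrow> \<delta> > 0 \<and> (\<forall>\<epsilon> \<xi> t. 0 \<le> \<epsilon> \<longrightarrow> \<epsilon> \<le> \<delta> \<longrightarrow> dist \<xi> \<xi>0 < \<delta> \<longrightarrow> t \<in> {0..T} \<longrightarrow> norm (sol \<epsilon> \<xi> t) \<le> R)"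
    for \<xi>0 \<delta> R
  have "\<forall>\<xi>0. \<exists>\<delta> R. Q \<xi>0 \<delta> R" using local_bound unfolding Q_def by blast
  then obtain \<delta> R where Q: "\<And>\<xi>0. Q \<xi>0 (\<delta> \<xi>0) (R \<xi>0)" by metis
  have pos: "\<delta> \<xi>0 > 0" for \<xi>0 using Q unfolding Q_def by blast
  obtain D where D: "D \<subseteq> K" "finite D" "K \<subseteq> (\<Union>\<xi>0\<in>D. ball \<xi>0 (\<delta> \<xi>0))"
  proof (rule compactE_image[OF K, of K "\<lambda>\<xi>0. ball \<xi>0 (\<delta> \<xi>0)"])
    show "K \<subseteq> (\<Union>\<xi>0\<in>K. ball \<xi>0 (\<delta> \<xi>0))" using pos by force
  qed auto
  define d where "d = Min (insert 1 (\<delta> ` D))"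
  define R' where "R' = Max (insert 0 (R ` D))"
  have d: "d > 0" "d \<le> 1" "\<And>\<xi>0. \<xi>0 \<in> D \<Longrightarrow> d \<le> \<delta> \<xi>0" unfolding d_def using D(2) pos by auto
  have R': "\<And>\<xi>0. \<xi>0 \<in> D \<Longrightarrow> R \<xi>0 \<le> R'" unfolding R'_def using D(2) by auto
  have "norm (sol \<epsilon> \<xi> t) \<le> R'" if "\<xi> \<in> K" "\<epsilon> \<in> {0..d}" "t \<in> {0..T}" for \<xi> \<epsilon> t
  proof -
    obtain \<xi>0 where x: "\<xi>0 \<in> D" "\<xi> \<in> ball \<xi>0 (\<delta> \<xi>0)" using D(3) \<open>\<xi> \<in> K\<close> by blast
    have "norm (sol \<epsilon> \<xi> t) \<le> R \<xi>0"
      using Q[of \<xi>0] x d(3)[OF x(1)] that unfolding Q_def by (simp add: dist_commute)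
    then show ?thesis using R'[OF x(1)] by linarith
  qed
  then show ?thesis using d by (intro bexI[of _ d] exI[of _ R']) auto
qed

lemma compact_comparison:
  assumes K: "compact K"
  shows "\<exists>\<delta>\<in>{0<..1}. \<exists>R C. C > 0 \<and> (\<forall>\<xi>\<in>K. \<forall>\<epsilon>\<in>{0..\<delta>}. \<forall>t\<in>{0..T}. norm (sol \<epsilon> \<xi> t) \<le> R) \<and>
    (\<forall>\<xi>\<in>K. \<forall>\<zeta>\<in>K. \<forall>\<epsilon>\<in>{0..\<delta>}. \<forall>t\<in>{0..T}. norm (sol \<epsilon> \<xi> t - sol 0 \<zeta> t) \<le> C * (norm (\<xi> - \<zeta>) + \<epsilon>))"
proof -
  obtain \<delta> R where d: "\<delta> \<in> {0<..1}" and R: "\<And>\<xi> \<epsilon> t. \<xi> \<in> K \<Longrightarrow> \<epsilon> \<in> {0..\<delta>} \<Longrightarrow> t \<in> {0..T} \<Longrightarrow> norm (sol \<epsilon> \<xi> t) \<le> R"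
    using compact_solution_bound[OF K] by blast
  obtain C where C: "C > 0" "\<And>\<epsilon> b x X t. \<epsilon> \<in> {0..1} \<Longrightarrow> b \<in> {0..T} \<Longrightarrow> solves \<epsilon> b x \<Longrightarrow> solves 0 b X \<Longrightarrow>
     (\<forall>t\<in>{0..b}. norm (x t) \<le> R \<and> norm (X t) \<le> R) \<Longrightarrow> t \<in> {0..b} \<Longrightarrow>
     norm (x t - X t) \<le> C * (norm (x 0 - X 0) + \<epsilon>)" using comparison[of R] by blast
  have "norm (sol \<epsilon> \<xi> t - sol 0 \<zeta> t) \<le> C * (norm (\<xi> - \<zeta>) + \<epsilon>)"
    if "\<xi> \<in> K" "\<zeta> \<in> K" "\<epsilon> \<in> {0..\<delta>}" "t \<in> {0..T}" for \<xi> \<zeta> \<epsilon> t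
  proof -
    have e: "\<epsilon> \<in> {0..1}" "0 \<in> {0..1::real}" "0 \<in> {0..\<delta>}" using that d by auto
    have "norm (sol \<epsilon> \<xi> t - sol 0 \<zeta> t) \<le> C * (norm (sol \<epsilon> \<xi> 0 - sol 0 \<zeta> 0) + \<epsilon>)"
      by (rule C(2)[OF e(1) _ solves_sol[OF e(1)] solves_sol[OF e(2)] _ that(4)])
        (use T R[OF that(1) that(3)] R[OF that(2) e(3)] in auto)
    then show ?thesis by (simp only: sol_0[OF e(1)] sol_0[OF e(2)])
  qed
  then show ?thesis using d R C(1) by blast
qed

text \<open>For \<epsilon> = 0 this is the variational equation, which gives the derivative of the
  unperturbed time-\<open>T\<close> map; for \<epsilon> = 1 it is the equation behind the averaging
  operator.\<close>

definition linearized :: "real \<Rightarrow> (real \<Rightarrow> 'a) \<Rightarrow> (real \<Rightarrow> 'a) \<Rightarrow> bool" where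
  "linearized \<epsilon> X y \<longleftrightarrow>
     (\<forall>t\<in>{0..T}. (y has_vector_derivative A (t, X t) (y t) + \<epsilon> *\<^sub>R g t (X t) 0) (at t within {0..T}))"

section \<open>First-order expansion along unperturbed solutions\<close>

lemma A_uniform:
  assumes k: "\<kappa> > 0"
  shows "\<exists>\<delta>>0. \<forall>t\<in>{0..T}. \<forall>x z. norm x \<le> R \<longrightarrow> norm z \<le> R \<longrightarrow> norm (x - z) < \<delta> \<longrightarrow> norm (A (t, x) - A (t, z)) \<le> \<kappa>"
proof -
  have "uniformly_continuous_on ({0..T} \<times> cball 0 R) A"
    by (rule compact_uniformly_continuous[OF continuous_on_subset[OF A_cont subset_UNIV] compact_box])
  then obtain d where d: "d > 0" "\<And>p q. p \<in> {0..T} \<times> cball 0 R \<Longrightarrow> q \<in> {0..T} \<times> cball 0 R \<Longrightarrow> dist q p < d \<Longrightarrow> dist (A q) (A p) < \<kappa>"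
    using k unfolding uniformly_continuous_on_def by meson
  show ?thesis
  proof (intro exI[of _ d] conjI ballI allI impI)
    fix t and x z :: 'a assume "t \<in> {0..T}" "norm x \<le> R" "norm z \<le> R" "norm (x - z) < d"
    then have "dist (A (t, x)) (A (t, z)) < \<kappa>"
      by (intro d(2)) (simp_all add: dist_Pair_Pair dist_norm)
    then show "norm (A (t, x) - A (t, z)) \<le> \<kappa>" by (simp add: dist_norm)
  qed (rule d(1))
qed

lemma g_uniform:
  assumes k: "\<kappa> > 0"
  shows "\<exists>\<delta>>0. \<forall>t\<in>{0..T}. \<forall>x z. \<forall>\<epsilon>\<in>{0..1}. norm x \<le> R \<longrightarrow> norm z \<le> R \<longrightarrow> norm (x - z) + \<epsilon> < \<delta> \<longrightarrow>
     norm (g t x \<epsilon> - g t z 0) \<le> \<kappa>"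
proof -
  let ?S = "({0..T} \<times> cball (0::'a) R) \<times> {0..1::real}"
  have "compact ?S" by (intro compact_Times compact_box compact_Icc)
  from compact_uniformly_continuous[OF g_continuous_on this]
  obtain d where d: "d > 0" "\<And>p q. p \<in> ?S \<Longrightarrow> q \<in> ?S \<Longrightarrow> dist q p < d \<Longrightarrow>
     dist (case q of (p, \<epsilon>) \<Rightarrow> g (fst p) (snd p) \<epsilon>) (case p of (p, \<epsilon>) \<Rightarrow> g (fst p) (snd p) \<epsilon>) < \<kappa>"
    using k unfolding uniformly_continuous_on_def by meson
  show ?thesis
  proof (intro exI[of _ d] conjI ballI allI impI)
    fix t \<epsilon> :: real and x z :: 'a
    assume a: "t \<in> {0..T}" "\<epsilon> \<in> {0..1}" "norm x \<le> R" "norm z \<le> R" "norm (x - z) + \<epsilon> < d"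
    have "dist ((t, x), \<epsilon>) ((t, z), 0) = sqrt ((norm (x - z))\<^sup>2 + \<epsilon>\<^sup>2)"
      unfolding dist_Pair_Pair by (simp add: dist_norm)
    also have "\<dots> \<le> norm (x - z) + \<epsilon>" using a by (intro sqrt_sum_squares_le_sum) simp_all
    finally have "dist ((t, x), \<epsilon>) ((t, z), 0) < d" using a(5) by linarith
    from d(2)[OF _ _ this] a show "norm (g t x \<epsilon> - g t z 0) \<le> \<kappa>" by (simp add: dist_norm)
  qed (rule d(1))
qed

text \<open>The mean value inequality on the segment from \<open>X t\<close> to \<open>x t\<close>
  bounds the remainder of \<open>f\<close> by \<kappa> \<rho>, uniform continuity bounds that of the
  perturbation by \<kappa> \<epsilon>, and Gronwall finishes. Keeping \<rho> apart from \<epsilon>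
  serves two purposes: \<epsilon> = 0 gives differentiability in the initial value, equal initial
  values give the expansion in \<epsilon>. The factor \<open>E\<close> is independent of
  \<kappa>.\<close>

lemma linearization:
  "\<exists>E>0. \<forall>\<kappa>>0. \<exists>\<delta>>0. \<forall>\<epsilon> \<rho> x X y t. \<epsilon> \<in> {0..1} \<longrightarrow> \<epsilon> \<le> \<delta> \<longrightarrow> \<rho> \<le> \<delta> \<longrightarrow> solves \<epsilon> T x \<longrightarrow> solves 0 T X \<longrightarrow>
     (\<forall>t\<in>{0..T}. norm (x t) \<le> R \<and> norm (X t) \<le> R \<and> norm (x t - X t) \<le> \<rho>) \<longrightarrow> linearized \<epsilon> X y \<longrightarrow> t \<in> {0..T} \<longrightarrow>
     norm (x t - X t - y t) \<le> (norm (x 0 - X 0 - y 0) + \<kappa> * (\<rho> + \<epsilon>)) * E"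
proof -
  obtain L where L: "L > 0" "\<And>t x. t \<in> {0..T} \<Longrightarrow> norm x \<le> R \<Longrightarrow> norm (A (t, x)) \<le> L" using A_bound by blast
  let ?E = "exp ((L + 1) * (T - 0))"
  have "\<exists>\<delta>>0. \<forall>\<epsilon> \<rho> x X y t. \<epsilon> \<in> {0..1} \<longrightarrow> \<epsilon> \<le> \<delta> \<longrightarrow> \<rho> \<le> \<delta> \<longrightarrow> solves \<epsilon> T x \<longrightarrow> solves 0 T X \<longrightarrow>
     (\<forall>t\<in>{0..T}. norm (x t) \<le> R \<and> norm (X t) \<le> R \<and> norm (x t - X t) \<le> \<rho>) \<longrightarrow> linearized \<epsilon> X y \<longrightarrow> t \<in> {0..T} \<longrightarrow>
     norm (x t - X t - y t) \<le> (norm (x 0 - X 0 - y 0) + \<kappa> * (\<rho> + \<epsilon>)) * ?E" if k: "\<kappa> > 0" for \<kappa>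
  proof -
    obtain d1 where d1: "d1 > 0" "\<And>t x z. t \<in> {0..T} \<Longrightarrow> norm x \<le> R \<Longrightarrow> norm z \<le> R \<Longrightarrow> norm (x - z) < d1 \<Longrightarrow> norm (A (t, x) - A (t, z)) \<le> \<kappa>"
      using A_uniform[OF k] by blast
    obtain d2 where d2: "d2 > 0" "\<And>t x z \<epsilon>. t \<in> {0..T} \<Longrightarrow> \<epsilon> \<in> {0..1} \<Longrightarrow> norm x \<le> R \<Longrightarrow> norm z \<le> R \<Longrightarrow> norm (x - z) + \<epsilon> < d2 \<Longrightarrow>
      norm (g t x \<epsilon> - g t z 0) \<le> \<kappa>" using g_uniform[OF k] by blast
    \<comment> \<open>A third, because the estimate for \<open>g\<close> involves \<rho> +
      \<epsilon>, which is at most 2 \<delta>.\<close>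
    define \<delta> where "\<delta> = min d1 d2 / 3"
    have d: "\<delta> > 0" "\<delta> < d1" "2 * \<delta> < d2" using d1(1) d2(1) by (auto simp: \<delta>_def)
    have "norm (x t - X t - y t) \<le> (norm (x 0 - X 0 - y 0) + \<kappa> * (\<rho> + \<epsilon>)) * ?E"
      if e: "\<epsilon> \<in> {0..1}" "\<epsilon> \<le> \<delta>" and rho: "\<rho> \<le> \<delta>" and x: "solves \<epsilon> T x" and X: "solves 0 T X"
        and R: "\<forall>t\<in>{0..T}. norm (x t) \<le> R \<and> norm (X t) \<le> R \<and> norm (x t - X t) \<le> \<rho>" and y: "linearized \<epsilon> X y"
        and t: "t \<in> {0..T}" for \<epsilon> \<rho> x X y t
    proof (rule gronwall[where w = "\<lambda>t. x t - X t - y t"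
          and w' = "\<lambda>t. field \<epsilon> t (x t) - field 0 t (X t) - (A (t, X t) (y t) + \<epsilon> *\<^sub>R g t (X t) 0)"])
      have "0 \<le> \<rho>" using R t norm_ge_zero order_trans by blast
      then show "0 \<le> \<kappa> * (\<rho> + \<epsilon>)" using k e by simp
      fix t assume t: "t \<in> {0..T}"
      show "((\<lambda>t. x t - X t - y t) has_vector_derivative
          field \<epsilon> t (x t) - field 0 t (X t) - (A (t, X t) (y t) + \<epsilon> *\<^sub>R g t (X t) 0)) (at t within {0..T})"
        using x X y t unfolding solves_def linearized_def by (intro has_vector_derivative_diff) blast+
      have Rt: "norm (x t) \<le> R" "norm (X t) \<le> R" "norm (x t - X t) \<le> \<rho>" using R t by blast+
      let ?S = "closed_segment (X t) (x t)"
      have "norm (f t (x t) - f t (X t) - A (t, X t) (x t - X t)) \<le> norm (x t - X t) * \<kappa>"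
      proof (rule differentiable_bound_linearization[where S = ?S and f' = "\<lambda>z. blinfun_apply (A (t, z))"])
        show "X t + s *\<^sub>R (x t - X t) \<in> ?S" if "s \<in> {0..1}" for s
          unfolding closed_segment_def using that by (intro CollectI exI[of _ s]) (simp add: algebra_simps)
        show "(f t has_derivative blinfun_apply (A (t, z))) (at z within ?S)" for z
          by (rule has_derivative_at_withinI[OF f_derivative])
        show "onorm (blinfun_apply (A (t, z)) - blinfun_apply (A (t, X t))) \<le> \<kappa>" if z: "z \<in> ?S" for z
        proof -
          have "?S \<subseteq> cball 0 R" using Rt by (intro closed_segment_subset convex_cball) simp_all
          then have "norm z \<le> R" using z by auto
          moreover have "norm (z - X t) \<le> norm (x t - X t)" using segment_bound(1)[OF z] .
          ultimately have "norm (A (t, z) - A (t, X t)) \<le> \<kappa>" using d1(2)[OF t] Rt rho d by simp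
          moreover have "blinfun_apply (A (t, z)) - blinfun_apply (A (t, X t)) = blinfun_apply (A (t, z) - A (t, X t))"
            by (simp add: fun_eq_iff blinfun.diff_left)
          ultimately show ?thesis by (simp add: norm_blinfun.rep_eq)
        qed
      qed simp
      also have "\<dots> \<le> \<rho> * \<kappa>" using Rt k by (intro mult_right_mono) simp_all
      finally have 1: "norm (f t (x t) - f t (X t) - A (t, X t) (x t - X t)) \<le> \<kappa> * \<rho>" by (simp only: mult.commute)
      have "norm (A (t, X t) (x t - X t - y t)) \<le> norm (A (t, X t)) * norm (x t - X t - y t)" by (rule norm_blinfun)
      also have "\<dots> \<le> L * norm (x t - X t - y t)" using L(2)[OF t Rt(2)] by (rule mult_right_mono) simp
      finally have 2: "norm (A (t, X t) (x t - X t - y t)) \<le> L * norm (x t - X t - y t)" .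
      have "norm (g t (x t) \<epsilon> - g t (X t) 0) \<le> \<kappa>"
        by (rule d2(2)[OF t e(1) Rt(1,2)]) (use Rt(3) rho e d in linarith)
      then have 3: "norm (\<epsilon> *\<^sub>R (g t (x t) \<epsilon> - g t (X t) 0)) \<le> \<epsilon> * \<kappa>" using e by (simp add: mult_left_mono)
      have eq: "field \<epsilon> t (x t) - field 0 t (X t) - (A (t, X t) (y t) + \<epsilon> *\<^sub>R g t (X t) 0) =
        (f t (x t) - f t (X t) - A (t, X t) (x t - X t)) + A (t, X t) (x t - X t - y t) + \<epsilon> *\<^sub>R (g t (x t) \<epsilon> - g t (X t) 0)"
        by (simp add: field_def blinfun.diff_right scaleR_right_diff_distrib)
      have "norm (field \<epsilon> t (x t) - field 0 t (X t) - (A (t, X t) (y t) + \<epsilon> *\<^sub>R g t (X t) 0)) \<le>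
         \<kappa> * \<rho> + L * norm (x t - X t - y t) + \<epsilon> * \<kappa>"
        unfolding eq by (intro norm_triangle_le add_mono 1 2 3)
      then show "norm (field \<epsilon> t (x t) - field 0 t (X t) - (A (t, X t) (y t) + \<epsilon> *\<^sub>R g t (X t) 0)) \<le>
         L * norm (x t - X t - y t) + \<kappa> * (\<rho> + \<epsilon>)" by (simp add: algebra_simps)
    qed (use L T t in auto)
    then show ?thesis using d(1) by blast
  qed
  then show ?thesis by (intro exI[of _ ?E]) simp
qed

lemma coefficients_continuous:
  assumes "solves 0 T X"
  shows "continuous_on {0..T} (\<lambda>t. A (t, X t))" "continuous_on {0..T} (\<lambda>t. g t (X t) 0)"
proof -
  have c: "continuous_on {0..T} X" by (rule solves_continuous[OF assms])
  show "continuous_on {0..T} (\<lambda>t. A (t, X t))"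
    by (rule continuous_on_compose2[OF A_cont]) (auto intro!: continuous_intros c)
  have "continuous_on {0..T} (\<lambda>t. (t, X t, 0::real))" by (intro continuous_intros c)
  then have "continuous_on {0..T} (\<lambda>t. case (t, X t, 0) of (t, x, \<epsilon>) \<Rightarrow> g t x \<epsilon>)"
    by (rule continuous_on_compose2[OF g_cont]) auto
  then show "continuous_on {0..T} (\<lambda>t. g t (X t) 0)" by simp
qed

lemma linearized_exists:
  assumes X: "solves 0 T X" and s: "s \<in> {0..T}"
  shows "\<exists>y. y s = h \<and> linearized \<epsilon> X y"
  unfolding linearized_def
  by (rule linear_ode_solution[OF _ coefficients_continuous(1)[OF X] _ s])
    (use T in \<open>auto intro!: continuous_intros coefficients_continuous(2)[OF X]\<close>)

lemma linearized_unique: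
  assumes X: "solves 0 T X" and y: "linearized \<epsilon> X y" "linearized \<epsilon> X z"
    and s: "s \<in> {0..T}" "y s = z s" and t: "t \<in> {0..T}"
  shows "y t = z t"
  by (rule linear_ode_unique[where y = y and z = z and b = "\<lambda>t. \<epsilon> *\<^sub>R g t (X t) 0",
        OF coefficients_continuous(1)[OF X] _ _ s t])
    (use y in \<open>unfold linearized_def, blast+\<close>)

lemma linearized_combination:
  assumes "linearized \<epsilon> X y" "linearized \<delta> X z"
  shows "linearized (\<epsilon> + r * \<delta>) X (\<lambda>t. y t + r *\<^sub>R z t)"
  unfolding linearized_def
proof
  fix t assume t: "t \<in> {0..T}"
  have "((\<lambda>t. y t + r *\<^sub>R z t) has_vector_derivative
    (A (t, X t) (y t) + \<epsilon> *\<^sub>R g t (X t) 0) + r *\<^sub>R (A (t, X t) (z t) + \<delta> *\<^sub>R g t (X t) 0)) (at t within {0..T})"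
    using assms t unfolding linearized_def
    by (intro has_vector_derivative_add bounded_linear.has_vector_derivative[OF bounded_linear_scaleR_right]) blast+
  then show "((\<lambda>t. y t + r *\<^sub>R z t) has_vector_derivative
    A (t, X t) (y t + r *\<^sub>R z t) + (\<epsilon> + r * \<delta>) *\<^sub>R g t (X t) 0) (at t within {0..T})"
    by (simp add: blinfun.add_right blinfun.scaleR_right algebra_simps)
qed

text \<open>The derivative sends \<open>h\<close> to the value at \<open>T\<close> of the solution
  of the variational equation that starts at \<open>h\<close>. In \<open>linearization\<close> the
  deviation \<rho> is \<open>C * norm (\<xi> - a)\<close>.\<close>

lemma poincare_differentiable: "(\<lambda>\<xi>. sol 0 \<xi> T) differentiable at a"
proof -
  let ?X = "sol 0 a"
  have X: "solves 0 T ?X" by (rule solves_sol) simp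
  have T0: "0 \<in> {0..T}" "T \<in> {0..T}" using T by auto
  have "\<forall>h. \<exists>y. y 0 = h \<and> linearized 0 ?X y" using linearized_exists[OF X T0(1)] by blast
  then obtain Y where Y: "\<And>h. Y h 0 = h" "\<And>h. linearized 0 ?X (Y h)" by metis
  have comb: "Y (h + r *\<^sub>R k) T = Y h T + r *\<^sub>R Y k T" for h k r
    by (rule linearized_unique[OF X Y(2) _ T0(1) _ T0(2), where z = "\<lambda>t. Y h t + r *\<^sub>R Y k t"])
      (use linearized_combination[OF Y(2)[of h] Y(2)[of k], of r] Y(1) in simp_all)
  have z: "Y 0 T = 0" using comb[where h = 0 and k = 0 and r = 1] by simp
  have lin: "linear (\<lambda>h. Y h T)"
    by (rule linearI) (use comb[where r = 1] comb[where h = 0] z in simp_all)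
  obtain \<delta> R C where d: "\<delta> \<in> {0<..1}" and C: "C > 0"
    and R: "\<And>\<xi> \<epsilon> t. \<xi> \<in> cball a 1 \<Longrightarrow> \<epsilon> \<in> {0..\<delta>} \<Longrightarrow> t \<in> {0..T} \<Longrightarrow> norm (sol \<epsilon> \<xi> t) \<le> R"
    and cmp: "\<And>\<xi> \<zeta> \<epsilon> t. \<xi> \<in> cball a 1 \<Longrightarrow> \<zeta> \<in> cball a 1 \<Longrightarrow> \<epsilon> \<in> {0..\<delta>} \<Longrightarrow> t \<in> {0..T} \<Longrightarrow>
       norm (sol \<epsilon> \<xi> t - sol 0 \<zeta> t) \<le> C * (norm (\<xi> - \<zeta>) + \<epsilon>)"
    using compact_comparison[OF compact_cball[of a 1]] by blast
  obtain E where E: "E > 0" and lz: "\<And>\<kappa>. \<kappa> > 0 \<Longrightarrow> \<exists>\<delta>>0. \<forall>\<epsilon> \<rho> x X y t. \<epsilon> \<in> {0..1} \<longrightarrow> \<epsilon> \<le> \<delta> \<longrightarrow> \<rho> \<le> \<delta> \<longrightarrow> solves \<epsilon> T x \<longrightarrow> solves 0 T X \<longrightarrow>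
     (\<forall>t\<in>{0..T}. norm (x t) \<le> R \<and> norm (X t) \<le> R \<and> norm (x t - X t) \<le> \<rho>) \<longrightarrow> linearized \<epsilon> X y \<longrightarrow> t \<in> {0..T} \<longrightarrow>
     norm (x t - X t - y t) \<le> (norm (x 0 - X 0 - y 0) + \<kappa> * (\<rho> + \<epsilon>)) * E"
    using linearization[of R] by blast
  have "((\<lambda>\<xi>. sol 0 \<xi> T) has_derivative (\<lambda>h. Y h T)) (at a)"
    unfolding has_derivative_at_alt
  proof (intro conjI allI impI)
    show "bounded_linear (\<lambda>h. Y h T)" using lin linear_conv_bounded_linear by blast
    fix e :: real assume e: "e > 0"
    \<comment> \<open>Chosen so that \<kappa> times C |\<xi> - a| times E equals e |\<xi> -
      a|.\<close>
    define \<kappa> where "\<kappa> = e / (C * E)"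
    have k: "\<kappa> > 0" using e C E by (simp add: \<kappa>_def)
    obtain d' where d': "d' > 0" "\<And>\<epsilon> \<rho> x X y t. \<epsilon> \<in> {0..1} \<Longrightarrow> \<epsilon> \<le> d' \<Longrightarrow> \<rho> \<le> d' \<Longrightarrow> solves \<epsilon> T x \<Longrightarrow> solves 0 T X \<Longrightarrow>
     (\<forall>t\<in>{0..T}. norm (x t) \<le> R \<and> norm (X t) \<le> R \<and> norm (x t - X t) \<le> \<rho>) \<Longrightarrow> linearized \<epsilon> X y \<Longrightarrow> t \<in> {0..T} \<Longrightarrow>
     norm (x t - X t - y t) \<le> (norm (x 0 - X 0 - y 0) + \<kappa> * (\<rho> + \<epsilon>)) * E" using lz[OF k] by blast
    show "\<exists>d>0. \<forall>\<xi>. norm (\<xi> - a) < d \<longrightarrow> norm (sol 0 \<xi> T - sol 0 a T - Y (\<xi> - a) T) \<le> e * norm (\<xi> - a)"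
    proof (intro exI[of _ "min 1 (d' / C)"] conjI allI impI)
      show "0 < min 1 (d' / C)" using d' C by simp
      fix \<xi> assume xi: "norm (\<xi> - a) < min 1 (d' / C)"
      have K: "\<xi> \<in> cball a 1" "a \<in> cball a 1" using xi by (auto simp: dist_norm norm_minus_commute)
      have e0: "0 \<in> {0..\<delta>}" "0 \<in> {0..1::real}" using d by auto
      have x: "solves 0 T (sol 0 \<xi>)" by (rule solves_sol) simp
      have "norm (sol 0 \<xi> T - sol 0 a T - Y (\<xi> - a) T) \<le>
        (norm (sol 0 \<xi> 0 - sol 0 a 0 - Y (\<xi> - a) 0) + \<kappa> * (C * norm (\<xi> - a) + 0)) * E"
      proof (rule d'(2)[OF e0(2) _ _ x X _ Y(2) T0(2)])
        show "0 \<le> d'" using d' by simp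
        show "C * norm (\<xi> - a) \<le> d'" using xi C by (simp add: field_simps)
        show "\<forall>t\<in>{0..T}. norm (sol 0 \<xi> t) \<le> R \<and> norm (sol 0 a t) \<le> R \<and> norm (sol 0 \<xi> t - sol 0 a t) \<le> C * norm (\<xi> - a)"
          using R[OF K(1) e0(1)] R[OF K(2) e0(1)] cmp[OF K e0(1)] by simp
      qed
      also have "\<dots> = e * norm (\<xi> - a)"
        using C E by (simp add: sol_0[OF e0(2)] Y(1) \<kappa>_def)
      finally show "norm (sol 0 \<xi> T - sol 0 a T - Y (\<xi> - a) T) \<le> e * norm (\<xi> - a)" .
    qed
  qed
  then show ?thesis by (rule differentiableI)
qed

lemma linearized_field_eq: "linearized_field f g T \<xi> t y = A (t, sol 0 \<xi> t) y + g t (sol 0 \<xi> t) 0"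
proof -
  have "frechet_derivative (f t) (at z) = blinfun_apply (A (t, z))" for z
    using frechet_derivative_at[OF f_derivative[of t z]] by simp
  then show ?thesis by (simp add: linearized_field_def sol_def field_0)
qed

lemma averaging_operator_eq:
  assumes s: "s \<in> {0..T}" and y: "linearized 1 (sol 0 \<xi>) y" "y s = 0"
  shows "averaging_operator f g T s \<xi> = y T - y 0"
proof -
  have X: "solves 0 T (sol 0 \<xi>)" by (rule solves_sol) simp
  have iff: "ivp_solution (linearized_field f g T \<xi>) T s 0 z \<longleftrightarrow> z s = 0 \<and> linearized 1 (sol 0 \<xi>) z" for z
    by (simp add: ivp_solution_def linearized_def linearized_field_eq)
  have "ivp_value (linearized_field f g T \<xi>) T s 0 t = y t" if t: "t \<in> {0..T}" for t
  proof (rule ivp_value_eq)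
    show "ivp_solution (linearized_field f g T \<xi>) T s 0 y" using y iff by blast
    fix z assume "ivp_solution (linearized_field f g T \<xi>) T s 0 z"
    then have z: "z s = 0" "linearized 1 (sol 0 \<xi>) z" using iff by blast+
    show "z t = y t" by (rule linearized_unique[OF X z(2) y(1) s _ t]) (simp only: z y)
  qed
  then show ?thesis unfolding averaging_operator_def using T by simp
qed

text \<open>\<open>linearization\<close> with equal initial values and \<rho> = C \<epsilon>. Its
  linear part is \<epsilon> times the solution that vanishes at time 0, whose value at
  \<open>T\<close> is the averaging operator with \<open>s = 0\<close>.\<close>

lemma poincare_expansion:
  assumes K: "compact K" and k: "\<kappa> > 0"
  shows "\<exists>\<delta>\<in>{0<..1}. \<forall>\<epsilon>\<in>{0..\<delta>}. \<forall>\<xi>\<in>K. norm (sol \<epsilon> \<xi> T - sol 0 \<xi> T - \<epsilon> *\<^sub>R averaging_operator f g T 0 \<xi>) \<le> \<kappa> * \<epsilon>"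
proof -
  have T0: "0 \<in> {0..T}" "T \<in> {0..T}" using T by auto
  obtain \<delta> R C where d: "\<delta> \<in> {0<..1}" and C: "C > 0"
    and R: "\<And>\<xi> \<epsilon> t. \<xi> \<in> K \<Longrightarrow> \<epsilon> \<in> {0..\<delta>} \<Longrightarrow> t \<in> {0..T} \<Longrightarrow> norm (sol \<epsilon> \<xi> t) \<le> R"
    and cmp: "\<And>\<xi> \<zeta> \<epsilon> t. \<xi> \<in> K \<Longrightarrow> \<zeta> \<in> K \<Longrightarrow> \<epsilon> \<in> {0..\<delta>} \<Longrightarrow> t \<in> {0..T} \<Longrightarrow>
       norm (sol \<epsilon> \<xi> t - sol 0 \<zeta> t) \<le> C * (norm (\<xi> - \<zeta>) + \<epsilon>)"
    using compact_comparison[OF K] by blast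
  obtain E where E: "E > 0" and lz: "\<And>\<kappa>. \<kappa> > 0 \<Longrightarrow> \<exists>\<delta>>0. \<forall>\<epsilon> \<rho> x X y t. \<epsilon> \<in> {0..1} \<longrightarrow> \<epsilon> \<le> \<delta> \<longrightarrow> \<rho> \<le> \<delta> \<longrightarrow> solves \<epsilon> T x \<longrightarrow> solves 0 T X \<longrightarrow>
     (\<forall>t\<in>{0..T}. norm (x t) \<le> R \<and> norm (X t) \<le> R \<and> norm (x t - X t) \<le> \<rho>) \<longrightarrow> linearized \<epsilon> X y \<longrightarrow> t \<in> {0..T} \<longrightarrow>
     norm (x t - X t - y t) \<le> (norm (x 0 - X 0 - y 0) + \<kappa> * (\<rho> + \<epsilon>)) * E"
    using linearization[of R] by blast
  \<comment> \<open>The resulting error is k' (C \<epsilon> + \<epsilon>) E, which is \<kappa>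
    \<epsilon> for this value.\<close>
  define k' where "k' = \<kappa> / ((C + 1) * E)"
  have k': "k' > 0" "k' * ((C + 1) * E) = \<kappa>" using k C E by (simp_all add: k'_def add_pos_pos)
  obtain d' where d': "d' > 0" "\<And>\<epsilon> \<rho> x X y t. \<epsilon> \<in> {0..1} \<Longrightarrow> \<epsilon> \<le> d' \<Longrightarrow> \<rho> \<le> d' \<Longrightarrow> solves \<epsilon> T x \<Longrightarrow> solves 0 T X \<Longrightarrow>
     (\<forall>t\<in>{0..T}. norm (x t) \<le> R \<and> norm (X t) \<le> R \<and> norm (x t - X t) \<le> \<rho>) \<Longrightarrow> linearized \<epsilon> X y \<Longrightarrow> t \<in> {0..T} \<Longrightarrow>
     norm (x t - X t - y t) \<le> (norm (x 0 - X 0 - y 0) + k' * (\<rho> + \<epsilon>)) * E" using lz[OF k'(1)] by blast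
  define r where "r = min \<delta> (min d' (d' / C))"
  have r: "r > 0" "r \<le> \<delta>" "r \<le> d'" "C * r \<le> d'"
  proof -
    have "C * r \<le> C * (d' / C)" using C by (intro mult_left_mono) (auto simp: r_def)
    then show "C * r \<le> d'" using C by simp
  qed (use d d' C in \<open>auto simp: r_def\<close>)
  have "norm (sol \<epsilon> \<xi> T - sol 0 \<xi> T - \<epsilon> *\<^sub>R averaging_operator f g T 0 \<xi>) \<le> \<kappa> * \<epsilon>"
    if e: "\<epsilon> \<in> {0..r}" and xi: "\<xi> \<in> K" for \<epsilon> \<xi>
  proof -
    have es: "\<epsilon> \<in> {0..\<delta>}" "\<epsilon> \<in> {0..1}" "0 \<in> {0..\<delta>}" "0 \<in> {0..1::real}" using e r d by auto
    have X: "solves 0 T (sol 0 \<xi>)" by (rule solves_sol) simp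
    obtain y where y: "y 0 = 0" "linearized 1 (sol 0 \<xi>) y" using linearized_exists[OF X T0(1)] by blast
    \<comment> \<open>A homogeneous solution starting at 0, brought in so that \<epsilon> y becomes
      an instance of \<open>linearized_combination\<close>; it vanishes at \<open>T\<close> because
      uniqueness equates it there with its double.\<close>
    obtain z where z: "z 0 = 0" "linearized 0 (sol 0 \<xi>) z" using linearized_exists[OF X T0(1)] by blast
    have av: "averaging_operator f g T 0 \<xi> = y T" using averaging_operator_eq[OF T0(1) y(2,1)] y(1) by simp
    have "linearized (0 + \<epsilon> * 1) (sol 0 \<xi>) (\<lambda>t. z t + \<epsilon> *\<^sub>R y t)" by (rule linearized_combination[OF z(2) y(2)])
    then have ly: "linearized \<epsilon> (sol 0 \<xi>) (\<lambda>t. z t + \<epsilon> *\<^sub>R y t)" by simp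
    have "linearized (0 + 1 * 0) (sol 0 \<xi>) (\<lambda>t. z t + 1 *\<^sub>R z t)" by (rule linearized_combination[OF z(2) z(2)])
    then have "linearized 0 (sol 0 \<xi>) (\<lambda>t. z t + z t)" by simp
    then have "z T = z T + z T" by (rule linearized_unique[OF X z(2) _ T0(1) _ T0(2)]) (simp add: z(1))
    then have zT: "z T = 0" by simp
    have "norm (sol \<epsilon> \<xi> T - sol 0 \<xi> T - (z T + \<epsilon> *\<^sub>R y T)) \<le>
      (norm (sol \<epsilon> \<xi> 0 - sol 0 \<xi> 0 - (z 0 + \<epsilon> *\<^sub>R y 0)) + k' * (C * \<epsilon> + \<epsilon>)) * E"
    proof (rule d'(2)[OF es(2) _ _ solves_sol[OF es(2)] X _ ly T0(2)])
      show "\<epsilon> \<le> d'" using e r by simp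
      have "C * \<epsilon> \<le> C * r" using C e by simp
      then show "C * \<epsilon> \<le> d'" using r by linarith
      show "\<forall>t\<in>{0..T}. norm (sol \<epsilon> \<xi> t) \<le> R \<and> norm (sol 0 \<xi> t) \<le> R \<and> norm (sol \<epsilon> \<xi> t - sol 0 \<xi> t) \<le> C * \<epsilon>"
        using R[OF xi es(1)] R[OF xi es(3)] cmp[OF xi xi es(1)] by simp
    qed
    also have "\<dots> = (k' * ((C + 1) * E)) * \<epsilon>"
      by (simp add: sol_0[OF es(2)] sol_0[OF es(4)] y(1) z(1) algebra_simps)
    finally show ?thesis using k'(2) zT av by simp
  qed
  then show ?thesis using r d by (intro bexI[of _ r]) auto
qed

text \<open>The solutions for two parameters are compared by Gronwall started at \<open>s\<close>:
  there \<open>y\<close> vanishes, and \<open>y0\<close> is small because it is continuous and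
  vanishes at \<open>s0\<close>. The coefficients are close because the unperturbed solutions
  are.\<close>

lemma averaging_operator_continuous:
  assumes K: "compact K"
  shows "continuous_on ({0..T} \<times> K) (\<lambda>(s, \<xi>). averaging_operator f g T s \<xi>)"
proof -
  have T0: "0 \<in> {0..T}" "T \<in> {0..T}" using T by auto
  obtain \<delta> R C where d: "\<delta> \<in> {0<..1}" and C: "C > 0"
    and R: "\<And>\<xi> \<epsilon> t. \<xi> \<in> K \<Longrightarrow> \<epsilon> \<in> {0..\<delta>} \<Longrightarrow> t \<in> {0..T} \<Longrightarrow> norm (sol \<epsilon> \<xi> t) \<le> R"
    and cmp: "\<And>\<xi> \<zeta> \<epsilon> t. \<xi> \<in> K \<Longrightarrow> \<zeta> \<in> K \<Longrightarrow> \<epsilon> \<in> {0..\<delta>} \<Longrightarrow> t \<in> {0..T} \<Longrightarrow>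
       norm (sol \<epsilon> \<xi> t - sol 0 \<zeta> t) \<le> C * (norm (\<xi> - \<zeta>) + \<epsilon>)"
    using compact_comparison[OF K] by blast
  have e0: "0 \<in> {0..\<delta>}" using d by simp
  obtain L where L: "L > 0" "\<And>t x. t \<in> {0..T} \<Longrightarrow> norm x \<le> R \<Longrightarrow> norm (A (t, x)) \<le> L" using A_bound by blast
  let ?E = "exp ((L + 1) * (T - 0))"
  have X: "solves 0 T (sol 0 \<xi>)" for \<xi> by (rule solves_sol) simp
  show ?thesis
    unfolding continuous_on_iff
  proof (intro ballI allI impI)
    fix p0 :: "real \<times> 'a" and e :: real assume p0: "p0 \<in> {0..T} \<times> K" and e: "e > 0"
    obtain s0 \<xi>0 where p0eq: "p0 = (s0, \<xi>0)" by (cases p0)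
    have s0: "s0 \<in> {0..T}" and xi0: "\<xi>0 \<in> K" using p0 p0eq by auto
    obtain y0 where y0: "y0 s0 = 0" "linearized 1 (sol 0 \<xi>0) y0" using linearized_exists[OF X s0] by blast
    have c0: "continuous_on {0..T} y0"
      by (rule continuous_on_vector_derivative) (use y0(2) in \<open>unfold linearized_def, blast\<close>)
    obtain N where N: "N > 0" "\<And>t. t \<in> {0..T} \<Longrightarrow> norm (y0 t) \<le> N" using compact_bound[OF compact_Icc c0] by blast
    \<comment> \<open>Makes the Gronwall bound for the difference \<open>e / 3\<close>; the
      averaging operator involves the two times 0 and \<open>T\<close>, so 2/3 of \<open>e\<close>
      is used.\<close>
    define \<kappa> where "\<kappa> = e / (3 * (N + 2) * ?E)"
    have k: "\<kappa> > 0" "3 * ((\<kappa> + \<kappa> * (N + 1)) * ?E) = e"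
    proof -
      show "\<kappa> > 0" using e N by (simp add: \<kappa>_def)
      have "3 * ((\<kappa> + \<kappa> * (N + 1)) * ?E) = \<kappa> * (3 * (N + 2) * ?E)" by (simp add: algebra_simps)
      also have "\<dots> = e" using N by (simp add: \<kappa>_def)
      finally show "3 * ((\<kappa> + \<kappa> * (N + 1)) * ?E) = e" .
    qed
    obtain d1 where d1: "d1 > 0" "\<And>t x z. t \<in> {0..T} \<Longrightarrow> norm x \<le> R \<Longrightarrow> norm z \<le> R \<Longrightarrow> norm (x - z) < d1 \<Longrightarrow> norm (A (t, x) - A (t, z)) \<le> \<kappa>"
      using A_uniform[OF k(1)] by blast
    obtain d2 where d2: "d2 > 0" "\<And>t x z \<epsilon>. t \<in> {0..T} \<Longrightarrow> \<epsilon> \<in> {0..1} \<Longrightarrow> norm x \<le> R \<Longrightarrow> norm z \<le> R \<Longrightarrow> norm (x - z) + \<epsilon> < d2 \<Longrightarrow>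
      norm (g t x \<epsilon> - g t z 0) \<le> \<kappa>" using g_uniform[OF k(1)] by blast
    obtain d3 where d3: "d3 > 0" "\<And>s. s \<in> {0..T} \<Longrightarrow> dist s s0 < d3 \<Longrightarrow> dist (y0 s) (y0 s0) < \<kappa>"
      using c0 s0 k(1) unfolding continuous_on_iff by meson
    define dd where "dd = min d3 (min d1 d2 / C)"
    have dd: "dd > 0" "dd \<le> d3" "C * dd \<le> d1" "C * dd \<le> d2"
    proof -
      have "C * dd \<le> C * (min d1 d2 / C)" using C by (intro mult_left_mono) (auto simp: dd_def)
      then show "C * dd \<le> d1" "C * dd \<le> d2" using C by auto
    qed (use d1 d2 d3 C in \<open>auto simp: dd_def\<close>)
    show "\<exists>d>0. \<forall>p\<in>{0..T} \<times> K. dist p p0 < d \<longrightarrow>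
      dist (case p of (s, \<xi>) \<Rightarrow> averaging_operator f g T s \<xi>) (case p0 of (s, \<xi>) \<Rightarrow> averaging_operator f g T s \<xi>) < e"
    proof (intro exI[of _ dd] conjI ballI impI)
      fix p assume p: "p \<in> {0..T} \<times> K" "dist p p0 < dd"
      obtain s \<xi> where peq: "p = (s, \<xi>)" by (cases p)
      have s: "s \<in> {0..T}" and xi: "\<xi> \<in> K" using p peq by auto
      have ds: "dist s s0 < dd" and dxi: "dist \<xi> \<xi>0 < dd"
        using p(2) dist_fst_le[of p p0] dist_snd_le[of p p0] by (auto simp: peq p0eq)
      obtain y where y: "y s = 0" "linearized 1 (sol 0 \<xi>) y" using linearized_exists[OF X s] by blast
      have ys: "norm (y s - y0 s) \<le> \<kappa>" using d3(2)[OF s] ds dd(2) y(1) y0(1) by (simp add: dist_norm)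
      have est: "norm (y t - y0 t) \<le> (\<kappa> + \<kappa> * (N + 1)) * ?E" if t: "t \<in> {0..T}" for t
      proof -
        have "norm (y t - y0 t) \<le> (norm (y s - y0 s) + \<kappa> * (N + 1)) * ?E"
        proof (rule gronwall[where w = "\<lambda>t. y t - y0 t" and w' = "\<lambda>t. (A (t, sol 0 \<xi> t) (y t) + 1 *\<^sub>R g t (sol 0 \<xi> t) 0) -
              (A (t, sol 0 \<xi>0 t) (y0 t) + 1 *\<^sub>R g t (sol 0 \<xi>0 t) 0)"])
          fix t assume t: "t \<in> {0..T}"
          show "((\<lambda>t. y t - y0 t) has_vector_derivative (A (t, sol 0 \<xi> t) (y t) + 1 *\<^sub>R g t (sol 0 \<xi> t) 0) -
              (A (t, sol 0 \<xi>0 t) (y0 t) + 1 *\<^sub>R g t (sol 0 \<xi>0 t) 0)) (at t within {0..T})"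
            using y(2) y0(2) t unfolding linearized_def by (intro has_vector_derivative_diff) blast+
          note Rx = R[OF xi e0 t] and R0 = R[OF xi0 e0 t]
          have "norm (sol 0 \<xi> t - sol 0 \<xi>0 t) \<le> C * norm (\<xi> - \<xi>0)" using cmp[OF xi xi0 e0 t] by simp
          also have "\<dots> < C * dd" using C dxi by (simp add: dist_norm)
          finally have dx: "norm (sol 0 \<xi> t - sol 0 \<xi>0 t) < C * dd" .
          have "norm (A (t, sol 0 \<xi> t) (y t - y0 t)) \<le> norm (A (t, sol 0 \<xi> t)) * norm (y t - y0 t)" by (rule norm_blinfun)
          also have "\<dots> \<le> L * norm (y t - y0 t)" using L(2)[OF t Rx] by (rule mult_right_mono) simp
          finally have 1: "norm (A (t, sol 0 \<xi> t) (y t - y0 t)) \<le> L * norm (y t - y0 t)" .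
          have "norm ((A (t, sol 0 \<xi> t) - A (t, sol 0 \<xi>0 t)) (y0 t)) \<le> norm (A (t, sol 0 \<xi> t) - A (t, sol 0 \<xi>0 t)) * norm (y0 t)"
            by (rule norm_blinfun)
          also have "\<dots> \<le> \<kappa> * N"
          proof (rule mult_mono)
            show "norm (A (t, sol 0 \<xi> t) - A (t, sol 0 \<xi>0 t)) \<le> \<kappa>"
              by (rule d1(2)[OF t Rx R0]) (use dx dd in linarith)
          qed (use N(2)[OF t] k in simp_all)
          finally have 2: "norm ((A (t, sol 0 \<xi> t) - A (t, sol 0 \<xi>0 t)) (y0 t)) \<le> \<kappa> * N" .
          have 3: "norm (g t (sol 0 \<xi> t) 0 - g t (sol 0 \<xi>0 t) 0) \<le> \<kappa>"
            by (rule d2(2)[OF t _ Rx R0]) (use dx dd in simp_all)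
          have eq: "(A (t, sol 0 \<xi> t) (y t) + 1 *\<^sub>R g t (sol 0 \<xi> t) 0) - (A (t, sol 0 \<xi>0 t) (y0 t) + 1 *\<^sub>R g t (sol 0 \<xi>0 t) 0) =
            A (t, sol 0 \<xi> t) (y t - y0 t) + (A (t, sol 0 \<xi> t) - A (t, sol 0 \<xi>0 t)) (y0 t) + (g t (sol 0 \<xi> t) 0 - g t (sol 0 \<xi>0 t) 0)"
            by (simp add: blinfun.diff_right blinfun.diff_left)
          have "norm ((A (t, sol 0 \<xi> t) (y t) + 1 *\<^sub>R g t (sol 0 \<xi> t) 0) - (A (t, sol 0 \<xi>0 t) (y0 t) + 1 *\<^sub>R g t (sol 0 \<xi>0 t) 0))
            \<le> L * norm (y t - y0 t) + \<kappa> * N + \<kappa>"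
            unfolding eq by (intro norm_triangle_le add_mono 1 2 3)
          then show "norm ((A (t, sol 0 \<xi> t) (y t) + 1 *\<^sub>R g t (sol 0 \<xi> t) 0) - (A (t, sol 0 \<xi>0 t) (y0 t) + 1 *\<^sub>R g t (sol 0 \<xi>0 t) 0))
            \<le> L * norm (y t - y0 t) + \<kappa> * (N + 1)" by (simp add: algebra_simps)
        qed (use L k N s t in auto)
        also have "\<dots> \<le> (\<kappa> + \<kappa> * (N + 1)) * ?E" using ys by (intro mult_right_mono) simp_all
        finally show ?thesis .
      qed
      have "dist (y T - y 0) (y0 T - y0 0) \<le> norm (y T - y0 T) + norm (y 0 - y0 0)"
        unfolding dist_norm using norm_triangle_ineq4[of "y T - y0 T" "y 0 - y0 0"] by (simp add: algebra_simps)
      also have "\<dots> \<le> 2 * ((\<kappa> + \<kappa> * (N + 1)) * ?E)" using est[OF T0(1)] est[OF T0(2)] by linarith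
      also have "\<dots> < e" using k(2) e by linarith
      finally have "dist (y T - y 0) (y0 T - y0 0) < e" .
      then show "dist (case p of (s, \<xi>) \<Rightarrow> averaging_operator f g T s \<xi>) (case p0 of (s, \<xi>) \<Rightarrow> averaging_operator f g T s \<xi>) < e"
        unfolding peq p0eq using averaging_operator_eq[OF s y(2,1)] averaging_operator_eq[OF s0 y0(2,1)] by simp
    qed (rule dd)
  qed
qed

section \<open>Continuity of the perturbed time-\<open>T\<close> map\<close>

lemma field_continuous_on:
  assumes e: "\<epsilon> \<in> {0..1}"
  shows "continuous_on S (\<lambda>(t, x). field \<epsilon> t x)"
proof -
  have "continuous_on S (\<lambda>p. (fst p, snd p, \<epsilon>))" by (intro continuous_intros)
  then have "continuous_on S (\<lambda>p. case (fst p, snd p, \<epsilon>) of (t, x, \<epsilon>) \<Rightarrow> g t x \<epsilon>)"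
    by (rule continuous_on_compose2[OF g_cont]) (use e in auto)
  then have g: "continuous_on S (\<lambda>p. g (fst p) (snd p) \<epsilon>)" by simp
  have "continuous_on S (\<lambda>p. f (fst p) (snd p))"
    using continuous_on_subset[OF f_cont subset_UNIV] by (simp add: case_prod_unfold)
  then show ?thesis
    unfolding field_def case_prod_unfold
    by (rule continuous_on_add) (rule continuous_on_scaleR[OF continuous_on_const g])
qed

lemma sol_lipschitz_in_time:
  assumes e: "\<epsilon> \<in> {0..1}" and R: "\<And>t. t \<in> {0..T} \<Longrightarrow> norm (sol \<epsilon> \<xi> t) \<le> R"
    and M: "\<And>t x. t \<in> {0..T} \<Longrightarrow> norm x \<le> R \<Longrightarrow> norm (field \<epsilon> t x) \<le> M"
    and t: "t \<in> {0..T}" and u: "u \<in> {0..T}"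
  shows "norm (sol \<epsilon> \<xi> t - sol \<epsilon> \<xi> u) \<le> M * norm (t - u)"
proof (rule differentiable_bound[OF convex_real_interval(5)[of 0 T]])
  show "(sol \<epsilon> \<xi> has_derivative (\<lambda>h. h *\<^sub>R field \<epsilon> t (sol \<epsilon> \<xi> t))) (at t within {0..T})" if "t \<in> {0..T}" for t
    using solves_sol[OF e] that unfolding solves_def has_vector_derivative_def by blast
  show "onorm (\<lambda>h. h *\<^sub>R field \<epsilon> t (sol \<epsilon> \<xi> t)) \<le> M" if "t \<in> {0..T}" for t
  proof (rule onorm_le)
    fix h :: real
    have "\<bar>h\<bar> * norm (field \<epsilon> t (sol \<epsilon> \<xi> t)) \<le> \<bar>h\<bar> * M"
      by (rule mult_left_mono[OF M[OF that R[OF that]]]) simp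
    then show "norm (h *\<^sub>R field \<epsilon> t (sol \<epsilon> \<xi> t)) \<le> M * norm h" by (simp add: mult.commute)
  qed
qed (use t u in simp_all)

text \<open>With \<open>g\<close> only continuous there is no Gronwall estimate between two
  perturbed solutions; compactness replaces it. By Arzela-Ascoli a subsequence of solutions
  converges uniformly, hence so do the derivatives, and by uniqueness the limit is the solution
  through \<xi>.\<close>

lemma sol_limit:
  assumes e: "\<epsilon> \<in> {0..1}" and R: "\<And>n t. t \<in> {0..T} \<Longrightarrow> norm (sol \<epsilon> (z n) t) \<le> R"
    and lim: "z \<longlonglongrightarrow> \<xi>" and q: "(\<lambda>n. sol \<epsilon> (z n) T) \<longlonglongrightarrow> q"
  shows "q = sol \<epsilon> \<xi> T"
proof -
  have T0: "0 \<in> {0..T}" "T \<in> {0..T}" using T by auto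
  let ?S = "{0..T} \<times> cball (0::'a) R"
  obtain M where M: "M > 0" "\<And>t x. t \<in> {0..T} \<Longrightarrow> norm x \<le> R \<Longrightarrow> norm (field \<epsilon> t x) \<le> M"
    using compact_bound[OF compact_box[of R] field_continuous_on[OF e]] by force
  have "uniformly_continuous_on ?S (\<lambda>(t, x). field \<epsilon> t x)"
    by (rule compact_uniformly_continuous[OF field_continuous_on[OF e] compact_box])
  then have uc: "\<exists>d>0. \<forall>p\<in>?S. \<forall>p'\<in>?S. dist p' p < d \<longrightarrow>
      dist (case p' of (t, x) \<Rightarrow> field \<epsilon> t x) (case p of (t, x) \<Rightarrow> field \<epsilon> t x) < r" if "r > 0" for r
    using that unfolding uniformly_continuous_on_def by blast
  obtain u k where k: "strict_mono (k :: nat \<Rightarrow> nat)"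
    and unif: "\<And>r. 0 < r \<Longrightarrow> \<exists>N. \<forall>n t. n \<ge> N \<and> t \<in> {0..T} \<longrightarrow> norm (sol \<epsilon> (z (k n)) t - u t) < r"
  proof (rule Arzela_Ascoli[of "{0..T}" "\<lambda>n. sol \<epsilon> (z n)" R])
    show "\<exists>d>0. \<forall>n s. s \<in> {0..T} \<and> norm (t - s) < d \<longrightarrow> norm (sol \<epsilon> (z n) t - sol \<epsilon> (z n) s) < r"
      if t: "t \<in> {0..T}" and r: "0 < r" for t r
    proof (intro exI[of _ "r / M"] conjI allI impI)
      show "0 < r / M" using r M by simp
      fix n s assume s: "s \<in> {0..T} \<and> norm (t - s) < r / M"
      then have "norm (sol \<epsilon> (z n) t - sol \<epsilon> (z n) s) \<le> M * norm (t - s)"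
        by (intro sol_lipschitz_in_time[OF e R M(2) t]) blast+
      also have "\<dots> < r" using s M(1) by (simp add: field_simps)
      finally show "norm (sol \<epsilon> (z n) t - sol \<epsilon> (z n) s) < r" .
    qed
  qed (use R in auto)
  have ptw: "(\<lambda>n. sol \<epsilon> (z (k n)) t) \<longlonglongrightarrow> u t" if "t \<in> {0..T}" for t
    unfolding LIMSEQ_iff using unif that by blast
  have uR: "norm (u t) \<le> R" if "t \<in> {0..T}" for t
    by (rule LIMSEQ_le_const2[OF tendsto_norm[OF ptw[OF that]]]) (use R[OF that] in blast)
  have zk: "(\<lambda>n. z (k n)) \<longlonglongrightarrow> \<xi>" using LIMSEQ_subseq_LIMSEQ[OF lim k] by (simp add: o_def)
  \<comment> \<open>Uniform convergence of the derivatives lets the limit be differentiated;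
    \<open>v\<close> is again the Arzela-Ascoli limit \<open>u\<close> on [0,T].\<close>
  have "\<exists>v. \<forall>t\<in>{0..T}. (\<lambda>n. sol \<epsilon> (z (k n)) t) \<longlonglongrightarrow> v t \<and>
      (v has_derivative (\<lambda>h. h *\<^sub>R field \<epsilon> t (u t))) (at t within {0..T})"
  proof (rule has_derivative_sequence[where f' = "\<lambda>n t h. h *\<^sub>R field \<epsilon> t (sol \<epsilon> (z (k n)) t)" and ?x0.0 = 0 and l = \<xi>])
    show "convex {0..T}" by simp
    show "(sol \<epsilon> (z (k n)) has_derivative (\<lambda>h. h *\<^sub>R field \<epsilon> t (sol \<epsilon> (z (k n)) t))) (at t within {0..T})"
      if "t \<in> {0..T}" for n t
      using solves_sol[OF e] that unfolding solves_def has_vector_derivative_def by blast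
    show "0 \<in> {0..T}" by (rule T0)
    show "(\<lambda>n. sol \<epsilon> (z (k n)) 0) \<longlonglongrightarrow> \<xi>" using zk by (simp add: sol_0[OF e])
    fix r :: real assume r: "r > 0"
    obtain d where d: "d > 0" "\<And>p p'. p \<in> ?S \<Longrightarrow> p' \<in> ?S \<Longrightarrow> dist p' p < d \<Longrightarrow>
      dist (case p' of (t, x) \<Rightarrow> field \<epsilon> t x) (case p of (t, x) \<Rightarrow> field \<epsilon> t x) < r" using uc[OF r] by blast
    obtain N where N: "\<And>n t. n \<ge> N \<Longrightarrow> t \<in> {0..T} \<Longrightarrow> norm (sol \<epsilon> (z (k n)) t - u t) < d" using unif[OF d(1)] by blast
    have "norm (h *\<^sub>R field \<epsilon> t (sol \<epsilon> (z (k n)) t) - h *\<^sub>R field \<epsilon> t (u t)) \<le> r * norm h"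
      if n: "n \<ge> N" and t: "t \<in> {0..T}" for n t h
    proof -
      have "dist (t, sol \<epsilon> (z (k n)) t) (t, u t) < d" using N[OF n t] by (simp add: dist_Pair_Pair dist_norm)
      then have "dist (field \<epsilon> t (sol \<epsilon> (z (k n)) t)) (field \<epsilon> t (u t)) < r"
        using d(2)[of "(t, u t)" "(t, sol \<epsilon> (z (k n)) t)"] t R[OF t] uR[OF t] by simp
      then have "\<bar>h\<bar> * norm (field \<epsilon> t (sol \<epsilon> (z (k n)) t) - field \<epsilon> t (u t)) \<le> \<bar>h\<bar> * r"
        by (intro mult_left_mono) (simp_all add: dist_norm)
      then show ?thesis by (simp add: mult.commute flip: scaleR_right_diff_distrib)
    qed
    then show "\<forall>\<^sub>F n in sequentially. \<forall>t\<in>{0..T}. \<forall>h.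
        norm (h *\<^sub>R field \<epsilon> t (sol \<epsilon> (z (k n)) t) - h *\<^sub>R field \<epsilon> t (u t)) \<le> r * norm h"
      unfolding eventually_sequentially by blast
  qed
  then obtain v where v: "\<And>t. t \<in> {0..T} \<Longrightarrow> (\<lambda>n. sol \<epsilon> (z (k n)) t) \<longlonglongrightarrow> v t"
    "\<And>t. t \<in> {0..T} \<Longrightarrow> (v has_derivative (\<lambda>h. h *\<^sub>R field \<epsilon> t (u t))) (at t within {0..T})" by blast
  have uv: "u t = v t" if "t \<in> {0..T}" for t by (rule LIMSEQ_unique[OF ptw[OF that] v(1)[OF that]])
  have "(\<lambda>n. sol \<epsilon> (z (k n)) 0) \<longlonglongrightarrow> \<xi>" using zk by (simp add: sol_0[OF e])
  then have "v 0 = \<xi>" using LIMSEQ_unique[OF v(1)[OF T0(1)]] by blast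
  moreover have "(v has_vector_derivative field \<epsilon> t (v t)) (at t within {0..T})" if "t \<in> {0..T}" for t
    unfolding has_vector_derivative_def using v(2)[OF that] by (simp only: uv[OF that])
  ultimately have "ivp_solution (field \<epsilon>) T 0 \<xi> v" unfolding ivp_solution_def by blast
  from sol_eq[OF e this T0(2)] have "sol \<epsilon> \<xi> T = v T" .
  moreover have "(\<lambda>n. sol \<epsilon> (z (k n)) T) \<longlonglongrightarrow> q" using LIMSEQ_subseq_LIMSEQ[OF q k] by (simp add: o_def)
  then have "v T = q" by (rule LIMSEQ_unique[OF v(1)[OF T0(2)]])
  ultimately show ?thesis by simp
qed

text \<open>A map into a compact ball is continuous once its graph is closed, and closedness is
  \<open>sol_limit\<close>.\<close>

lemma poincare_continuous:
  assumes e: "\<epsilon> \<in> {0..1}" and K: "compact K" and R: "\<And>\<xi> t. \<xi> \<in> K \<Longrightarrow> t \<in> {0..T} \<Longrightarrow> norm (sol \<epsilon> \<xi> t) \<le> R"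
  shows "continuous_on K (\<lambda>\<xi>. sol \<epsilon> \<xi> T)"
proof (rule continuous_from_closed_graph)
  show "compact (cball (0::'a) R)" by simp
  show "(\<lambda>\<xi>. sol \<epsilon> \<xi> T) \<in> K \<rightarrow> cball 0 R" using R T by simp
  show "closed ((\<lambda>\<xi>. (\<xi>, sol \<epsilon> \<xi> T)) ` K)"
    unfolding closed_sequential_limits
  proof (intro allI impI, elim conjE)
    fix p l assume p: "\<forall>n. p n \<in> (\<lambda>\<xi>. (\<xi>, sol \<epsilon> \<xi> T)) ` K" and l: "p \<longlonglongrightarrow> l"
    define z where "z n = fst (p n)" for n
    have z: "z n \<in> K" "p n = (z n, sol \<epsilon> (z n) T)" for n
      using p[rule_format, of n] by (auto simp: z_def)
    have lz: "z \<longlonglongrightarrow> fst l" using tendsto_fst[OF l] by (simp add: z_def[abs_def])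
    have lq: "(\<lambda>n. sol \<epsilon> (z n) T) \<longlonglongrightarrow> snd l" using tendsto_snd[OF l] by (simp add: z(2))
    have "fst l \<in> K" using closed_sequentially[OF compact_imp_closed[OF K] z(1) lz] .
    moreover have "snd l = sol \<epsilon> (fst l) T" by (rule sol_limit[OF e _ lz lq]) (rule R[OF z(1)])
    ultimately show "l \<in> (\<lambda>\<xi>. (\<xi>, sol \<epsilon> \<xi> T)) ` K" by (intro image_eqI[of _ _ "fst l"]) (simp_all add: prod_eq_iff)
  qed
qed

lemma poincare_continuous_near_0:
  assumes K: "compact K"
  shows "\<exists>\<delta>\<in>{0<..1}. \<forall>\<epsilon>\<in>{0..\<delta>}. continuous_on K (\<lambda>\<xi>. sol \<epsilon> \<xi> T)"
proof -
  obtain \<delta> R where d: "\<delta> \<in> {0<..1}" and R: "\<And>\<xi> \<epsilon> t. \<xi> \<in> K \<Longrightarrow> \<epsilon> \<in> {0..\<delta>} \<Longrightarrow> t \<in> {0..T} \<Longrightarrow> norm (sol \<epsilon> \<xi> t) \<le> R"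
    using compact_solution_bound[OF K] by blast
  have "continuous_on K (\<lambda>\<xi>. sol \<epsilon> \<xi> T)" if "\<epsilon> \<in> {0..\<delta>}" for \<epsilon>
    by (rule poincare_continuous[OF _ K R[OF _ that]]) (use that d in auto)
  then show ?thesis using d by blast
qed

end

section \<open>Periodic solutions near the boundary\<close>

text \<open>The local degree of I - P is the sign of the determinant of I - P'(a), and that sign is
  the parity of the number of negative eigenvalues.\<close>

lemma fixed_point_index_eq_degree:
  fixes P :: "real^'n \<Rightarrow> real^'n"
  assumes d: "P differentiable at a" and fp: "P a = a"
    and inv: "invertible (mat 1 - jacobian_matrix P a)"
  obtains r0 where "r0 > 0" "\<And>x. dist x a < r0 \<Longrightarrow> P x = x \<Longrightarrow> x = a"
    "\<And>r. 0 < r \<Longrightarrow> r < r0 \<Longrightarrow> continuous_on (cball a r) P \<Longrightarrow>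
       brouwer_degree (\<lambda>x. x - P x) (ball a r) = fixed_point_index a P"
proof -
  let ?D = "\<lambda>h. h - frechet_derivative P (at a) h"
  have "((\<lambda>x. x - P x) has_derivative ?D) (at a)"
    using d by (intro has_derivative_diff has_derivative_ident) (simp add: frechet_derivative_works)
  have J: "matrix ?D = mat 1 - jacobian_matrix P a"
  proof -
    have "axis j (1::real) $ i = (if i = j then 1 else 0)" for i j :: 'n by (simp add: axis_def)
    then show ?thesis unfolding vec_eq_iff by (simp add: jacobian_matrix_def matrix_component mat_def)
  qed
  have reg: "det (matrix ?D) \<noteq> 0" using inv unfolding J by (simp add: invertible_det_nz)
  obtain r0 where r0: "r0 > 0" "\<And>x. dist x a < r0 \<Longrightarrow> x - P x = 0 \<Longrightarrow> x = a"
    "\<And>r. 0 < r \<Longrightarrow> r < r0 \<Longrightarrow> continuous_on (cball a r) (\<lambda>x. x - P x) \<Longrightarrow>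
       real_of_int (brouwer_degree (\<lambda>x. x - P x) (ball a r)) = sgn (det (matrix ?D))"
    using brouwer_degree_local[OF \<open>((\<lambda>x. x - P x) has_derivative ?D) (at a)\<close> _ reg] fp by (metis (no_types, lifting) right_minus_eq)
  have ind: "real_of_int (fixed_point_index a P) = sgn (det (matrix ?D))"
    using sgn_det_eq_negative_eigenvalue_count[OF reg] unfolding fixed_point_index_def J by simp
  show ?thesis
  proof
    show "r0 > 0" by (fact r0(1))
    show "x = a" if "dist x a < r0" "P x = x" for x using r0(2)[OF that(1)] that(2) by simp
    fix r assume r: "0 < r" "r < r0" and c: "continuous_on (cball a r) P"
    have "continuous_on (cball a r) (\<lambda>x. x - P x)" by (intro continuous_on_diff continuous_on_id c)
    from r0(3)[OF r this] show "brouwer_degree (\<lambda>x. x - P x) (ball a r) = fixed_point_index a P"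
      unfolding ind[symmetric] by simp
  qed
qed

text \<open>Additivity over disjoint balls around the fixed points, each small enough for its local
  degree to be the index.\<close>

lemma brouwer_degree_eq_index_sum:
  fixes P :: "real^'n \<Rightarrow> real^'n"
  assumes V: "open V" "bounded V" and P: "continuous_on (closure V) P"
    and d: "\<And>a. a \<in> V \<Longrightarrow> P a = a \<Longrightarrow> P differentiable at a"
    and inv: "\<And>a. a \<in> V \<Longrightarrow> P a = a \<Longrightarrow> invertible (mat 1 - jacobian_matrix P a)"
    and fin: "finite {a \<in> V. P a = a}" and fr: "\<And>x. x \<in> frontier V \<Longrightarrow> P x \<noteq> x"
  shows "brouwer_degree (\<lambda>x. x - P x) V = (\<Sum>a | a \<in> V \<and> P a = a. fixed_point_index a P)"
proof -
  let ?Z = "{a \<in> V. P a = a}"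
  define Q where "Q a r0 \<longleftrightarrow> r0 > 0 \<and> (\<forall>r. 0 < r \<longrightarrow> r < r0 \<longrightarrow> continuous_on (cball a r) P \<longrightarrow>
       brouwer_degree (\<lambda>x. x - P x) (ball a r) = fixed_point_index a P)" for a r0
  have "\<forall>a\<in>?Z. \<exists>r. Q a r \<and> cball a r \<subseteq> V \<and> (\<forall>b\<in>?Z. b \<noteq> a \<longrightarrow> 2 * r \<le> dist a b)"
  proof
    fix a assume a: "a \<in> ?Z"
    then have aV: "a \<in> V" "P a = a" by blast+
    have "\<exists>r0. Q a r0"
      by (rule fixed_point_index_eq_degree[OF d[OF aV] aV(2) inv[OF aV]]) (unfold Q_def, blast)
    then obtain r0 where r0: "Q a r0" ..
    obtain e where e: "e > 0" "cball a e \<subseteq> V" using V(1) a open_contains_cball by blast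
    obtain s where s: "s > 0" "\<forall>b\<in>?Z. b \<noteq> a \<longrightarrow> s \<le> dist a b" using finite_set_avoid[OF fin] by blast
    define r where "r = min r0 (min e (s / 2))"
    have r: "r > 0" "r \<le> r0" "r \<le> e" "2 * r \<le> s" using r0 e s by (auto simp: r_def Q_def)
    have "Q a r" using r0 r unfolding Q_def by simp
    moreover have "cball a r \<subseteq> V" using subset_cball[OF r(3)] e(2) by (rule order_trans)
    moreover have "\<forall>b\<in>?Z. b \<noteq> a \<longrightarrow> 2 * r \<le> dist a b" using s(2) r(4) by (meson order_trans)
    ultimately show "\<exists>r. Q a r \<and> cball a r \<subseteq> V \<and> (\<forall>b\<in>?Z. b \<noteq> a \<longrightarrow> 2 * r \<le> dist a b)" by blast
  qed
  from bchoice[OF this] obtain \<rho> where \<rho>: "\<forall>a\<in>?Z. Q a (\<rho> a) \<and> cball a (\<rho> a) \<subseteq> V \<and> (\<forall>b\<in>?Z. b \<noteq> a \<longrightarrow> 2 * \<rho> a \<le> dist a b)" ..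
  \<comment> \<open>Half the radius, since \<open>Q\<close> speaks of radii strictly below
    \<open>\<rho> a\<close>.\<close>
  define B where "B a = ball a (\<rho> a / 2)" for a
  have pos: "\<rho> a > 0" if "a \<in> ?Z" for a using \<rho> that unfolding Q_def by blast
  have sub: "cball a (\<rho> a / 2) \<subseteq> V" if "a \<in> ?Z" for a
  proof -
    have "cball a (\<rho> a / 2) \<subseteq> cball a (\<rho> a)" using pos[OF that] by (intro subset_cball) simp
    then show ?thesis using \<rho> that by blast
  qed
  have "brouwer_degree (\<lambda>x. x - P x) V = (\<Sum>a\<in>?Z. brouwer_degree (\<lambda>x. x - P x) (B a))"
  proof (rule brouwer_degree_additive[OF V _ fin])
    show "continuous_on (closure V) (\<lambda>x. x - P x)" by (intro continuous_on_diff continuous_on_id P)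
    show "open (B a)" for a by (simp add: B_def)
    show "B a \<subseteq> V" if "a \<in> ?Z" for a using sub[OF that] ball_subset_cball unfolding B_def by blast
    show "B a \<inter> B b = {}" if ab: "a \<in> ?Z" "b \<in> ?Z" "a \<noteq> b" for a b
    proof -
      have "2 * \<rho> a \<le> dist a b" "2 * \<rho> b \<le> dist b a" using \<rho> ab not_sym[OF ab(3)] by blast+
      then have "\<rho> a / 2 + \<rho> b / 2 \<le> dist a b" using pos[OF ab(1)] pos[OF ab(2)] dist_commute[of a b] by linarith
      then show ?thesis unfolding B_def by (rule disjoint_ballI)
    qed
    show "x - P x \<noteq> 0" if x: "x \<in> closure V - (\<Union>a\<in>?Z. B a)" for x
    proof
      assume "x - P x = 0"
      then have "P x = x" by simp
      then have "x \<notin> frontier V" using fr by blast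
      then have "x \<in> V" using x V(1) by (auto simp: frontier_def interior_open)
      then have "x \<in> ?Z" using \<open>P x = x\<close> by simp
      moreover have "x \<in> B x" using pos[OF \<open>x \<in> ?Z\<close>] by (simp add: B_def)
      ultimately show False using x by blast
    qed
  qed
  also have "\<dots> = (\<Sum>a\<in>?Z. fixed_point_index a P)"
  proof (rule sum.cong)
    fix a assume a: "a \<in> ?Z"
    have "continuous_on (cball a (\<rho> a / 2)) P"
      using continuous_on_subset[OF P] sub[OF a] closure_subset by blast
    moreover have "0 < \<rho> a / 2" "\<rho> a / 2 < \<rho> a" using pos[OF a] by simp_all
    ultimately show "brouwer_degree (\<lambda>x. x - P x) (B a) = fixed_point_index a P"
      using \<rho> a unfolding B_def Q_def by blast
  qed simp
  finally show ?thesis .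
qed

text \<open>The topological core, stated for a family of maps known only through its expansion in
  \<epsilon>. Without a fixed point near the frontier, excision would make the degree of I -
  P_\<epsilon> on \<open>U\<close> equal to that on \<open>V\<close>, against
  \<open>index\<close>.\<close>

lemma fixed_points_near_frontier:
  fixes P :: "real \<Rightarrow> real^'n \<Rightarrow> real^'n" and \<Phi> :: "real^'n \<Rightarrow> real^'n"
  assumes U: "open U" "bounded U"
    and cont: "\<And>\<epsilon>. \<epsilon> \<in> {0..\<epsilon>1} \<Longrightarrow> continuous_on (closure U) (P \<epsilon>)" and e1: "\<epsilon>1 > 0"
    and fixed: "\<And>x. x \<in> frontier U \<Longrightarrow> P 0 x = x"
    and expansion: "\<And>\<kappa>. \<kappa> > 0 \<Longrightarrow> \<exists>\<delta>>0. \<forall>\<epsilon>\<in>{0..\<delta>}. \<forall>x\<in>closure U. norm (P \<epsilon> x - P 0 x - \<epsilon> *\<^sub>R \<Phi> x) \<le> \<kappa> * \<epsilon>"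
    and \<Phi>: "continuous_on (closure U) \<Phi>" "\<And>x. x \<in> frontier U \<Longrightarrow> \<Phi> x \<noteq> 0"
    and diff: "\<And>a. a \<in> U \<Longrightarrow> P 0 a = a \<Longrightarrow> P 0 differentiable at a"
    and inv: "\<And>a. a \<in> U \<Longrightarrow> P 0 a = a \<Longrightarrow> invertible (mat 1 - jacobian_matrix (P 0) a)"
    and fin: "finite {a \<in> U. P 0 a = a}"
    and index: "(\<Sum>a\<in>{a \<in> U. P 0 a = a}. fixed_point_index a (P 0)) \<noteq> brouwer_degree (\<lambda>x. - \<Phi> x) U"
    and \<delta>: "\<delta> > 0"
  shows "\<exists>\<epsilon>0>0. \<forall>\<epsilon>\<in>{0<..\<epsilon>0}. \<exists>x\<in>U. P \<epsilon> x = x \<and> infdist x (frontier U) \<le> \<delta>"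
proof -
  let ?Z = "{a \<in> U. P 0 a = a}" and ?d = "\<lambda>x. infdist x (frontier U)"
  have ne: "frontier U \<noteq> {}"
  proof
    assume "frontier U = {}"
    then have U0: "U = {}" by (rule bounded_open_frontier_empty[OF U(2)])
    \<comment> \<open>Additivity over an empty family: the degree on the empty set is 0, as is the
      empty sum of indices, so \<open>index\<close> rules out an empty frontier.\<close>
    have "brouwer_degree (\<lambda>x. - \<Phi> x) {} = (\<Sum>i\<in>({}::nat set). brouwer_degree (\<lambda>x. - \<Phi> x) ({} :: (real^'n) set))"
      by (rule brouwer_degree_additive) auto
    then show False using index U0 by simp
  qed
  have clU: "x \<in> U" if "x \<in> closure U" "x \<notin> frontier U" for x
    using that U(1) by (simp add: frontier_def interior_open)
  have frU: "frontier U \<subseteq> closure U" by (simp add: frontier_def)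
  have dpos: "0 < ?d a" if "a \<in> U" for a
  proof -
    have "a \<notin> frontier U" using that U(1) by (simp add: frontier_def interior_open)
    then show ?thesis using infdist_pos_not_in_closed[OF frontier_closed ne] by blast
  qed
  \<comment> \<open>Half the minimum, so that every fixed point of \<open>P 0\<close> in
    \<open>U\<close> lies in \<open>V\<close> and none on its frontier.\<close>
  define \<delta>' where "\<delta>' = Min (insert \<delta> (?d ` ?Z)) / 2"
  have Minpos: "0 < Min (insert \<delta> (?d ` ?Z))" using fin \<delta> dpos by (subst Min_gr_iff) auto
  have d': "\<delta>' > 0" "\<delta>' \<le> \<delta>" "\<And>a. a \<in> ?Z \<Longrightarrow> \<delta>' < ?d a"
  proof -
    show "\<delta>' > 0" using Minpos by (simp add: \<delta>'_def)
    have "Min (insert \<delta> (?d ` ?Z)) \<le> \<delta>" using fin by (intro Min_le) auto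
    then show "\<delta>' \<le> \<delta>" using Minpos \<delta> by (simp add: \<delta>'_def)
    fix a assume a: "a \<in> ?Z"
    have "Min (insert \<delta> (?d ` ?Z)) \<le> ?d a" using fin a by (intro Min_le) auto
    then show "\<delta>' < ?d a" using Minpos unfolding \<delta>'_def by linarith
  qed
  have cd: "continuous_on UNIV ?d" by (intro continuous_on_infdist continuous_on_id)
  define V where "V = U \<inter> ?d -` {\<delta>'<..}"
  have oV: "open V" unfolding V_def
    by (rule continuous_open_preimage[OF continuous_on_subset[OF cd subset_UNIV] U(1) open_greaterThan])
  have VU: "V \<subseteq> U" by (simp add: V_def)
  have bV: "bounded V" by (rule bounded_subset[OF U(2) VU])
  have clVU: "closure V \<subseteq> closure U" by (rule closure_mono[OF VU])
  have clV: "x \<in> U" "\<delta>' \<le> ?d x" if x: "x \<in> closure V" for x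
  proof -
    have "closed (?d -` {\<delta>'..})" using cd by (intro continuous_closed_vimage) (auto simp: continuous_on_eq_continuous_at)
    moreover have "V \<subseteq> ?d -` {\<delta>'..}" by (auto simp: V_def)
    ultimately have "closure V \<subseteq> ?d -` {\<delta>'..}" by (rule closure_minimal[rotated])
    then show "\<delta>' \<le> ?d x" using x by auto
    then have "?d x \<noteq> 0" using d'(1) by linarith
    then have "x \<notin> frontier U" using infdist_zero by blast
    then show "x \<in> U" using clU clVU x by blast
  qed
  have ZV: "{a \<in> V. P 0 a = a} = ?Z" using d'(3) VU unfolding V_def by auto
  have frV: "P 0 x \<noteq> x" if x: "x \<in> frontier V" for x
  proof
    assume "P 0 x = x"
    moreover have "x \<in> closure V" "x \<notin> V" using x oV by (auto simp: frontier_def interior_open)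
    ultimately have "x \<in> {a \<in> V. P 0 a = a}" unfolding ZV using clV(1) by blast
    then show False using \<open>x \<notin> V\<close> by blast
  qed
  have c0: "continuous_on (closure U) (P 0)" by (rule cont) (use e1 in simp)
  have cF: "continuous_on (closure U) (\<lambda>x. x - P \<epsilon> x)" if "\<epsilon> \<in> {0..\<epsilon>1}" for \<epsilon>
    by (intro continuous_on_diff continuous_on_id cont that)
  have frVU: "frontier V \<subseteq> closure U" using clVU by (auto simp: frontier_def)
  have "\<exists>m>0. \<forall>x\<in>frontier V. m \<le> norm (x - P 0 x)"
  proof (rule compact_norm_bound_below)
    show "continuous_on (frontier V) (\<lambda>x. x - P 0 x)" by (rule continuous_on_subset[OF cF frVU]) (use e1 in simp)
    show "x - P 0 x \<noteq> 0" if "x \<in> frontier V" for x using frV[OF that] by simp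
  qed (rule compact_frontier_bounded[OF bV])
  then obtain m1 where m1: "m1 > 0" "\<And>x. x \<in> frontier V \<Longrightarrow> m1 \<le> norm (x - P 0 x)" by blast
  have "\<exists>m>0. \<forall>x\<in>frontier U. m \<le> norm (\<Phi> x)"
    by (rule compact_norm_bound_below[OF compact_frontier_bounded[OF U(2)] continuous_on_subset[OF \<Phi>(1) frU] \<Phi>(2)])
  then obtain m2 where m2: "m2 > 0" "\<And>x. x \<in> frontier U \<Longrightarrow> m2 \<le> norm (\<Phi> x)" by blast
  have "bounded (\<Phi> ` closure U)" using \<Phi>(1) U(2) by (intro compact_imp_bounded compact_continuous_image) auto
  then obtain M where M: "M > 0" "\<And>x. x \<in> closure U \<Longrightarrow> norm (\<Phi> x) \<le> M" unfolding bounded_pos by blast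
  \<comment> \<open>With this \<kappa> the remainder on the frontier of \<open>U\<close> is at most
    half as long as \<epsilon> \<Phi>.\<close>
  have "m2 / 2 > 0" using m2(1) by simp
  from expansion[OF this] obtain r where r: "r > 0"
    "\<And>\<epsilon> x. \<epsilon> \<in> {0..r} \<Longrightarrow> x \<in> closure U \<Longrightarrow> norm (P \<epsilon> x - P 0 x - \<epsilon> *\<^sub>R \<Phi> x) \<le> m2 / 2 * \<epsilon>" by blast
  \<comment> \<open>Keeps the distance of \<open>P \<epsilon>\<close> from \<open>P 0\<close>, at
    most \<epsilon> (M + m2), below the minimum \<open>m1\<close> of |x - P 0 x| on the frontier of
    \<open>V\<close>.\<close>
  define \<epsilon>0 where "\<epsilon>0 = min \<epsilon>1 (min r (m1 / (2 * (M + m2))))"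
  have e0: "\<epsilon>0 > 0" "\<epsilon>0 \<le> \<epsilon>1" "\<epsilon>0 \<le> r" "\<epsilon>0 * (M + m2) < m1"
  proof -
    have pos: "M + m2 > 0" using M(1) m2(1) by simp
    show "\<epsilon>0 > 0" using e1 r(1) m1(1) pos by (simp add: \<epsilon>0_def)
    have "\<epsilon>0 * (M + m2) \<le> m1 / (2 * (M + m2)) * (M + m2)" using pos by (intro mult_right_mono) (simp_all add: \<epsilon>0_def)
    also have "\<dots> = m1 / 2" using pos by (simp add: field_simps)
    finally show "\<epsilon>0 * (M + m2) < m1" using m1(1) by linarith
  qed (simp_all add: \<epsilon>0_def)
  have "\<exists>x\<in>U. P \<epsilon> x = x \<and> ?d x \<le> \<delta>" if e: "\<epsilon> \<in> {0<..\<epsilon>0}" for \<epsilon>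
  proof (rule ccontr)
    assume none: "\<not> (\<exists>x\<in>U. P \<epsilon> x = x \<and> ?d x \<le> \<delta>)"
    have er: "\<epsilon> \<in> {0..r}" "\<epsilon> \<in> {0..\<epsilon>1}" "\<epsilon> > 0" using e e0 by auto
    let ?F = "\<lambda>x. x - P \<epsilon> x"
    \<comment> \<open>On the frontier \<open>P 0 x = x\<close>, so x - P_\<epsilon>(x) is
      -\<epsilon> \<Phi>(x) up to the remainder \<open>v\<close>, which is too short to cancel any
      stage of the homotopy to -\<Phi>.\<close>
    have hom: "(1 - t) *\<^sub>R ?F x + t *\<^sub>R (- \<Phi> x) \<noteq> 0" if x: "x \<in> frontier U" and t: "t \<in> {0..1}" for x t
    proof
      assume 0: "(1 - t) *\<^sub>R ?F x + t *\<^sub>R (- \<Phi> x) = 0"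
      define v where "v = P \<epsilon> x - P 0 x - \<epsilon> *\<^sub>R \<Phi> x"
      have F: "?F x = - (\<epsilon> *\<^sub>R \<Phi> x) - v" unfolding v_def using fixed[OF x] by simp
      have "((1 - t) * \<epsilon> + t) *\<^sub>R p + (1 - t) *\<^sub>R v = - ((1 - t) *\<^sub>R (- (\<epsilon> *\<^sub>R p) - v) + t *\<^sub>R (- p))" for p
        by (simp add: algebra_simps)
      then have "((1 - t) * \<epsilon> + t) *\<^sub>R \<Phi> x + (1 - t) *\<^sub>R v = 0" using 0 unfolding F by simp
      then have "((1 - t) * \<epsilon> + t) *\<^sub>R \<Phi> x = - ((1 - t) *\<^sub>R v)" by (simp only: eq_neg_iff_add_eq_0)
      then have n: "norm (((1 - t) * \<epsilon> + t) *\<^sub>R \<Phi> x) = norm ((1 - t) *\<^sub>R v)" by simp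
      have c: "0 \<le> (1 - t) * \<epsilon>" "0 \<le> t" "0 \<le> 1 - t" using t er(3) by simp_all
      have "((1 - t) * \<epsilon> + t) * m2 \<le> ((1 - t) * \<epsilon> + t) * norm (\<Phi> x)" using c m2(2)[OF x] by (intro mult_left_mono) simp_all
      also have "\<dots> = (1 - t) * norm v" using n c by simp
      also have "\<dots> \<le> (1 - t) * (m2 / 2 * \<epsilon>)"
        using r(2)[OF er(1), of x] x frU c(3) unfolding v_def by (intro mult_left_mono) auto
      finally have "((1 - t) * \<epsilon> + t) * m2 - (1 - t) * (m2 / 2 * \<epsilon>) \<le> 0" by linarith
      moreover have "((1 - t) * \<epsilon> + t) * m2 - (1 - t) * (m2 / 2 * \<epsilon>) = (1 - t) * \<epsilon> * (m2 / 2) + t * m2"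
        by (simp add: field_simps)
      ultimately have "(1 - t) * \<epsilon> * (m2 / 2) + t * m2 \<le> 0" by linarith
      moreover have "0 \<le> (1 - t) * \<epsilon> * (m2 / 2)" "0 \<le> t * m2" using c m2(1) by simp_all
      ultimately have "t * m2 = 0" "(1 - t) * \<epsilon> * (m2 / 2) = 0" by linarith+
      then show False using m2(1) er(3) by simp
    qed
    have "brouwer_degree (\<lambda>x. - \<Phi> x) U = brouwer_degree ?F U"
      by (rule brouwer_degree_linear_homotopy[OF U cF[OF er(2)] _ hom, symmetric]) (intro continuous_on_minus \<Phi>(1))
    \<comment> \<open>Excision, as additivity over a single set.\<close>
    also have "\<dots> = (\<Sum>i\<in>{0::nat}. brouwer_degree ?F V)"
    proof (rule brouwer_degree_additive[OF U cF[OF er(2)]])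
      show "?F x \<noteq> 0" if x: "x \<in> closure U - (\<Union>i\<in>{0::nat}. V)" for x
      proof (cases "x \<in> frontier U")
        case True
        then show ?thesis using hom[of x 0] by simp
      next
        case False
        then have xU: "x \<in> U" using clU x by blast
        then have "?d x \<le> \<delta>'" using x unfolding V_def by auto
        then have "?d x \<le> \<delta>" using d'(2) by simp
        then show ?thesis using none xU by (metis right_minus_eq)
      qed
    qed (use oV VU in auto)
    also have "\<dots> = brouwer_degree ?F V" by simp
    also have "\<dots> = brouwer_degree (\<lambda>x. x - P 0 x) V"
    proof (rule brouwer_degree_linear_homotopy[OF oV bV])
      show "continuous_on (closure V) ?F" by (rule continuous_on_subset[OF cF[OF er(2)] clVU])
      show "continuous_on (closure V) (\<lambda>x. x - P 0 x)" by (rule continuous_on_subset[OF cF clVU]) (use e1 in simp)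
      fix x and t :: real assume x: "x \<in> frontier V" and t: "t \<in> {0..1}"
      have xc: "x \<in> closure U" using x frVU by blast
      let ?w = "P \<epsilon> x - P 0 x - \<epsilon> *\<^sub>R \<Phi> x"
      have "dist (?F x) (x - P 0 x) = norm (?w + \<epsilon> *\<^sub>R \<Phi> x)" by (simp add: dist_norm norm_minus_commute)
      also have "\<dots> \<le> m2 / 2 * \<epsilon> + \<epsilon> * M"
      proof (rule norm_triangle_le[OF add_mono])
        show "norm ?w \<le> m2 / 2 * \<epsilon>" by (rule r(2)[OF er(1) xc])
        show "norm (\<epsilon> *\<^sub>R \<Phi> x) \<le> \<epsilon> * M" using M(2)[OF xc] er(3) by simp
      qed
      also have "\<dots> \<le> \<epsilon> * (M + m2)" using m2(1) er(3) by (simp add: algebra_simps)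
      also have "\<dots> \<le> \<epsilon>0 * (M + m2)" using e M(1) m2(1) by (intro mult_right_mono) simp_all
      also have "\<dots> < m1" by (rule e0)
      finally have a: "dist (?F x) (x - P 0 x) < m1" .
      have b: "dist (x - P 0 x) (x - P 0 x) < m1" using m1(1) by simp
      have "dist ((1 - t) *\<^sub>R ?F x + t *\<^sub>R (x - P 0 x)) ((1 - t) *\<^sub>R (x - P 0 x) + t *\<^sub>R (x - P 0 x)) < m1"
        by (rule convex_combination_dist[OF a b t])
      moreover have "(1 - t) *\<^sub>R (x - P 0 x) + t *\<^sub>R (x - P 0 x) = x - P 0 x" by (simp add: algebra_simps)
      ultimately show "(1 - t) *\<^sub>R ?F x + t *\<^sub>R (x - P 0 x) \<noteq> 0"
        using m1(2)[OF x] by (metis dist_0_norm not_le)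
    qed
    also have "\<dots> = (\<Sum>a | a \<in> V \<and> P 0 a = a. fixed_point_index a (P 0))"
      by (rule brouwer_degree_eq_index_sum[OF oV bV continuous_on_subset[OF c0 clVU]])
        (use diff inv VU fin frV ZV in auto)
    also have "\<dots> = (\<Sum>a\<in>?Z. fixed_point_index a (P 0))" using ZV by simp
    finally show False using index by simp
  qed
  then show ?thesis using e0(1) by blast
qed

text \<open>At multiples of \<open>T\<close> the one-sided derivatives match because
  \<open>F\<close> is periodic and \<open>x T = x 0\<close>.\<close>

lemma periodic_extension:
  fixes F :: "real \<Rightarrow> 'a::real_normed_vector \<Rightarrow> 'a"
  assumes T: "0 < T" and F: "\<And>t x. F (t + T) x = F t x"
    and x: "ivp_solution F T 0 \<xi> x" and xT: "x T = \<xi>"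
  shows "periodic_solution F T (\<lambda>t. x (t - T * of_int \<lfloor>t / T\<rfloor>))"
proof -
  define X where "X t = x (t - T * of_int \<lfloor>t / T\<rfloor>)" for t
  have Fn: "F (t + T * real n) x = F t x" for t x and n :: nat
  proof (induction n)
    case (Suc n)
    have "F (t + T * real (Suc n)) x = F ((t + T * real n) + T) x" by (simp add: algebra_simps)
    then show ?case using Suc F by simp
  qed simp
  have Fi: "F (t + T * of_int n) x = F t x" for t x and n :: int
  proof (cases "0 \<le> n")
    case True
    then show ?thesis using Fn[of t "nat n" x] by simp
  next
    case False
    then show ?thesis using Fn[of "t + T * of_int n" "nat (- n)" x] by simp
  qed
  have x0: "x 0 = \<xi>" using x by (simp add: ivp_solution_def)
  \<comment> \<open>Valid up to the right end point, where the floor has already jumped but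
    \<open>x T = x 0\<close>.\<close>
  have Xn: "X t = x (t - T * of_int n)" if t: "t \<in> {T * of_int n..T * of_int n + T}" for t and n :: int
  proof (cases "t = T * of_int n + T")
    case True
    then have "t / T = of_int (n + 1)" using T by (simp add: field_simps)
    then have "\<lfloor>t / T\<rfloor> = n + 1" by simp
    then have "X t = x 0" using True unfolding X_def by (simp add: algebra_simps)
    moreover have "x (t - T * of_int n) = x T" using True by simp
    ultimately show ?thesis using x0 xT by simp
  next
    case False
    then have "of_int n \<le> t / T" "t / T < of_int n + 1" using t T by (simp_all add: field_simps)
    then have "\<lfloor>t / T\<rfloor> = n" by linarith
    then show ?thesis by (simp add: X_def)
  qed
  have d: "(X has_vector_derivative F t (X t)) (at t within {T * of_int n..T * of_int n + T})"
    if t: "t \<in> {T * of_int n..T * of_int n + T}" for t and n :: int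
  proof -
    let ?S = "{T * of_int n..T * of_int n + T}"
    have im: "(\<lambda>t. t - T * of_int n) ` ?S \<subseteq> {0..T}" by auto
    have "(x has_vector_derivative F (t - T * of_int n) (x (t - T * of_int n))) (at (t - T * of_int n) within {0..T})"
      using x t unfolding ivp_solution_def by auto
    then have "(x has_vector_derivative F (t - T * of_int n) (x (t - T * of_int n))) (at (t - T * of_int n) within (\<lambda>t. t - T * of_int n) ` ?S)"
      by (rule has_vector_derivative_within_subset[OF _ im])
    moreover have "((\<lambda>t. t - T * of_int n) has_vector_derivative 1) (at t within ?S)"
      by (auto intro!: derivative_eq_intros)
    ultimately have "(x \<circ> (\<lambda>t. t - T * of_int n) has_vector_derivative 1 *\<^sub>R F (t - T * of_int n) (x (t - T * of_int n))) (at t within ?S)"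
      by (rule vector_diff_chain_within[rotated])
    moreover have "F (t - T * of_int n) (x (t - T * of_int n)) = F t (X t)"
      using Fi[of "t - T * of_int n" n] Xn[OF t] by simp
    ultimately have "(x \<circ> (\<lambda>t. t - T * of_int n) has_vector_derivative F t (X t)) (at t within ?S)" by simp
    then show ?thesis
      by (rule has_vector_derivative_transform[OF t, rotated]) (simp add: Xn)
  qed
  have "(X has_vector_derivative F t (X t)) (at t)" for t
  proof -
    define n where "n = \<lfloor>t / T\<rfloor>"
    have "of_int n \<le> t / T" "t / T < of_int n + 1" unfolding n_def by linarith+
    then have t: "T * of_int n \<le> t" "t < T * of_int n + T" using T by (simp_all add: field_simps)
    show ?thesis
    proof (cases "t = T * of_int n")
      case True
      \<comment> \<open>The derivative exists within each of the two adjacent intervals, and their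
        union is a neighbourhood of \<open>t\<close>.\<close>
      let ?A = "{T * of_int n..T * of_int n + T}" and ?B = "{T * of_int (n - 1)..T * of_int (n - 1) + T}"
      have tA: "t \<in> ?A" "t \<in> ?B" using True T by (simp_all add: algebra_simps)
      have "at t within (?A \<union> ?B) = at t"
      proof (rule at_within_interior)
        have "?A \<union> ?B = {T * of_int (n - 1)..T * of_int n + T}" using T by (auto simp: algebra_simps)
        then show "t \<in> interior (?A \<union> ?B)" using True T by (simp add: algebra_simps)
      qed
      moreover have "(X has_vector_derivative F t (X t)) (at t within (?A \<union> ?B))"
        using d[OF tA(1)] d[OF tA(2)]
        unfolding has_vector_derivative_def has_derivative_within
        by (simp only: at_within_union) (blast intro: filterlim_sup)
      ultimately show ?thesis by simp
    next
      case False
      then have "t \<in> interior {T * of_int n..T * of_int n + T}" using t by simp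
      then have "at t within {T * of_int n..T * of_int n + T} = at t" by (rule at_within_interior)
      then show ?thesis using d[of t n] t by simp
    qed
  qed
  moreover have "X (t + T) = X t" for t
  proof -
    have "(t + T) / T = t / T + 1" using T by (simp add: field_simps)
    then have "\<lfloor>(t + T) / T\<rfloor> = \<lfloor>t / T\<rfloor> + 1" by simp
    then show ?thesis unfolding X_def by (simp add: algebra_simps)
  qed
  ultimately show ?thesis unfolding periodic_solution_def X_def[abs_def] by blast
qed

lemma C1_on_partial_derivative:
  fixes f :: "real \<Rightarrow> 'a::euclidean_space \<Rightarrow> 'b::real_normed_vector"
  assumes "C1_on UNIV (\<lambda>(t, x). f t x)"
  obtains A :: "real \<times> 'a \<Rightarrow> 'a \<Rightarrow>\<^sub>L 'b" where "continuous_on UNIV A"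
    "\<And>t x. (f t has_derivative blinfun_apply (A (t, x))) (at x)"
proof -
  obtain F' :: "real \<times> 'a \<Rightarrow> (real \<times> 'a) \<Rightarrow>\<^sub>L 'b" where
    d: "\<And>p. ((\<lambda>(t, x). f t x) has_derivative blinfun_apply (F' p)) (at p)" and c: "continuous_on UNIV F'"
    using assms unfolding C1_on_def by blast
  define i :: "'a \<Rightarrow>\<^sub>L (real \<times> 'a)" where "i = Blinfun (Pair 0)"
  have i: "blinfun_apply i h = (0, h)" for h
  proof -
    have "bounded_linear (\<lambda>h::'a. (0::real, h))" by (intro bounded_linear_Pair bounded_linear_zero bounded_linear_ident)
    then show ?thesis unfolding i_def by (simp add: bounded_linear_Blinfun_apply)
  qed
  show ?thesis
  proof
    show "continuous_on UNIV (\<lambda>p. F' p o\<^sub>L i)" by (intro continuous_intros c)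
    fix t :: real and x :: 'a
    have "((\<lambda>x. (t, x)) has_derivative (\<lambda>h. (0, h))) (at x)" by (auto intro!: derivative_eq_intros)
    from has_derivative_compose[OF this d]
    have "(f t has_derivative (\<lambda>h. F' (t, x) (0, h))) (at x)" by simp
    moreover have "blinfun_apply (F' (t, x) o\<^sub>L i) = (\<lambda>h. F' (t, x) (0, h))" by (rule ext) (simp add: i)
    ultimately show "(f t has_derivative blinfun_apply (F' (t, x) o\<^sub>L i)) (at x)" by simp
  qed
qed

theorem mainTheorem5:
  fixes f :: "real \<Rightarrow> real^'n \<Rightarrow> real^'n"
    and g :: "real \<Rightarrow> real^'n \<Rightarrow> real \<Rightarrow> real^'n"
    and T :: real
    and U :: "(real^'n) set"
  assumes T_pos: "0 < T"
    and f_C1: "C1_on UNIV (\<lambda>(t, x). f t x)"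
    and g_cont: "continuous_on (UNIV \<times> UNIV \<times> {0..1}) (\<lambda>(t, x, \<epsilon>). g t x \<epsilon>)"
    and f_periodic: "\<And>t x. f (t + T) x = f t x"
    and g_periodic: "\<And>t x \<epsilon>. \<epsilon> \<in> {0..1} \<Longrightarrow> g (t + T) x \<epsilon> = g t x \<epsilon>"
    and f_extend: "\<And>t0 \<xi>. t0 \<in> {0..T} \<Longrightarrow> \<exists>x. ivp_solution f T t0 \<xi> x"
    and U_open: "open U"
    and U_bounded: "bounded U"
    and frontier_fixed: "\<And>\<xi>. \<xi> \<in> frontier U \<Longrightarrow> poincare_map f T \<xi> = \<xi>"
    and perturbed_exists: "\<And>t0 \<xi> \<epsilon>. t0 \<in> {0..T} \<Longrightarrow> \<epsilon> \<in> {0<..1} \<Longrightarrow>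
          \<exists>x. ivp_solution (\<lambda>t x. f t x + \<epsilon> *\<^sub>R g t x \<epsilon>) T t0 \<xi> x"
    and perturbed_unique: "\<And>t0 \<xi> \<epsilon> x y t. t0 \<in> {0..T} \<Longrightarrow> \<epsilon> \<in> {0<..1} \<Longrightarrow>
          ivp_solution (\<lambda>t x. f t x + \<epsilon> *\<^sub>R g t x \<epsilon>) T t0 \<xi> x \<Longrightarrow>
          ivp_solution (\<lambda>t x. f t x + \<epsilon> *\<^sub>R g t x \<epsilon>) T t0 \<xi> y \<Longrightarrow>
          t \<in> {0..T} \<Longrightarrow> x t = y t"
    and averaging_nonzero: "\<And>s \<xi>. s \<in> {0..T} \<Longrightarrow> \<xi> \<in> frontier U \<Longrightarrow>
          averaging_operator f g T s \<xi> \<noteq> 0"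
    and finite_fixed: "finite {a \<in> U. poincare_map f T a = a}"
    and nonsingular: "\<And>a. a \<in> U \<Longrightarrow> poincare_map f T a = a \<Longrightarrow>
          invertible (mat 1 - jacobian_matrix (poincare_map f T) a)"
    and index_sum: "(\<Sum>a\<in>{a \<in> U. poincare_map f T a = a}. fixed_point_index a (poincare_map f T))
          \<noteq> brouwer_degree (\<lambda>\<xi>. - averaging_operator f g T T \<xi>) U"
  shows "\<exists>\<epsilon>0\<in>{0<..1}. \<exists>x :: real \<Rightarrow> real \<Rightarrow> real^'n.
           (\<forall>\<epsilon>\<in>{0<..\<epsilon>0}. periodic_solution (\<lambda>t x. f t x + \<epsilon> *\<^sub>R g t x \<epsilon>) T (x \<epsilon>)) \<and>
           ((\<lambda>\<epsilon>. infdist (x \<epsilon> 0) (frontier U)) \<longlongrightarrow> 0) (at_right 0)"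
proof -
  have f_cont: "continuous_on UNIV (\<lambda>(t, x). f t x)" by (rule C1_on_imp_continuous_on[OF f_C1])
  obtain A :: "real \<times> (real^'n) \<Rightarrow> (real^'n) \<Rightarrow>\<^sub>L (real^'n)" where A: "continuous_on UNIV A"
    "\<And>t x. (f t has_derivative blinfun_apply (A (t, x))) (at x)"
    by (rule C1_on_partial_derivative[OF f_C1]) (rule that)
  have T0: "0 \<in> {0..T}" using T_pos by simp
  interpret averaging_system f g T A
    by unfold_locales (fact T_pos A f_cont g_cont f_extend[OF T0] perturbed_exists[OF T0] perturbed_unique[OF T0])+
  let ?P = "\<lambda>\<epsilon> \<xi>. sol \<epsilon> \<xi> T" and ?d = "\<lambda>\<xi>. infdist \<xi> (frontier U)" and ?\<Phi> = "averaging_operator f g T"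
  have P0: "poincare_map f T = ?P 0"
    by (rule ext) (simp add: poincare_map_def sol_def field_0)
  have cU: "compact (closure U)" using U_bounded by simp
  have frU: "frontier U \<subseteq> closure U" by (simp add: frontier_def)
  have c\<Phi>: "continuous_on ({0..T} \<times> closure U) (\<lambda>(s, \<xi>). ?\<Phi> s \<xi>)" by (rule averaging_operator_continuous[OF cU])
  have c\<Phi>0: "continuous_on (closure U) (?\<Phi> 0)"
  proof -
    have "continuous_on (closure U) (\<lambda>\<xi>. case (0, \<xi>) of (s, \<xi>) \<Rightarrow> ?\<Phi> s \<xi>)"
      by (rule continuous_on_compose2[OF c\<Phi>]) (use T0 in \<open>auto intro!: continuous_intros\<close>)
    then show ?thesis by simp
  qed
  have deg: "brouwer_degree (\<lambda>\<xi>. - ?\<Phi> 0 \<xi>) U = brouwer_degree (\<lambda>\<xi>. - ?\<Phi> T \<xi>) U"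
  proof (rule brouwer_degree_homotopy[OF U_open U_bounded])
    show "0 \<le> T" using T_pos by simp
    show "continuous_on ({0..T} \<times> closure U) (\<lambda>(s, \<xi>). - ?\<Phi> s \<xi>)"
      using continuous_on_minus[OF c\<Phi>] by (simp add: case_prod_unfold)
    show "- ?\<Phi> s \<xi> \<noteq> 0" if "s \<in> {0..T}" "\<xi> \<in> frontier U" for s \<xi>
      using averaging_nonzero[OF that] by simp
  qed
  obtain \<epsilon>1 where \<epsilon>1: "\<epsilon>1 \<in> {0<..1}" "\<And>\<epsilon>. \<epsilon> \<in> {0..\<epsilon>1} \<Longrightarrow> continuous_on (closure U) (?P \<epsilon>)"
    using poincare_continuous_near_0[OF cU] by blast
  have near: "\<exists>\<epsilon>0>0. \<forall>\<epsilon>\<in>{0<..\<epsilon>0}. \<exists>\<xi>\<in>U. ?P \<epsilon> \<xi> = \<xi> \<and> ?d \<xi> \<le> \<delta>" if "\<delta> > 0" for \<delta>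
  proof (rule fixed_points_near_frontier[OF U_open U_bounded \<epsilon>1(2) _ _ _ c\<Phi>0])
    show "\<epsilon>1 > 0" using \<epsilon>1(1) by simp
    show "?P 0 \<xi> = \<xi>" if "\<xi> \<in> frontier U" for \<xi> using frontier_fixed[OF that] by (simp only: P0)
    show "\<exists>\<delta>>0. \<forall>\<epsilon>\<in>{0..\<delta>}. \<forall>\<xi>\<in>closure U. norm (?P \<epsilon> \<xi> - ?P 0 \<xi> - \<epsilon> *\<^sub>R ?\<Phi> 0 \<xi>) \<le> \<kappa> * \<epsilon>"
      if "\<kappa> > 0" for \<kappa> using poincare_expansion[OF cU that] by force
    show "?\<Phi> 0 \<xi> \<noteq> 0" if "\<xi> \<in> frontier U" for \<xi> by (rule averaging_nonzero[OF T0 that])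
    show "?P 0 differentiable at a" for a by (rule poincare_differentiable)
    show "invertible (mat 1 - jacobian_matrix (?P 0) a)" if "a \<in> U" "?P 0 a = a" for a
      using nonsingular[unfolded P0, OF that] .
    show "finite {a \<in> U. ?P 0 a = a}" using finite_fixed[unfolded P0] .
    show "(\<Sum>a\<in>{a \<in> U. ?P 0 a = a}. fixed_point_index a (?P 0)) \<noteq> brouwer_degree (\<lambda>\<xi>. - ?\<Phi> 0 \<xi>) U"
      using index_sum[unfolded P0] unfolding deg .
  qed (use that in auto)
  \<comment> \<open>A choice for each \<open>\<epsilon>\<close> must not depend on \<open>\<delta>\<close>: take a fixed point almost nearest to the boundary.\<close>
  define Q where "Q \<epsilon> \<xi> \<longleftrightarrow> \<xi> \<in> U \<and> ?P \<epsilon> \<xi> = \<xi> \<and> (\<forall>\<zeta>\<in>U. ?P \<epsilon> \<zeta> = \<zeta> \<longrightarrow> ?d \<xi> \<le> ?d \<zeta> + \<epsilon>)" for \<epsilon> \<xi>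
  obtain \<epsilon>2 where \<epsilon>2: "\<epsilon>2 > 0" "\<And>\<epsilon>. \<epsilon> \<in> {0<..\<epsilon>2} \<Longrightarrow> \<exists>\<xi>\<in>U. ?P \<epsilon> \<xi> = \<xi> \<and> ?d \<xi> \<le> 1"
    using near[of 1] by auto
  define \<epsilon>0 where "\<epsilon>0 = min 1 \<epsilon>2"
  have e0: "\<epsilon>0 \<in> {0<..1}" "\<epsilon>0 \<le> \<epsilon>2" using \<epsilon>2(1) by (auto simp: \<epsilon>0_def)
  have "\<exists>\<xi>. Q \<epsilon> \<xi>" if e: "\<epsilon> \<in> {0<..\<epsilon>0}" for \<epsilon>
  proof -
    let ?S = "?d ` {\<xi> \<in> U. ?P \<epsilon> \<xi> = \<xi>}"
    have ne: "?S \<noteq> {}" using \<epsilon>2(2)[of \<epsilon>] e e0 by auto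
    have bd: "bdd_below ?S" by (rule bdd_belowI[of _ 0]) (auto simp: infdist_nonneg)
    have "Inf ?S < Inf ?S + \<epsilon>" using e by simp
    then obtain v where v: "v \<in> ?S" "v < Inf ?S + \<epsilon>" using cInf_less_iff[OF ne bd] by blast
    then obtain \<xi> where \<xi>: "\<xi> \<in> U" "?P \<epsilon> \<xi> = \<xi>" "?d \<xi> = v" by blast
    have "?d \<xi> \<le> ?d \<zeta> + \<epsilon>" if "\<zeta> \<in> U" "?P \<epsilon> \<zeta> = \<zeta>" for \<zeta>
    proof -
      have "Inf ?S \<le> ?d \<zeta>" by (rule cInf_lower[OF _ bd]) (use that in blast)
      then show ?thesis using v(2) \<xi>(3) by linarith
    qed
    then show ?thesis using \<xi> unfolding Q_def by blast
  qed
  then obtain z where z: "\<And>\<epsilon>. \<epsilon> \<in> {0<..\<epsilon>0} \<Longrightarrow> Q \<epsilon> (z \<epsilon>)" by metis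
  \<comment> \<open>Reduction of the time modulo \<open>T\<close>, because \<open>sol\<close> is
    meaningful on [0,T] only.\<close>
  define x where "x \<epsilon> t = sol \<epsilon> (z \<epsilon>) (t - T * of_int \<lfloor>t / T\<rfloor>)" for \<epsilon> t
  have x0: "x \<epsilon> 0 = z \<epsilon>" if "\<epsilon> \<in> {0<..\<epsilon>0}" for \<epsilon>
    unfolding x_def using sol_0[of \<epsilon> "z \<epsilon>"] that e0 by simp
  have "periodic_solution (\<lambda>t x. f t x + \<epsilon> *\<^sub>R g t x \<epsilon>) T (x \<epsilon>)" if e: "\<epsilon> \<in> {0<..\<epsilon>0}" for \<epsilon>
  proof -
    have e1: "\<epsilon> \<in> {0..1}" using e e0 by simp
    have eq: "field \<epsilon> = (\<lambda>t x. f t x + \<epsilon> *\<^sub>R g t x \<epsilon>)" by (intro ext) (simp add: field_def)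
    show ?thesis
      unfolding x_def[abs_def]
    proof (rule periodic_extension[OF T_pos])
      show "f (t + T) x + \<epsilon> *\<^sub>R g (t + T) x \<epsilon> = f t x + \<epsilon> *\<^sub>R g t x \<epsilon>" for t x
        by (simp add: f_periodic g_periodic[OF e1])
      show "ivp_solution (\<lambda>t x. f t x + \<epsilon> *\<^sub>R g t x \<epsilon>) T 0 (z \<epsilon>) (sol \<epsilon> (z \<epsilon>))"
        using sol_solution[OF e1, of "z \<epsilon>"] by (simp only: eq)
      show "sol \<epsilon> (z \<epsilon>) T = z \<epsilon>" using z[OF e] unfolding Q_def by blast
    qed
  qed
  moreover have "((\<lambda>\<epsilon>. ?d (x \<epsilon> 0)) \<longlongrightarrow> 0) (at_right 0)"
  proof (rule tendstoI)
    fix r :: real assume r: "r > 0"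
    then obtain \<epsilon>3 where \<epsilon>3: "\<epsilon>3 > 0" "\<And>\<epsilon>. \<epsilon> \<in> {0<..\<epsilon>3} \<Longrightarrow> \<exists>\<xi>\<in>U. ?P \<epsilon> \<xi> = \<xi> \<and> ?d \<xi> \<le> r / 2"
      using near[of "r / 2"] by auto
    \<comment> \<open>The slack \<epsilon> in \<open>Q\<close> stays below r/2, and a competing
      fixed point lies within r/2 of the frontier.\<close>
    have "dist (?d (x \<epsilon> 0)) 0 < r" if e: "0 < \<epsilon>" "\<epsilon> < min \<epsilon>0 (min \<epsilon>3 (r / 2))" for \<epsilon>
    proof -
      obtain \<xi> where \<xi>: "\<xi> \<in> U" "?P \<epsilon> \<xi> = \<xi>" "?d \<xi> \<le> r / 2" using \<epsilon>3(2)[of \<epsilon>] e by auto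
      have ee: "\<epsilon> \<in> {0<..\<epsilon>0}" using e by simp
      have "?d (z \<epsilon>) \<le> ?d \<xi> + \<epsilon>" using z[OF ee] \<xi>(1,2) unfolding Q_def by blast
      then have "?d (x \<epsilon> 0) < r" unfolding x0[OF ee] using \<xi>(3) e by simp
      then show ?thesis by (simp add: infdist_nonneg)
    qed
    moreover have "0 < min \<epsilon>0 (min \<epsilon>3 (r / 2))" using e0 \<epsilon>3 r by simp
    ultimately show "\<forall>\<^sub>F \<epsilon> in at_right 0. dist (?d (x \<epsilon> 0)) 0 < r"
      unfolding eventually_at_right_field by blast
  qed
  ultimately show ?thesis using e0(1) by blast
qed

end
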